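(* The rational homology of $M_{\mathrm{Gr}}$ is $$H_n(M_{\mathrm{Gr}};\mathbb{Q})\cong\begin{cases}\mathbb{Q}^2&n=0\\\mathbb{Q}&n=1\\0&n>1.\end{cases}$$
   Context: A graph is a finite graph; self-loops, multiple edges, vertices of any valence, disconnected graphs and the empty graph are allowed. $M_{\mathrm{Gr}}=|\overline{\mathcal{F}}_\bullet|$ is the geometric realization of the following simplicial set. An element of $\overline{\mathcal{F}}_p$ is an isomorphism class of pairs $(G;\ \emptyset=E_0\subset E_1\subset\cdots\subset E_p=E(G))$ where $G$ is a graph and the $E_j$ are subsets of its edge set. For $0<i<p$ the face $d_i$ omits $E_i$; $d_p$ replaces $G$ by the subgraph with the same vertices and edge set $E_{p-1}$ (deleting the other edges); $d_0$ replaces $G$ by the graph obtained by contracting all edges in $E_1$ (a contracted loop is simply removed), with the chain $E_j\setminus E_1$, $j\ge1$. Degeneracies repeat an $E_i$. (As a set, $M_{\mathrm{Gr}}$ is the set of isomorphism classes of graphs with a length in $(0,\infty)$ assigned to each edge; edges are contracted as their length tends to $0$ and deleted as their length tends to $\infty$.) *)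

theory Defs
  imports "HOL-Homology.Homology"
begin

section \<open>Finite multigraphs, deletion and contraction\<close>

text \<open>An edge is an abstract label; \<open>ends G e\<close> is the set of its one (for a self-loop) or two end
  points.  The values of \<open>ends G\<close> outside \<open>edges G\<close> are irrelevant; isomorphisms ignore them.\<close>

record ('v, 'e) multigraph =
  verts :: "'v set"
  edges :: "'e set"
  ends :: "'e \<Rightarrow> 'v set"

definition finite_multigraph :: "('v, 'e) multigraph \<Rightarrow> bool" where
  "finite_multigraph G \<longleftrightarrow>
     finite (verts G) \<and> finite (edges G) \<and>
     (\<forall>e\<in>edges G. ends G e \<subseteq> verts G \<and> card (ends G e) \<in> {1, 2})"

definition restrict_edges :: "('v, 'e) multigraph \<Rightarrow> 'e set \<Rightarrow> ('v, 'e) multigraph" where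
  "restrict_edges G S = G\<lparr>edges := S\<rparr>"

text \<open>\<open>connected_via G S\<close> relates the vertices in the same component of \<open>(verts G, S)\<close>.\<close>

definition connected_via :: "('v, 'e) multigraph \<Rightarrow> 'e set \<Rightarrow> ('v \<times> 'v) set" where
  "connected_via G S =
     {(u, v). \<exists>e\<in>S. ends G e = {u, v}}\<^sup>* \<inter> verts G \<times> verts G"

text \<open>All edges of \<open>S\<close> are contracted simultaneously: the new vertices are the components of
  \<open>(verts G, S)\<close>.  In particular loops in \<open>S\<close> simply disappear.\<close>

definition contract_edges :: "('v, 'e) multigraph \<Rightarrow> 'e set \<Rightarrow> ('v set, 'e) multigraph" where
  "contract_edges G S =
     \<lparr>verts = verts G // connected_via G S,
      edges = edges G - S,
      ends = (\<lambda>e. (\<lambda>v. connected_via G S `` {v}) ` ends G e)\<rparr>"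


section \<open>Simplicial sets and geometric realization\<close>

text \<open>\<open>face X p i\<close> is $d_i : X_p \to X_{p-1}$ and \<open>degen X p i\<close> is $s_i : X_p \to X_{p+1}$; only
  $0 \le i \le p$ matters, and $p \ge 1$ for faces.\<close>

record 'a simplicial_set =
  simplices :: "nat \<Rightarrow> 'a set"
  face :: "nat \<Rightarrow> nat \<Rightarrow> 'a \<Rightarrow> 'a"
  degen :: "nat \<Rightarrow> nat \<Rightarrow> 'a \<Rightarrow> 'a"

text \<open>The codegeneracy adds the coordinates \<open>i\<close> and \<open>i + 1\<close>.  The coface map is the library's
  \<^const>\<open>simplical_face\<close>, which inserts a zero at position \<open>i\<close>.\<close>

definition codegeneracy :: "nat \<Rightarrow> (nat \<Rightarrow> real) \<Rightarrow> nat \<Rightarrow> real" where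
  "codegeneracy i t =
     (\<lambda>j. if j < i then t j else if j = i then t i + t (Suc i) else t (Suc j))"

text \<open>A point \<open>((p, x), t)\<close> of the disjoint union lies in the copy indexed by \<open>x\<close> of the standard
  \<open>p\<close>-simplex.\<close>

inductive glue ::
  "'a simplicial_set \<Rightarrow> (nat \<times> 'a) \<times> (nat \<Rightarrow> real) \<Rightarrow> (nat \<times> 'a) \<times> (nat \<Rightarrow> real) \<Rightarrow> bool"
  for X where
  glue_face: "\<lbrakk>x \<in> simplices X (Suc p); i \<le> Suc p; t \<in> standard_simplex p\<rbrakk> \<Longrightarrow>
     glue X ((Suc p, x), simplical_face i t) ((p, face X (Suc p) i x), t)"
| glue_degen: "\<lbrakk>x \<in> simplices X p; i \<le> p; t \<in> standard_simplex (Suc p)\<rbrakk> \<Longrightarrow>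
     glue X ((Suc p, degen X p i x), t) ((p, x), codegeneracy i t)"

definition quotient_topology :: "'a topology \<Rightarrow> ('a \<Rightarrow> 'b) \<Rightarrow> 'b topology" where
  "quotient_topology T q =
     topology (\<lambda>U. U \<subseteq> q ` topspace T \<and> openin T {x \<in> topspace T. q x \<in> U})"

lemma openin_quotient_topology:
  "openin (quotient_topology T q) U \<longleftrightarrow>
     U \<subseteq> q ` topspace T \<and> openin T {x \<in> topspace T. q x \<in> U}"
proof -
  let ?P = "\<lambda>U. U \<subseteq> q ` topspace T \<and> openin T {x \<in> topspace T. q x \<in> U}"
  have Int: "?P (A \<inter> B)" if A: "?P A" and B: "?P B" for A B
  proof -
    have "{x \<in> topspace T. q x \<in> A \<inter> B} = {x \<in> topspace T. q x \<in> A} \<inter> {x \<in> topspace T. q x \<in> B}"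
      by auto
    moreover have "openin T ({x \<in> topspace T. q x \<in> A} \<inter> {x \<in> topspace T. q x \<in> B})"
      by (rule openin_Int) (simp_all only: A B)
    moreover have "A \<inter> B \<subseteq> q ` topspace T"
      using A by (simp only: le_infI1)
    ultimately show ?thesis
      by (simp only: simp_thms)
  qed
  have Union: "?P (\<Union>K)" if K: "\<forall>A\<in>K. ?P A" for K
  proof -
    have "{x \<in> topspace T. q x \<in> \<Union>K} = \<Union>((\<lambda>A. {x \<in> topspace T. q x \<in> A}) ` K)"
      by auto
    moreover have "openin T (\<Union>((\<lambda>A. {x \<in> topspace T. q x \<in> A}) ` K))"
      by (rule openin_Union) (use K in fast)
    moreover have "\<Union>K \<subseteq> q ` topspace T"
      by (rule Union_least) (use K in fast)
    ultimately show ?thesis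
      by (simp only: simp_thms)
  qed
  have "istopology ?P"
    unfolding istopology_def using Int Union by meson
  then show ?thesis
    unfolding quotient_topology_def by (simp only: topology_inverse')
qed

lemma topspace_quotient_topology: "topspace (quotient_topology T q) = q ` topspace T"
proof
  show "topspace (quotient_topology T q) \<subseteq> q ` topspace T"
    using openin_topspace[of "quotient_topology T q"] unfolding openin_quotient_topology by (rule conjunct1)
  have "{x \<in> topspace T. q x \<in> q ` topspace T} = topspace T"
    by auto
  then have "openin (quotient_topology T q) (q ` topspace T)"
    unfolding openin_quotient_topology by (simp only: openin_topspace order_refl simp_thms)
  then show "q ` topspace T \<subseteq> topspace (quotient_topology T q)"
    by (rule openin_subset)
qed

lemma quotient_map_quotient_topology: "quotient_map T (quotient_topology T q) q"
  unfolding quotient_map_def topspace_quotient_topology openin_quotient_topology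
  by (intro conjI allI impI refl) fast+

definition realization ::
  "'a simplicial_set \<Rightarrow> ((nat \<times> 'a) \<times> (nat \<Rightarrow> real)) set topology" where
  "realization X =
     quotient_topology
       (sum_topology (\<lambda>(p, x). subtopology (powertop_real UNIV) (standard_simplex p))
          (SIGMA p:UNIV. simplices X p))
       (\<lambda>z. {w. equivclp (glue X) z w})"


section \<open>The space of metric graphs\<close>

text \<open>A pair \<open>(G, [E\<^sub>0, \<dots>, E\<^sub>p])\<close> with \<open>{} = E\<^sub>0 \<subseteq> \<dots> \<subseteq> E\<^sub>p = edges G\<close>; the inclusions need not be
  strict.\<close>

fun flagged_graph :: "nat \<Rightarrow> ('v, 'e) multigraph \<times> 'e set list \<Rightarrow> bool" where
  "flagged_graph p (G, Es) \<longleftrightarrow>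
     finite_multigraph G \<and> length Es = Suc p \<and> Es ! 0 = {} \<and> Es ! p = edges G \<and>
     (\<forall>j<p. Es ! j \<subseteq> Es ! Suc j)"

fun flagged_iso ::
  "('v, 'e) multigraph \<times> 'e set list \<Rightarrow> ('w, 'f) multigraph \<times> 'f set list \<Rightarrow> bool" where
  "flagged_iso (G, Es) (H, Fs) \<longleftrightarrow>
     (\<exists>f g. bij_betw f (verts G) (verts H) \<and> bij_betw g (edges G) (edges H) \<and>
        (\<forall>e\<in>edges G. ends H (g e) = f ` ends G e) \<and>
        Fs = map ((`) g) Es)"

text \<open>Isomorphism classes are represented inside the pairs whose vertices and edges are natural
  numbers; every finite multigraph has such a copy.  The pair \<open>P\<close> itself may live on other types, as
  happens after a contraction.\<close>

type_synonym flag_class = "((nat, nat) multigraph \<times> nat set list) set"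

definition iso_class :: "('v, 'e) multigraph \<times> 'e set list \<Rightarrow> flag_class" where
  "iso_class P = {Q. flagged_iso P Q}"

definition graph_simplices :: "nat \<Rightarrow> flag_class set" where
  "graph_simplices p = iso_class ` {P :: (nat, nat) multigraph \<times> nat set list. flagged_graph p P}"

text \<open>The operations on a class are unions over its members, of sets that do not depend on
  the member.\<close>

definition graph_face :: "nat \<Rightarrow> nat \<Rightarrow> flag_class \<Rightarrow> flag_class" where
  "graph_face p i C =
     (\<Union>(G, Es)\<in>C.
        if i = 0 then
          iso_class (contract_edges G (Es ! 1), map (\<lambda>F. F - Es ! 1) (tl Es))
        else if i = p then
          iso_class (restrict_edges G (Es ! (p - 1)), butlast Es)
        else
          iso_class (G, take i Es @ drop (Suc i) Es))"

definition graph_degen :: "nat \<Rightarrow> nat \<Rightarrow> flag_class \<Rightarrow> flag_class" where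
  "graph_degen p i C = (\<Union>(G, Es)\<in>C. iso_class (G, take (Suc i) Es @ drop i Es))"

definition graph_simplicial_set :: "flag_class simplicial_set" where
  "graph_simplicial_set =
     \<lparr>simplices = graph_simplices, face = graph_face, degen = graph_degen\<rparr>"

definition M_Gr :: "((nat \<times> flag_class) \<times> (nat \<Rightarrow> real)) set topology" where
  "M_Gr = realization graph_simplicial_set"


section \<open>Singular homology with rational coefficients\<close>

text \<open>The library's singular homology has integer coefficients.  The following repeats its
  construction with rational coefficients, on the library's singular simplices and their faces,
  and keeps track of the scalar multiplication.\<close>

definition rat_ring :: "rat ring" where
  "rat_ring = \<lparr>carrier = UNIV, mult = (*), one = 1, zero = 0, add = (+)\<rparr>"

type_synonym 'a rat_chain = "((nat \<Rightarrow> real) \<Rightarrow> 'a) \<Rightarrow>\<^sub>0 rat"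

definition rat_chain_set :: "nat \<Rightarrow> 'a topology \<Rightarrow> 'a rat_chain set" where
  "rat_chain_set n X = {c. Poly_Mapping.keys c \<subseteq> singular_simplex_set n X}"

definition rat_chain_boundary :: "nat \<Rightarrow> 'a rat_chain \<Rightarrow> 'a rat_chain" where
  "rat_chain_boundary n c =
     (if n = 0 then 0
      else \<Sum>f\<in>Poly_Mapping.keys c. \<Sum>k\<le>n.
             Poly_Mapping.single (singular_face n k f) ((-1) ^ k * Poly_Mapping.lookup c f))"

definition rat_boundary_set :: "nat \<Rightarrow> 'a topology \<Rightarrow> 'a rat_chain set" where
  "rat_boundary_set n X = rat_chain_boundary (Suc n) ` rat_chain_set (Suc n) X"

text \<open>Modules are \<^type>\<open>module\<close> records, which extend rings; the ring multiplication and unit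
  are unused and left undefined.\<close>

definition rat_cycle_module :: "nat \<Rightarrow> 'a topology \<Rightarrow> (rat, 'a rat_chain) module" where
  "rat_cycle_module n X =
     \<lparr>carrier = {c \<in> rat_chain_set n X. rat_chain_boundary n c = 0},
      mult = undefined, one = undefined, zero = 0, add = (+),
      smult = (\<lambda>a. Poly_Mapping.map ((*) a))\<rparr>"

text \<open>Adding \<open>N\<close> in the scalar multiplication makes the result a full coset also when \<open>a\<close> is zero.\<close>

definition quotient_module :: "('r, 'm) module \<Rightarrow> 'm set \<Rightarrow> ('r, 'm set) module" where
  "quotient_module M N =
     \<lparr>carrier = a_rcosets\<^bsub>M\<^esub> N,
      mult = undefined, one = undefined, zero = N, add = (<+>\<^bsub>M\<^esub>),
      smult = (\<lambda>a A. N <+>\<^bsub>M\<^esub> ((\<lambda>x. a \<odot>\<^bsub>M\<^esub> x) ` A))\<rparr>"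

definition rat_homology :: "nat \<Rightarrow> 'a topology \<Rightarrow> (rat, 'a rat_chain set) module" where
  "rat_homology n X = quotient_module (rat_cycle_module n X) (rat_boundary_set n X)"

definition module_isomorphic ::
  "('r, 'k) ring_scheme \<Rightarrow> ('r, 'm) module \<Rightarrow> ('r, 'n) module \<Rightarrow> bool" where
  "module_isomorphic R M N \<longleftrightarrow>
     (\<exists>h \<in> iso (add_monoid M) (add_monoid N).
        \<forall>a\<in>carrier R. \<forall>x\<in>carrier M. h (a \<odot>\<^bsub>M\<^esub> x) = a \<odot>\<^bsub>N\<^esub> h x)"

text \<open>The vector space of \<open>k\<close>-tuples, as functions vanishing from \<open>k\<close> on.\<close>

definition rat_power :: "nat \<Rightarrow> (rat, nat \<Rightarrow> rat) module" where
  "rat_power k =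
     \<lparr>carrier = {v. \<forall>i\<ge>k. v i = 0},
      mult = undefined, one = undefined, zero = (\<lambda>_. 0), add = (\<lambda>v w i. v i + w i),
      smult = (\<lambda>a v i. a * v i)\<rparr>"

end

theory Submission
  imports Defs "HOL-Analysis.Abstract_Topological_Spaces" "HOL-Library.Multiset"
begin

text \<open>
  A point of the realization is a finite graph whose edges have lengths in \<open>[0, 1]\<close> (after rescaling
  \<open>[0, \<infinity>]\<close>), where edges of length \<open>0\<close> are contracted and edges of length \<open>1\<close> are deleted. Adding a
  complete graph on the vertices, with all new edges of the same length \<open>s\<close>, and moving \<open>s\<close> from \<open>1\<close>
  down to a small value deforms the graphs with \<open>n \<ge> 2\<close> vertices into a neighbourhood of the graphs
  with fewer vertices. By excision these graphs do not contribute to the homology, and the homology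
  of the nonempty graphs is that of the graphs with one vertex, the roses.

  A rose is a multiset of lengths, and its consecutive gaps form a finitely supported probability
  measure on \<open>\<int>\<close>. Since loops of length \<open>0\<close> or \<open>1\<close> may be added or removed, the measure is only
  defined up to translation. So the space of roses is a quotient of a contractible space by \<open>\<int>\<close>,
  and straight-line homotopies identify it with the circle up to homotopy. The empty graph
  is an isolated point. Finally, the integral homology groups are free and finitely generated, so
  the rational homology is obtained by clearing denominators.
\<close>

section \<open>Isomorphisms, contraction and flags\<close>

text \<open>The complete graph cannot be added continuously over the whole space. When an edge
  length tends to 0 and two vertices merge, the new edge between them survives as a loop of length
  \<open>s\<close> and the new edges to a third vertex become parallel, whereas the complete graph
  on the merged vertices has neither. So the homotopy \<open>connect\<close> is used only where the
  number of vertices is exactly \<open>n\<close>, and the graphs with fewer vertices must be cut out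
  before. Excision then asks for an open neighbourhood of these graphs in which the deformation
  ends. It is \<open>clusters_le (n - 1)\<close>: at most \<open>n - 1\<close> vertices remain once
  the edges shorter than 1/2 are contracted. Hence the two vertex counts \<open>zero_comps\<close>
  and \<open>short_comps\<close>; the first gives closed sets, the second open ones, and
  \<open>shrink\<close> carries the second kind into the first. The final \<open>s = 1/4\<close>
  lies strictly between 0, where vertices would merge, and 1/2, below which the new edges are short.
  The circle coordinate is the sum of the lengths modulo 1: for \<open>N\<close> lengths the gap
  measure has mean \<open>N\<close> minus their sum, and a translation changes the mean by an
  integer.\<close>

definition multigraph_iso ::
  "('v \<Rightarrow> 'w) \<Rightarrow> ('e \<Rightarrow> 'f) \<Rightarrow> ('v, 'e) multigraph \<Rightarrow> ('w, 'f) multigraph \<Rightarrow> bool" where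
  "multigraph_iso f g G H \<longleftrightarrow>
     bij_betw f (verts G) (verts H) \<and> bij_betw g (edges G) (edges H) \<and>
     (\<forall>e\<in>edges G. ends H (g e) = f ` ends G e)"

lemma flagged_iso_iff:
  "flagged_iso (G, Es) (H, Fs) \<longleftrightarrow> (\<exists>f g. multigraph_iso f g G H \<and> Fs = map ((`) g) Es)"
  by (simp add: multigraph_iso_def conj_assoc)

lemma flagged_isoI:
  "multigraph_iso f g G H \<Longrightarrow> Fs = map ((`) g) Es \<Longrightarrow> flagged_iso (G, Es) (H, Fs)"
  unfolding flagged_iso_iff by blast

lemma flagged_isoE:
  assumes "flagged_iso (G, Es) (H, Fs)"
  obtains f g where "multigraph_iso f g G H" "Fs = map ((`) g) Es"
  using assms unfolding flagged_iso_iff by blast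

declare flagged_iso.simps [simp del]

lemma multigraph_iso_comp:
  assumes "multigraph_iso f g G H" "multigraph_iso f' g' H K"
  shows "multigraph_iso (f' \<circ> f) (g' \<circ> g) G K"
  using assms bij_betw_trans[of f "verts G" "verts H" f' "verts K"]
    bij_betw_trans[of g "edges G" "edges H" g' "edges K"] bij_betw_apply[of g "edges G" "edges H"]
  by (simp add: multigraph_iso_def image_comp)

text \<open>The assumption on \<open>G\<close> enters through
  \<open>ends G e \<subseteq> verts G\<close>: only inside \<open>verts G\<close> does the inverse
  of \<open>f\<close> undo \<open>f\<close> on the set of ends.\<close>

lemma multigraph_iso_inv:
  assumes "multigraph_iso f g G H" "finite_multigraph G"
  shows "multigraph_iso (inv_into (verts G) f) (inv_into (edges G) g) H G"
proof -
  have f: "bij_betw f (verts G) (verts H)" and g: "bij_betw g (edges G) (edges H)"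
    and ends: "\<And>e. e \<in> edges G \<Longrightarrow> ends H (g e) = f ` ends G e"
    using assms(1) by (auto simp: multigraph_iso_def)
  have "ends G (inv_into (edges G) g e) = inv_into (verts G) f ` ends H e" if "e \<in> edges H"
    for e
  proof -
    let ?e = "inv_into (edges G) g e"
    have e: "?e \<in> edges G" "g ?e = e"
      using g that by (auto simp: bij_betw_def inv_into_into f_inv_into_f)
    have "ends G ?e \<subseteq> verts G"
      using assms(2) e(1) by (auto simp: finite_multigraph_def)
    then show ?thesis
      using ends[OF e(1)] f inv_into_image_cancel[of f "verts G" "ends G ?e"] e(2)
      by (simp add: bij_betw_def)
  qed
  then show ?thesis
    using f g by (simp add: multigraph_iso_def bij_betw_inv_into)
qed

lemma finite_multigraph_iso:
  assumes "multigraph_iso f g G H" "finite_multigraph G"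
  shows "finite_multigraph H"
proof -
  have f: "inj_on f (verts G)" "verts H = f ` verts G" and g: "edges H = g ` edges G"
    and ends: "\<And>e. e \<in> edges G \<Longrightarrow> ends H (g e) = f ` ends G e"
    using assms(1) by (auto simp: multigraph_iso_def bij_betw_def)
  have "ends H (g e) \<subseteq> verts H \<and> card (ends H (g e)) \<in> {1, 2}"
    if "e \<in> edges G" for e
  proof -
    have *: "ends G e \<subseteq> verts G" "card (ends G e) \<in> {1, 2}"
      using assms(2) that by (auto simp: finite_multigraph_def)
    have "card (f ` ends G e) = card (ends G e)"
      by (rule card_image[OF inj_on_subset[OF f(1) *(1)]])
    then show ?thesis
      using *(2) image_mono[OF *(1), of f] unfolding f(2) ends[OF that] by simp
  qed
  then show ?thesis
    using assms(2) unfolding finite_multigraph_def f(2) g by blast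
qed

section \<open>Components of a graph restricted to a set of edges, and contraction\<close>

definition adjacent :: "('v, 'e) multigraph \<Rightarrow> 'e set \<Rightarrow> ('v \<times> 'v) set" where
  "adjacent G S = {(u, v). \<exists>e\<in>S. ends G e = {u, v}}"

lemma adjacent_iff: "(u, v) \<in> adjacent G S \<longleftrightarrow> (\<exists>e\<in>S. ends G e = {u, v})"
  by (simp add: adjacent_def)

lemma sym_adjacent: "sym (adjacent G S)"
  by (rule symI) (simp add: adjacent_iff insert_commute)

lemma connected_via_iff:
  "(u, v) \<in> connected_via G S \<longleftrightarrow> u \<in> verts G \<and> v \<in> verts G \<and> (u, v) \<in> (adjacent G S)\<^sup>*"
  unfolding connected_via_def adjacent_def[symmetric] Int_iff mem_Times_iff fst_conv snd_conv
  by (rule iffI; elim conjE; intro conjI; assumption)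

lemma connected_via_trans:
  "(u, v) \<in> connected_via G S \<Longrightarrow> (v, w) \<in> connected_via G S \<Longrightarrow> (u, w) \<in> connected_via G S"
  unfolding connected_via_iff
  by (elim conjE, intro conjI; (rule rtrancl_trans)?; assumption)

lemma connected_via_sym: "(u, v) \<in> connected_via G S \<Longrightarrow> (v, u) \<in> connected_via G S"
  unfolding connected_via_iff
  by (elim conjE, intro conjI; (rule symD[OF sym_rtrancl[OF sym_adjacent]])?; assumption)

lemma connected_via_refl: "v \<in> verts G \<Longrightarrow> (v, v) \<in> connected_via G S"
  unfolding connected_via_iff by (intro conjI; (rule rtrancl_refl)?; assumption)

lemma equiv_connected_via: "equiv (verts G) (connected_via G S)"
proof (rule equivI)
  show "connected_via G S \<subseteq> verts G \<times> verts G"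
    unfolding connected_via_def by (rule Int_lower2)
  show "refl_on (verts G) (connected_via G S)"
    by (rule refl_onI) (rule connected_via_refl)
  show "sym (connected_via G S)"
    by (rule symI) (rule connected_via_sym)
  show "trans (connected_via G S)"
    by (rule transI) (rule connected_via_trans)
qed

lemma connected_via_mono: "S \<subseteq> T \<Longrightarrow> connected_via G S \<subseteq> connected_via G T"
  unfolding connected_via_def adjacent_def[symmetric]
  by (intro Int_mono rtrancl_mono subset_refl subrelI)
    (unfold adjacent_iff, erule bexE, rule bexI, assumption, erule (1) subsetD)

lemma connected_via_edge:
  assumes "e \<in> S" "ends G e = {u, v}" "{u, v} \<subseteq> verts G"
  shows "(u, v) \<in> connected_via G S"
proof -
  have "(u, v) \<in> adjacent G S"
    using assms(1,2) unfolding adjacent_iff by (intro bexI[of _ e])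
  then show ?thesis
    using assms(3) by (simp add: connected_via_iff r_into_rtrancl)
qed

text \<open>Induction along a walk. The closure in \<open>connected_via\<close> is cut down to
  \<open>verts G\<close> only at its two ends; \<open>finite_multigraph G\<close> and
  \<open>S \<subseteq> edges G\<close> keep the intermediate vertices inside as well.\<close>

lemma connected_via_induct [consumes 3, case_names base step]:
  assumes uv: "(u, v) \<in> connected_via G S" and G: "finite_multigraph G" and S: "S \<subseteq> edges G"
    and base: "P u"
    and step: "\<And>x y e. (u, x) \<in> connected_via G S \<Longrightarrow> P x \<Longrightarrow> e \<in> S \<Longrightarrow> ends G e = {x, y} \<Longrightarrow>
      x \<in> verts G \<Longrightarrow> y \<in> verts G \<Longrightarrow> P y"
  shows "P v"
proof -
  have u: "u \<in> verts G" and *: "(u, v) \<in> (adjacent G S)\<^sup>*"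
    using uv unfolding connected_via_iff by simp_all
  from * have "P v \<and> (u, v) \<in> connected_via G S"
  proof (induction rule: rtrancl_induct)
    case base
    show ?case using assms(4) connected_via_refl[OF u, of S] by simp
  next
    case (step x y)
    then obtain e where e: "e \<in> S" "ends G e = {x, y}"
      unfolding adjacent_iff by (elim bexE)
    then have "{x, y} \<subseteq> verts G"
      using G S unfolding finite_multigraph_def by blast
    have ux: "P x" "(u, x) \<in> connected_via G S"
      using step.IH by auto
    have "(u, y) \<in> connected_via G S"
      by (rule connected_via_trans[OF ux(2) connected_via_edge[OF e \<open>{x, y} \<subseteq> verts G\<close>]])
    moreover have "P y"
      using assms(5)[OF ux(2,1) e] \<open>{x, y} \<subseteq> verts G\<close> by simp
    ultimately show ?case by simp
  qed
  then show ?thesis ..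
qed

lemma connected_via_map:
  assumes "(u, v) \<in> connected_via G S" "finite_multigraph G" "S \<subseteq> edges G"
    and f: "f ` verts G \<subseteq> verts H"
    and fe: "\<And>e x y. e \<in> S \<Longrightarrow> ends G e = {x, y} \<Longrightarrow> (f x, f y) \<in> connected_via H T"
  shows "(f u, f v) \<in> connected_via H T"
  using assms(1-3)
proof (induction rule: connected_via_induct)
  case base
  have "f u \<in> verts H" using assms(1) f by (auto simp: connected_via_iff)
  then show ?case by (rule connected_via_refl)
next
  case (step x y e)
  show ?case by (rule connected_via_trans[OF \<open>(f u, f x) \<in> connected_via H T\<close>
        fe[OF \<open>e \<in> S\<close> \<open>ends G e = {x, y}\<close>]])
qed

lemma connected_via_iso:
  assumes iso: "multigraph_iso f g G H" and G: "finite_multigraph G" and S: "S \<subseteq> edges G"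
    and "u \<in> verts G" "v \<in> verts G"
  shows "(f u, f v) \<in> connected_via H (g ` S) \<longleftrightarrow> (u, v) \<in> connected_via G S"
proof
  have f: "bij_betw f (verts G) (verts H)" and g: "bij_betw g (edges G) (edges H)"
    and ends: "\<And>e. e \<in> edges G \<Longrightarrow> ends H (g e) = f ` ends G e"
    using iso by (auto simp: multigraph_iso_def)
  note H = finite_multigraph_iso[OF iso G]
  have vH: "ends H e \<subseteq> verts H" if "e \<in> edges H" for e
    using H that by (auto simp: finite_multigraph_def)
  have vG: "ends G e \<subseteq> verts G" if "e \<in> edges G" for e
    using G that by (auto simp: finite_multigraph_def)
  {
    assume "(u, v) \<in> connected_via G S"
    then show "(f u, f v) \<in> connected_via H (g ` S)"
    proof (rule connected_via_map[OF _ G S])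
      show "f ` verts G \<subseteq> verts H"
        using f by (auto simp: bij_betw_def)
      show "(f x, f y) \<in> connected_via H (g ` S)" if "e \<in> S" "ends G e = {x, y}" for e x y
      proof (rule connected_via_edge)
        have e: "e \<in> edges G" using that S by auto
        show "g e \<in> g ` S" using that by simp
        show "ends H (g e) = {f x, f y}" using ends[OF e] that by simp
        then show "{f x, f y} \<subseteq> verts H"
          using vH[of "g e"] e g by (simp add: bij_betw_apply)
      qed
    qed
  }
  assume *: "(f u, f v) \<in> connected_via H (g ` S)"
  have gS: "g ` S \<subseteq> edges H"
    using g S by (auto simp: bij_betw_def)
  let ?f = "inv_into (verts G) f"
  have "(?f (f u), ?f (f v)) \<in> connected_via G S"
    using * H gS
  proof (rule connected_via_map)
    show "?f ` verts H \<subseteq> verts G"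
      using f by (auto simp: bij_betw_def inv_into_into)
    show "(?f x, ?f y) \<in> connected_via G S" if "e \<in> g ` S" "ends H e = {x, y}" for e x y
    proof -
      obtain d where d: "d \<in> S" "e = g d" using \<open>e \<in> g ` S\<close> by auto
      have "ends G d = ?f ` ends H e"
        using d S ends[of d] vG[of d] inv_into_image_cancel[of f "verts G" "ends G d"] f
        by (metis bij_betw_def subsetD)
      then show ?thesis
        using d S that(2) vG[of d] by (intro connected_via_edge[of d]) auto
    qed
  qed
  then show "(u, v) \<in> connected_via G S"
    using f assms(4,5) by (simp add: bij_betw_def)
qed

lemma multigraph_iso_restrict:
  assumes "multigraph_iso f g G H" "S \<subseteq> edges G"
  shows "multigraph_iso f g (restrict_edges G S) (restrict_edges H (g ` S))"
  using assms bij_betw_subset[of g "edges G" "edges H" S "g ` S"]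
  by (simp add: multigraph_iso_def restrict_edges_def subset_iff)

lemma quotient_as_image: "A // r = (\<lambda>v. r `` {v}) ` A"
  by (auto simp: quotient_def)

lemma image_connected_via_class:
  assumes "multigraph_iso f g G H" "finite_multigraph G" "S \<subseteq> edges G" "v \<in> verts G"
  shows "f ` (connected_via G S `` {v}) = connected_via H (g ` S) `` {f v}"
proof -
  have f: "bij_betw f (verts G) (verts H)"
    using assms(1) by (auto simp: multigraph_iso_def)
  have "x \<in> f ` (connected_via G S `` {v})" if "(f v, x) \<in> connected_via H (g ` S)" for x
  proof -
    have "x \<in> verts H" using that by (simp add: connected_via_iff)
    then obtain u where "u \<in> verts G" "x = f u"
      using f by (auto simp: bij_betw_def)
    then show ?thesis
      using that connected_via_iso[OF assms(1-3) assms(4), of u] by auto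
  qed
  moreover have "(f v, f u) \<in> connected_via H (g ` S)" if "(v, u) \<in> connected_via G S" for u
    using that connected_via_iso[OF assms(1-3) assms(4), of u] by (simp add: connected_via_iff)
  ultimately show ?thesis by auto
qed

text \<open>A contraction that keeps the edges of \<open>S\<close> as loops. The edge set is then
  the same for all \<open>S\<close>, so the lengths stay indexed by the same edges while the set of
  zero edges varies with them.\<close>

definition collapse :: "('v, 'e) multigraph \<Rightarrow> 'e set \<Rightarrow> ('v set, 'e) multigraph" where
  "collapse G S =
     \<lparr>verts = verts G // connected_via G S,
      edges = edges G,
      ends = (\<lambda>e. (\<lambda>v. connected_via G S `` {v}) ` ends G e)\<rparr>"

lemma contract_edges_eq: "contract_edges G S = restrict_edges (collapse G S) (edges G - S)"
  by (simp add: contract_edges_def restrict_edges_def collapse_def)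

lemma multigraph_iso_collapse:
  assumes iso: "multigraph_iso f g G H" and G: "finite_multigraph G" and S: "S \<subseteq> edges G"
  shows "multigraph_iso ((`) f) g (collapse G S) (collapse H (g ` S))"
proof -
  have f: "bij_betw f (verts G) (verts H)" and g: "bij_betw g (edges G) (edges H)"
    and ends: "\<And>e. e \<in> edges G \<Longrightarrow> ends H (g e) = f ` ends G e"
    using iso by (auto simp: multigraph_iso_def)
  have img: "f ` (connected_via G S `` {v}) = connected_via H (g ` S) `` {f v}" if "v \<in> verts G"
    for v
    using image_connected_via_class[OF assms that] .
  have "inj_on ((`) f) (verts G // connected_via G S)"
  proof (rule inj_on_image, rule inj_on_subset)
    show "inj_on f (verts G)" using f by (simp add: bij_betw_def)
    show "\<Union> (verts G // connected_via G S) \<subseteq> verts G"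
      by (auto simp: quotient_def connected_via_def)
  qed
  moreover have "(`) f ` (verts G // connected_via G S) = verts H // connected_via H (g ` S)"
  proof -
    have "verts H = f ` verts G" using f by (simp add: bij_betw_def)
    then show ?thesis
      using img by (simp add: quotient_as_image image_image cong: image_cong)
  qed
  ultimately have 1: "bij_betw ((`) f) (verts G // connected_via G S) (verts H // connected_via H (g ` S))"
    by (simp add: bij_betw_def)
  have 3: "(\<lambda>v. connected_via H (g ` S) `` {v}) ` ends H (g e)
      = (`) f ` (\<lambda>v. connected_via G S `` {v}) ` ends G e" if "e \<in> edges G" for e
  proof -
    have "ends G e \<subseteq> verts G" using G that by (auto simp: finite_multigraph_def)
    then have "(\<lambda>v. connected_via H (g ` S) `` {f v}) ` ends G e
      = (\<lambda>v. f ` (connected_via G S `` {v})) ` ends G e"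
      using img by (intro image_cong) auto
    then show ?thesis
      using ends[OF that] by (simp add: image_image)
  qed
  show ?thesis
    using 1 g 3 unfolding multigraph_iso_def collapse_def by simp
qed

lemma multigraph_iso_contract:
  assumes "multigraph_iso f g G H" and "finite_multigraph G" and S: "S \<subseteq> edges G"
  shows "multigraph_iso ((`) f) g (contract_edges G S) (contract_edges H (g ` S))"
proof -
  have "inj_on g (edges G)" "edges H = g ` edges G"
    using assms(1) by (auto simp: multigraph_iso_def bij_betw_def)
  then have "g ` (edges G - S) = edges H - g ` S"
    using inj_on_image_set_diff[of g "edges G" "edges G" S] S by simp
  then show ?thesis
    using multigraph_iso_restrict[OF multigraph_iso_collapse[OF assms], of "edges G - S"]
    by (simp add: contract_edges_eq collapse_def)
qed

lemma finite_restrict_edges: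
  "finite_multigraph G \<Longrightarrow> S \<subseteq> edges G \<Longrightarrow> finite_multigraph (restrict_edges G S)"
  by (auto simp: finite_multigraph_def restrict_edges_def finite_subset)

lemma card_image_1_2:
  assumes "card A \<in> {1, 2}"
  shows "card (f ` A) \<in> {1, 2}"
proof -
  have "finite A" "A \<noteq> {}" using assms card.infinite by fastforce+
  then have "card (f ` A) \<noteq> 0" "card (f ` A) \<le> card A" by (auto simp: card_image_le)
  then show ?thesis using assms by auto
qed

lemma finite_collapse:
  assumes G: "finite_multigraph G"
  shows "finite_multigraph (collapse G S)"
  unfolding finite_multigraph_def
proof (intro conjI ballI)
  show "finite (verts (collapse G S))" "finite (edges (collapse G S))"
    using G by (simp_all add: collapse_def quotient_as_image finite_multigraph_def)
  fix e assume "e \<in> edges (collapse G S)"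
  then have "ends G e \<subseteq> verts G" "card (ends G e) \<in> {1, 2}"
    using G by (simp_all add: collapse_def finite_multigraph_def)
  then show "ends (collapse G S) e \<subseteq> verts (collapse G S)"
    "card (ends (collapse G S) e) \<in> {1, 2}"
    using card_image_1_2[of "ends G e" "\<lambda>v. connected_via G S `` {v}"]
    by (simp_all add: collapse_def quotient_as_image image_mono)
qed

lemma finite_contract_edges:
  assumes "finite_multigraph G"
  shows "finite_multigraph (contract_edges G S)"
  unfolding contract_edges_eq
  by (rule finite_restrict_edges[OF finite_collapse[OF assms]]) (simp add: collapse_def)

section \<open>Flags of edge sets, and the simplicial operators evaluated on a
  representative\<close>

lemma flagged_graph_mono:
  assumes "flagged_graph p (G, Es)" "j \<le> k" "k \<le> p"
  shows "Es ! j \<subseteq> Es ! k"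
  using assms(2,3)
proof (induction k)
  case (Suc k)
  then show ?case
    using assms(1) by (cases "j = Suc k") (auto simp: subset_iff)
qed auto

lemma flagged_graph_subset:
  assumes "flagged_graph p (G, Es)" "F \<in> set Es"
  shows "F \<subseteq> edges G"
proof -
  obtain j where "j \<le> p" "F = Es ! j"
    using assms by (auto simp: in_set_conv_nth less_Suc_eq_le)
  then show ?thesis
    using flagged_graph_mono[OF assms(1), of j p] assms(1) by auto
qed

lemma flagged_iso_trans:
  assumes "flagged_iso P Q" "flagged_iso Q R"
  shows "flagged_iso P R"
proof -
  obtain G Es H Fs K Ds where [simp]: "P = (G, Es)" "Q = (H, Fs)" "R = (K, Ds)"
    by (cases P; cases Q; cases R)
  obtain f g f' g' where "multigraph_iso f g G H" "Fs = map ((`) g) Es"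
    "multigraph_iso f' g' H K" "Ds = map ((`) g') Fs"
    using assms by (auto simp: flagged_iso_iff)
  moreover from this have "Ds = map ((`) (g' \<circ> g)) Es"
    by (simp add: image_comp)
  ultimately show ?thesis
    using multigraph_iso_comp[of f g G H f' g' K] unfolding flagged_iso_iff \<open>P = (G, Es)\<close> \<open>R = (K, Ds)\<close>
    by blast
qed

text \<open>The sets of a flag lie in \<open>edges G\<close>, where \<open>g\<close> is injective,
  so the inverse of \<open>g\<close> recovers them from their images. This is what the flag
  hypothesis on \<open>P\<close> provides.\<close>

lemma flagged_iso_sym:
  assumes "flagged_graph p P" "flagged_iso P Q"
  shows "flagged_iso Q P"
proof -
  obtain G Es H Fs where [simp]: "P = (G, Es)" "Q = (H, Fs)"
    by (cases P; cases Q)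
  obtain f g where fg: "multigraph_iso f g G H" "Fs = map ((`) g) Es"
    using assms by (auto simp: flagged_iso_iff)
  have P: "flagged_graph p (G, Es)" using assms(1) by simp
  then have G: "finite_multigraph G" by simp
  have "inv_into (edges G) g ` g ` F = F" if "F \<in> set Es" for F
    using flagged_graph_subset[OF P that] fg(1)
    by (auto simp: multigraph_iso_def bij_betw_def inv_into_image_cancel)
  then have "Es = map ((`) (inv_into (edges G) g)) Fs"
    using fg(2) by (simp add: map_idI o_def)
  then show ?thesis
    using multigraph_iso_inv[OF fg(1) G]
    by (auto simp: flagged_iso_iff)
qed

lemma flagged_iso_flagged_graph:
  assumes "flagged_graph p P" "flagged_iso P Q"
  shows "flagged_graph p Q"
proof -
  obtain G Es H Fs where [simp]: "P = (G, Es)" "Q = (H, Fs)"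
    by (cases P; cases Q)
  obtain f g where fg: "multigraph_iso f g G H" "Fs = map ((`) g) Es"
    using assms by (auto simp: flagged_iso_iff)
  have "finite_multigraph H"
    using finite_multigraph_iso[OF fg(1)] assms(1) by simp
  then show ?thesis
    using assms(1) fg(2) image_mono[of "Es ! j" "Es ! Suc j" g for j] fg(1)
    by (simp add: multigraph_iso_def bij_betw_def)
qed

lemma iso_class_eq:
  assumes "flagged_graph p P" "flagged_iso P Q"
  shows "iso_class P = iso_class Q"
proof -
  have "flagged_iso P R \<longleftrightarrow> flagged_iso Q R"
    for R :: "(nat, nat) multigraph \<times> nat set list"
    using flagged_iso_trans[OF flagged_iso_sym[OF assms], of R] flagged_iso_trans[OF assms(2), of R]
    by metis
  then show ?thesis
    by (simp add: iso_class_def)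
qed

lemma ex_nat_multigraph_iso:
  assumes "finite_multigraph G"
  obtains f g and H :: "(nat, nat) multigraph" where "multigraph_iso f g G H"
proof -
  obtain f :: "'a \<Rightarrow> nat" and g :: "'b \<Rightarrow> nat"
    where f: "bij_betw f (verts G) {0..<card (verts G)}" and g: "bij_betw g (edges G) {0..<card (edges G)}"
    using assms ex_bij_betw_finite_nat by (metis finite_multigraph_def)
  let ?H = "\<lparr>verts = {0..<card (verts G)}, edges = {0..<card (edges G)},
    ends = (\<lambda>d. f ` ends G (inv_into (edges G) g d))\<rparr>"
  have "multigraph_iso f g G ?H"
    using f g by (simp add: multigraph_iso_def bij_betw_def)
  then show ?thesis by (rule that)
qed

lemma ex_nat_flagged_iso:
  assumes "flagged_graph p P"
  obtains Q :: "(nat, nat) multigraph \<times> nat set list" where "flagged_iso P Q"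
proof -
  obtain G Es where [simp]: "P = (G, Es)" by (cases P)
  have "finite_multigraph G" using assms by simp
  then obtain f g and H :: "(nat, nat) multigraph" where "multigraph_iso f g G H"
    by (rule ex_nat_multigraph_iso)
  then have "flagged_iso P (H, map ((`) g) Es)"
    by (auto simp: flagged_iso_iff)
  then show ?thesis using that by blast
qed

lemma iso_class_in_graph_simplices:
  assumes "flagged_graph p P"
  shows "iso_class P \<in> graph_simplices p"
proof -
  obtain Q :: "(nat, nat) multigraph \<times> nat set list" where Q: "flagged_iso P Q"
    using ex_nat_flagged_iso[OF assms] .
  then show ?thesis
    using iso_class_eq[OF assms Q] flagged_iso_flagged_graph[OF assms Q]
    by (auto simp: graph_simplices_def)
qed

lemma flagged_graph_contract:
  assumes "flagged_graph (Suc p) (G, Es)"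
  shows "flagged_graph p (contract_edges G (Es ! 1), map (\<lambda>F. F - Es ! 1) (tl Es))"
proof -
  have len: "length Es = Suc (Suc p)" using assms by simp
  then show ?thesis
    using assms finite_contract_edges[of G]
    by (auto simp: nth_tl contract_edges_def)
qed

lemma flagged_graph_restrict:
  assumes "flagged_graph (Suc p) (G, Es)"
  shows "flagged_graph p (restrict_edges G (Es ! p), butlast Es)"
proof -
  have "Es ! p \<subseteq> edges G"
    using flagged_graph_subset[OF assms, of "Es ! p"] assms by simp
  then have "finite_multigraph (restrict_edges G (Es ! p))"
    using assms finite_restrict_edges[of G] by simp
  then show ?thesis
    using assms by (auto simp: nth_butlast restrict_edges_def)
qed

lemma flagged_graph_drop_nth:
  assumes "flagged_graph (Suc p) (G, Es)" "0 < i" "i \<le> p"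
  shows "flagged_graph p (G, take i Es @ drop (Suc i) Es)"
proof -
  let ?Ds = "take i Es @ drop (Suc i) Es"
  have nth: "?Ds ! j = (if j < i then Es ! j else Es ! Suc j)" if "j \<le> p" for j
    using assms that by (auto simp: nth_append)
  have "?Ds ! j \<subseteq> ?Ds ! Suc j" if "j < p" for j
    using that nth[of j] nth[of "Suc j"] flagged_graph_mono[OF assms(1)] by auto
  moreover have "?Ds ! 0 = {}" "?Ds ! p = edges G"
    using assms nth[of 0] nth[of p] by auto
  ultimately show ?thesis
    using assms by (simp add: min_def)
qed

lemma flagged_graph_repeat_nth:
  assumes "flagged_graph p (G, Es)" "i \<le> p"
  shows "flagged_graph (Suc p) (G, take (Suc i) Es @ drop i Es)"
proof -
  let ?Ds = "take (Suc i) Es @ drop i Es"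
  have nth: "?Ds ! j = (if j \<le> i then Es ! j else Es ! (j - 1))" if "j \<le> Suc p" for j
    using assms that by (auto simp: nth_append min_def)
  have "?Ds ! j \<subseteq> ?Ds ! Suc j" if "j < Suc p" for j
    using that nth[of j] nth[of "Suc j"] flagged_graph_mono[OF assms(1)] assms(2) by auto
  moreover have "?Ds ! 0 = {}" "?Ds ! Suc p = edges G"
    using assms nth[of 0] nth[of "Suc p"] by auto
  ultimately show ?thesis
    using assms by (simp add: min_def)
qed

text \<open>Reduces the unions in \<open>graph_face\<close> and \<open>graph_degen\<close> to the
  value at one representative. The union is not empty because a finite graph on any types has a copy
  on the natural numbers.\<close>

lemma UN_iso_class:
  assumes P: "flagged_graph p P"
    and "\<And>Q. flagged_iso P Q \<Longrightarrow> F Q = A"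
  shows "(\<Union>Q\<in>iso_class P. F Q) = A"
proof -
  have "iso_class P \<noteq> {}"
    using ex_nat_flagged_iso[OF P] by (metis Collect_empty_eq iso_class_def)
  then show ?thesis
    using assms(2) by (auto simp: iso_class_def)
qed

lemma graph_face_0:
  assumes P: "flagged_graph (Suc p) (G, Es)"
  shows "graph_face (Suc p) 0 (iso_class (G, Es))
    = iso_class (contract_edges G (Es ! 1), map (\<lambda>F. F - Es ! 1) (tl Es))"
  unfolding graph_face_def if_True simp_thms
proof (rule UN_iso_class[OF P], clarify)
  fix H Fs assume "flagged_iso (G, Es) (H :: (nat, nat) multigraph, Fs)"
  then obtain f g where fg: "multigraph_iso f g G H" "Fs = map ((`) g) Es"
    by (auto simp: flagged_iso_iff)
  have len: "length Es = Suc (Suc p)" and G: "finite_multigraph G" using P by simp_all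
  have S: "Es ! 1 \<subseteq> edges G" using flagged_graph_subset[OF P] len by simp
  have F1: "Fs ! 1 = g ` Es ! 1" using len fg(2) by simp
  have "g ` F - g ` Es ! 1 = g ` (F - Es ! 1)" if "F \<in> set (tl Es)" for F
  proof -
    have "F \<subseteq> edges G" using that flagged_graph_subset[OF P] list.set_sel(2)[of Es F] len
      by fastforce
    moreover have "inj_on g (edges G)"
      using fg(1) by (simp add: multigraph_iso_def bij_betw_def)
    ultimately show ?thesis
      using S inj_on_image_set_diff[of g "edges G" F "Es ! 1"] by blast
  qed
  then have "map (\<lambda>F. F - Fs ! 1) (tl Fs) = map ((`) g) (map (\<lambda>F. F - Es ! 1) (tl Es))"
    unfolding F1 using fg(2) by (auto simp: map_tl[symmetric])
  then have "flagged_iso (contract_edges G (Es ! 1), map (\<lambda>F. F - Es ! 1) (tl Es))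
     (contract_edges H (Fs ! 1), map (\<lambda>F. F - Fs ! 1) (tl Fs))"
    using multigraph_iso_contract[OF fg(1) G S] F1
    by (auto simp: flagged_iso_iff)
  then show "iso_class (contract_edges H (Fs ! 1), map (\<lambda>F. F - Fs ! 1) (tl Fs))
    = iso_class (contract_edges G (Es ! 1), map (\<lambda>F. F - Es ! 1) (tl Es))"
    by (rule iso_class_eq[OF flagged_graph_contract[OF P], symmetric])
qed

lemma graph_face_last:
  assumes P: "flagged_graph (Suc p) (G, Es)"
  shows "graph_face (Suc p) (Suc p) (iso_class (G, Es)) = iso_class (restrict_edges G (Es ! p), butlast Es)"
proof -
  have *: "graph_face (Suc p) (Suc p) (iso_class (G, Es))
    = (\<Union>(H, Fs)\<in>iso_class (G, Es). iso_class (restrict_edges H (Fs ! p), butlast Fs))"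
    by (simp add: graph_face_def)
  show ?thesis
    unfolding *
  proof (rule UN_iso_class[OF P], clarify)
    fix H Fs assume "flagged_iso (G, Es) (H :: (nat, nat) multigraph, Fs)"
    then obtain f g where fg: "multigraph_iso f g G H" "Fs = map ((`) g) Es"
      by (auto simp: flagged_iso_iff)
    have len: "length Es = Suc (Suc p)" using P by simp
    have S: "Es ! p \<subseteq> edges G" using flagged_graph_subset[OF P] len by simp
    have F: "Fs ! p = g ` Es ! p" using len fg(2) by simp
    have "flagged_iso (restrict_edges G (Es ! p), butlast Es) (restrict_edges H (Fs ! p), butlast Fs)"
      by (rule flagged_isoI[OF multigraph_iso_restrict[OF fg(1) S, folded F]]) (simp add: fg(2) map_butlast)
    then show "iso_class (restrict_edges H (Fs ! p), butlast Fs)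
      = iso_class (restrict_edges G (Es ! p), butlast Es)"
      by (rule iso_class_eq[OF flagged_graph_restrict[OF P], symmetric])
  qed
qed

lemma graph_face_mid:
  assumes P: "flagged_graph (Suc p) (G, Es)" and i: "0 < i" "i \<le> p"
  shows "graph_face (Suc p) i (iso_class (G, Es)) = iso_class (G, take i Es @ drop (Suc i) Es)"
proof -
  have *: "graph_face (Suc p) i (iso_class (G, Es))
    = (\<Union>(H, Fs)\<in>iso_class (G, Es). iso_class (H, take i Fs @ drop (Suc i) Fs))"
    using i by (simp add: graph_face_def)
  show ?thesis
    unfolding *
  proof (rule UN_iso_class[OF P], clarify)
    fix H Fs assume "flagged_iso (G, Es) (H :: (nat, nat) multigraph, Fs)"
    then have "flagged_iso (G, take i Es @ drop (Suc i) Es) (H, take i Fs @ drop (Suc i) Fs)"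
      by (auto elim!: flagged_isoE intro!: flagged_isoI simp: take_map drop_map)
    then show "iso_class (H, take i Fs @ drop (Suc i) Fs) = iso_class (G, take i Es @ drop (Suc i) Es)"
      by (rule iso_class_eq[OF flagged_graph_drop_nth[OF P i], symmetric])
  qed
qed

lemma graph_degen_iso_class:
  assumes P: "flagged_graph p (G, Es)" and i: "i \<le> p"
  shows "graph_degen p i (iso_class (G, Es)) = iso_class (G, take (Suc i) Es @ drop i Es)"
  unfolding graph_degen_def
proof (rule UN_iso_class[OF P], clarify)
  fix H Fs assume "flagged_iso (G, Es) (H :: (nat, nat) multigraph, Fs)"
  then have "flagged_iso (G, take (Suc i) Es @ drop i Es) (H, take (Suc i) Fs @ drop i Fs)"
    by (auto elim!: flagged_isoE intro!: flagged_isoI simp: take_map drop_map)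
  then show "iso_class (H, take (Suc i) Fs @ drop i Fs) = iso_class (G, take (Suc i) Es @ drop i Es)"
    by (rule iso_class_eq[OF flagged_graph_repeat_nth[OF P i], symmetric])
qed

section \<open>Points of the realization as metric graphs\<close>

lemma sum_remove_nth:
  fixes f :: "nat \<Rightarrow> real"
  assumes "i \<le> Suc n"
  shows "(\<Sum>j\<le>Suc n. f j) = (\<Sum>j\<le>n. f (if j < i then j else Suc j)) + f i"
proof -
  let ?s = "\<lambda>j. if j < i then j else Suc j"
  have "j \<in> ?s ` {..n}" if "j \<le> Suc n" "j \<noteq> i" for j
  proof (cases "j < i")
    case True
    then show ?thesis using assms by (intro image_eqI[of _ _ j]) auto
  next
    case False
    then show ?thesis using that by (intro image_eqI[of _ _ "j - 1"]) auto
  qed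
  then have eq: "{..Suc n} = insert i (?s ` {..n})"
    using assms by auto
  have notin: "i \<notin> ?s ` {..n}" and inj: "inj_on ?s {..n}"
    by (auto simp: inj_on_def split: if_splits)
  have "sum f {..Suc n} = f i + sum f (?s ` {..n})"
    unfolding eq by (rule sum.insert[OF _ notin]) simp
  also have "sum f (?s ` {..n}) = (\<Sum>j\<le>n. f (?s j))"
    using sum.reindex[OF inj, of f] by (simp only: o_def)
  finally show ?thesis by (simp only: add.commute)
qed

lemma codegeneracy_alt:
  "codegeneracy i t j = t (if j < i then j else Suc j) + (if j = i then t i else 0)"
  by (auto simp: codegeneracy_def)

lemma codegeneracy_in_standard_simplex:
  assumes "t \<in> standard_simplex (Suc p)" "i \<le> p"
  shows "codegeneracy i t \<in> standard_simplex p"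
proof -
  have t: "\<And>j. 0 \<le> t j" "\<And>j. j > Suc p \<Longrightarrow> t j = 0" "(\<Sum>j\<le>Suc p. t j) = 1"
    using assms(1) by (auto simp: standard_simplex_def)
  have "t i + t (Suc i) = sum t {i, Suc i}" by simp
  also have "\<dots> \<le> sum t {..Suc p}"
    using assms(2) t(1) by (intro sum_mono2) auto
  finally have le: "t i + t (Suc i) \<le> 1" using t(3) by simp
  have "(\<Sum>j\<le>p. codegeneracy i t j) = (\<Sum>j\<le>p. t (if j < i then j else Suc j)) + t i"
    unfolding codegeneracy_alt sum.distrib using assms(2) by simp
  also have "\<dots> = 1"
    using sum_remove_nth[of i p t] assms(2) t(3) by simp
  finally have "(\<Sum>j\<le>p. codegeneracy i t j) = 1" .
  moreover have "0 \<le> codegeneracy i t j \<and> codegeneracy i t j \<le> 1" for j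
    using assms(1) le t(1) by (auto simp: codegeneracy_def standard_simplex_def)
  moreover have "codegeneracy i t j = 0" if "j > p" for j
    using that t(2) assms(2) by (auto simp: codegeneracy_def)
  ultimately show ?thesis by (simp add: standard_simplex_def)
qed

definition cell_point :: "nat \<Rightarrow> flag_class \<Rightarrow> (nat \<Rightarrow> real) \<Rightarrow> ((nat \<times> flag_class) \<times> (nat \<Rightarrow> real)) set" where
  "cell_point p C t = {w. equivclp (glue graph_simplicial_set) ((p, C), t) w}"

lemma cell_point_glue:
  assumes "glue graph_simplicial_set ((p, C), t) ((q, D), u)"
  shows "cell_point p C t = cell_point q D u"
proof -
  have *: "equivclp (glue graph_simplicial_set) ((p, C), t) ((q, D), u)"
    using assms by (rule r_into_equivclp)
  show ?thesis
    unfolding cell_point_def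
    using equivclp_trans[OF *] equivclp_trans[OF equivclp_sym[OF *]] by (intro Collect_cong) metis
qed

text \<open>The edges in \<open>Es ! j - Es ! (j - 1)\<close> get the length \<open>t 0 + \<dots> + t (j - 1)\<close>; so the length
  0 means contraction and the length 1 deletion.\<close>

definition edge_length :: "'e set list \<Rightarrow> (nat \<Rightarrow> real) \<Rightarrow> 'e \<Rightarrow> real" where
  "edge_length Es t e = (\<Sum>i<length Es. if e \<in> Es ! i then 0 else t i)"

definition metric_flag ::
  "nat \<Rightarrow> ('v, 'e) multigraph \<Rightarrow> ('e \<Rightarrow> real) \<Rightarrow> 'e set list \<Rightarrow> (nat \<Rightarrow> real) \<Rightarrow> bool" where
  "metric_flag p G l Es t \<longleftrightarrow>
     flagged_graph p (G, Es) \<and> t \<in> standard_simplex p \<and> (\<forall>e\<in>edges G. edge_length Es t e = l e)"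

lemma edge_length_bounds:
  assumes "length Es = Suc p" "t \<in> standard_simplex p"
  shows "0 \<le> edge_length Es t e" "edge_length Es t e \<le> 1"
proof -
  have t: "\<And>j. 0 \<le> t j" "(\<Sum>j\<le>p. t j) = 1"
    using assms(2) by (auto simp: standard_simplex_def)
  show "0 \<le> edge_length Es t e"
    unfolding edge_length_def using t(1) by (intro sum_nonneg) auto
  have "edge_length Es t e \<le> (\<Sum>i<Suc p. t i)"
    unfolding edge_length_def assms(1) using t(1) by (intro sum_mono) auto
  then show "edge_length Es t e \<le> 1"
    using t(2) by (simp add: lessThan_Suc_atMost)
qed

section \<open>Reducing a flag that induces given lengths, and uniqueness of the reduced
  form\<close>

lemma nth_remove:
  assumes "length Es = Suc (Suc p)" "i \<le> Suc p" "j \<le> p"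
  shows "(take i Es @ drop (Suc i) Es) ! j = Es ! (if j < i then j else Suc j)"
  using assms by (auto simp: nth_append)

lemma simplical_face_remove:
  assumes "t i = 0"
  shows "simplical_face i (\<lambda>j. t (if j < i then j else Suc j)) = t"
  using assms by (auto simp: simplical_face_def fun_eq_iff)

text \<open>A vanishing coordinate strictly between the ends puts the point on an inner face, which
  forgets \<open>Es ! i\<close> but leaves the graph alone. The outer faces change the graph and are
  treated separately, as deletion and contraction.\<close>

lemma metric_flag_remove:
  assumes m: "metric_flag (Suc p) G l Es t" and i: "0 < i" "i \<le> p" and 0: "t i = 0"
  shows "metric_flag p G l (take i Es @ drop (Suc i) Es) (\<lambda>j. t (if j < i then j else Suc j))"
    "cell_point (Suc p) (iso_class (G, Es)) t
     = cell_point p (iso_class (G, take i Es @ drop (Suc i) Es)) (\<lambda>j. t (if j < i then j else Suc j))"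
proof -
  let ?t = "\<lambda>j. t (if j < i then j else Suc j)" and ?Ds = "take i Es @ drop (Suc i) Es"
  have P: "flagged_graph (Suc p) (G, Es)" and ts: "t \<in> standard_simplex (Suc p)"
    and l: "\<And>e. e \<in> edges G \<Longrightarrow> edge_length Es t e = l e"
    using m unfolding metric_flag_def by blast+
  have len: "length Es = Suc (Suc p)" using P by simp
  then have lenD: "length ?Ds = Suc p" using i by simp
  have "(\<Sum>j\<le>p. ?t j) = 1"
    using sum_remove_nth[of i p t] i 0 ts by (simp add: standard_simplex_def)
  then have t': "?t \<in> standard_simplex p"
    using ts i by (auto simp: standard_simplex_def)
  have "edge_length ?Ds ?t e = edge_length Es t e" for e
  proof -
    have "edge_length Es t e = (\<Sum>j\<le>Suc p. if e \<in> Es ! j then 0 else t j)"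
      by (simp only: edge_length_def len lessThan_Suc_atMost)
    also have "\<dots> = (\<Sum>j\<le>p. if e \<in> Es ! (if j < i then j else Suc j) then 0 else ?t j)"
      using sum_remove_nth[of i p "\<lambda>j. if e \<in> Es ! j then 0 else t j"] i 0 by simp
    also have "\<dots> = (\<Sum>j\<le>p. if e \<in> ?Ds ! j then 0 else ?t j)"
      using nth_remove[OF len, of i] i by (intro sum.cong refl) simp
    also have "\<dots> = edge_length ?Ds ?t e"
      by (simp only: edge_length_def lenD lessThan_Suc_atMost)
    finally show ?thesis by simp
  qed
  then show "metric_flag p G l ?Ds ?t"
    using flagged_graph_drop_nth[OF P i] t' l unfolding metric_flag_def by simp
  have "glue graph_simplicial_set ((Suc p, iso_class (G, Es)), simplical_face i ?t)
     ((p, face graph_simplicial_set (Suc p) i (iso_class (G, Es))), ?t)"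
    by (rule glue_face) (use iso_class_in_graph_simplices[OF P] i t' in \<open>auto simp: graph_simplicial_set_def\<close>)
  then show "cell_point (Suc p) (iso_class (G, Es)) t = cell_point p (iso_class (G, ?Ds)) ?t"
    using graph_face_mid[OF P i] simplical_face_remove[of t i] 0
    by (intro cell_point_glue) (simp add: graph_simplicial_set_def)
qed

text \<open>A repeated edge set makes the simplex degenerate, so the point already lies in the
  shorter simplex, at the coordinates given by the codegeneracy. Here \<open>i = 0\<close> is
  allowed.\<close>

lemma metric_flag_merge:
  assumes m: "metric_flag (Suc p) G l Es t" and i: "i \<le> p" and eq: "Es ! i = Es ! Suc i"
  shows "metric_flag p G l (take i Es @ drop (Suc i) Es) (codegeneracy i t)"
    "cell_point (Suc p) (iso_class (G, Es)) t
     = cell_point p (iso_class (G, take i Es @ drop (Suc i) Es)) (codegeneracy i t)"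
proof -
  let ?t = "codegeneracy i t" and ?Ds = "take i Es @ drop (Suc i) Es"
  have P: "flagged_graph (Suc p) (G, Es)" and ts: "t \<in> standard_simplex (Suc p)"
    and l: "\<And>e. e \<in> edges G \<Longrightarrow> edge_length Es t e = l e"
    using m unfolding metric_flag_def by blast+
  have len: "length Es = Suc (Suc p)" using P by simp
  then have lenD: "length ?Ds = Suc p" using i by simp
  have nth: "?Ds ! j = Es ! (if j < i then j else Suc j)" if "j \<le> p" for j
    using nth_remove[OF len _ that, of i] i by simp
  have t': "?t \<in> standard_simplex p"
    by (rule codegeneracy_in_standard_simplex[OF ts i])
  have "edge_length ?Ds ?t e = edge_length Es t e" for e
  proof -
    have "edge_length Es t e = (\<Sum>j\<le>Suc p. if e \<in> Es ! j then 0 else t j)"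
      by (simp only: edge_length_def len lessThan_Suc_atMost)
    also have "\<dots> = (\<Sum>j\<le>p. if e \<in> Es ! (if j < i then j else Suc j) then 0
        else t (if j < i then j else Suc j)) + (if e \<in> Es ! i then 0 else t i)"
      using i by (intro sum_remove_nth) simp
    \<comment> \<open>The term of the removed position moves to index \<open>i\<close> of the
      shortened sum, where membership is decided by \<open>Es ! Suc i\<close>, which equals
      \<open>Es ! i\<close>.\<close>
    also have "(if e \<in> Es ! i then 0 else t i) = (\<Sum>j\<le>p. if e \<in> Es ! (if j < i then j else Suc j) then 0
        else if j = i then t i else 0)"
    proof -
      have "(\<Sum>j\<le>p. if e \<in> Es ! (if j < i then j else Suc j) then 0 else if j = i then t i else 0)
        = (\<Sum>j\<le>p. if j = i then (if e \<in> Es ! i then 0 else t i) else 0)"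
        using eq by (intro sum.cong refl) auto
      then show ?thesis using i by simp
    qed
    also have "(\<Sum>j\<le>p. if e \<in> Es ! (if j < i then j else Suc j) then 0
        else t (if j < i then j else Suc j)) + \<dots> = (\<Sum>j\<le>p. if e \<in> ?Ds ! j then 0 else ?t j)"
      unfolding sum.distrib[symmetric] using nth
      by (intro sum.cong refl) (simp add: codegeneracy_alt)
    also have "\<dots> = edge_length ?Ds ?t e"
      by (simp only: edge_length_def lenD lessThan_Suc_atMost)
    finally show ?thesis by simp
  qed
  moreover have D: "flagged_graph p (G, ?Ds)"
  proof -
    have "?Ds ! j \<subseteq> ?Ds ! Suc j" if "j < p" for j
      using that nth[of j] nth[of "Suc j"] flagged_graph_mono[OF P] by auto
    moreover have "?Ds ! 0 = {}"
      using nth[of 0] eq P by (cases "i = 0") auto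
    moreover have "?Ds ! p = edges G"
      using nth[of p] i P by (cases "p < i") auto
    ultimately show ?thesis
      using P lenD by simp
  qed
  ultimately show "metric_flag p G l ?Ds ?t"
    using t' l unfolding metric_flag_def by simp
  \<comment> \<open>Repeating entry \<open>i\<close> of the shortened list gives \<open>Es\<close>
    back, which exhibits the simplex as the \<open>i\<close>-th degeneracy of the shorter
    one.\<close>
  have "take (Suc i) ?Ds @ drop i ?Ds = Es"
  proof (rule nth_equalityI)
    show "length (take (Suc i) ?Ds @ drop i ?Ds) = length Es"
      using len i by (simp add: min_def) arith
    fix j assume "j < length (take (Suc i) ?Ds @ drop i ?Ds)"
    then have j: "j \<le> Suc p" using len i by (simp add: min_def split: if_splits)
    have lt: "length (take (Suc i) ?Ds) = Suc i" using lenD i by (simp only: length_take)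
    show "(take (Suc i) ?Ds @ drop i ?Ds) ! j = Es ! j"
    proof (cases "j \<le> i")
      case True
      then have "(take (Suc i) ?Ds @ drop i ?Ds) ! j = ?Ds ! j"
        using lt by (simp only: nth_append less_Suc_eq_le if_True nth_take)
      then show ?thesis using nth[of j] True i eq by (cases "j = i") auto
    next
      case False
      then have "(take (Suc i) ?Ds @ drop i ?Ds) ! j = drop i ?Ds ! (j - Suc i)"
        using lt by (simp only: nth_append less_Suc_eq_le if_False)
      also have "\<dots> = ?Ds ! (j - 1)"
        using False j lenD i by (subst nth_drop) (simp_all only: , auto)
      also have "\<dots> = Es ! j"
        using nth[of "j - 1"] False j by (cases "j - 1 < i") auto
      finally show ?thesis .
    qed
  qed
  then have deg: "graph_degen p i (iso_class (G, ?Ds)) = iso_class (G, Es)"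
    using graph_degen_iso_class[OF D i] by (simp only:)
  have "glue graph_simplicial_set
     ((Suc p, degen graph_simplicial_set p i (iso_class (G, ?Ds))), t) ((p, iso_class (G, ?Ds)), ?t)"
    by (rule glue_degen) (use iso_class_in_graph_simplices[OF D] i ts in \<open>auto simp: graph_simplicial_set_def\<close>)
  then show "cell_point (Suc p) (iso_class (G, Es)) t = cell_point p (iso_class (G, ?Ds)) ?t"
    using deg by (intro cell_point_glue) (simp only: graph_simplicial_set_def simplicial_set.simps)
qed

text \<open>Nondegenerate and on no inner face. The coordinates \<open>t 0\<close> and
  \<open>t p\<close> may vanish, since passing to an outer face would replace \<open>G\<close>,
  which is fixed here.\<close>

definition reduced_flag :: "nat \<Rightarrow> 'e set list \<Rightarrow> (nat \<Rightarrow> real) \<Rightarrow> bool" where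
  "reduced_flag p Es t \<longleftrightarrow> (\<forall>j. 0 < j \<and> j < p \<longrightarrow> t j \<noteq> 0) \<and> (\<forall>j<p. Es ! j \<noteq> Es ! Suc j)"

lemma metric_flag_reduce:
  assumes "metric_flag p G l Es t"
  shows "\<exists>q Fs u. metric_flag q G l Fs u \<and> reduced_flag q Fs u \<and>
     cell_point p (iso_class (G, Es)) t = cell_point q (iso_class (G, Fs)) u"
  using assms
proof (induction p arbitrary: Es t)
  case 0
  then show ?case by (intro exI[of _ 0] exI[of _ Es] exI[of _ t]) (simp add: reduced_flag_def)
next
  case (Suc p)
  consider "reduced_flag (Suc p) Es t" | i where "0 < i" "i \<le> p" "t i = 0"
    | i where "i \<le> p" "Es ! i = Es ! Suc i"
    unfolding reduced_flag_def less_Suc_eq_le by blast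
  then show ?case
  proof cases
    case 1
    then show ?thesis using Suc.prems by blast
  next
    case 2
    then show ?thesis
      using Suc.IH[OF metric_flag_remove(1)[OF Suc.prems 2]] metric_flag_remove(2)[OF Suc.prems 2]
        by simp
  next
    case 3
    then show ?thesis
      using Suc.IH[OF metric_flag_merge(1)[OF Suc.prems 3]] metric_flag_merge(2)[OF Suc.prems 3]
        by simp
  qed
qed

lemma edge_length_eq_partial_sum:
  assumes P: "flagged_graph p (G, Es)" and e: "e \<in> Es ! j" "e \<notin> Es ! (j - 1)" and j: "0 < j" "j \<le> p"
  shows "edge_length Es t e = (\<Sum>i<j. t i)"
proof -
  have iff: "e \<in> Es ! i \<longleftrightarrow> j \<le> i" if "i \<le> p" for i
  proof
    show "e \<in> Es ! i" if "j \<le> i"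
      using flagged_graph_mono[OF P that \<open>i \<le> p\<close>] e(1) by blast
    show "j \<le> i" if "e \<in> Es ! i"
    proof (rule ccontr)
      assume "\<not> j \<le> i"
      then have "Es ! i \<subseteq> Es ! (j - 1)"
        using flagged_graph_mono[OF P, of i "j - 1"] j by simp
      then show False using that e(2) by blast
    qed
  qed
  have "edge_length Es t e = (\<Sum>i<Suc p. if j \<le> i then 0 else t i)"
    unfolding edge_length_def using P iff by (intro sum.cong) auto
  also have "\<dots> = (\<Sum>i<j. t i)"
    using j by (intro sum.mono_neutral_cong_right) auto
  finally show ?thesis .
qed

lemma flag_edge_index:
  assumes P: "flagged_graph p (G, Es)" and e: "e \<in> edges G"
  obtains j where "0 < j" "j \<le> p" "e \<in> Es ! j" "e \<notin> Es ! (j - 1)"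
proof -
  define j where "j = (LEAST j. e \<in> Es ! j)"
  have p: "e \<in> Es ! p" using P e by simp
  then have 1: "e \<in> Es ! j" and 2: "j \<le> p"
    unfolding j_def by (rule LeastI, rule Least_le)
  have "j \<noteq> 0" using 1 P by (intro notI) simp
  moreover have "e \<notin> Es ! (j - 1)"
    using not_less_Least[of "j - 1" "\<lambda>j. e \<in> Es ! j"] \<open>j \<noteq> 0\<close> unfolding j_def[symmetric] by simp
  ultimately show ?thesis using that[of j] 1 2 by simp
qed

text \<open>An edge that enters the chain at step \<open>j\<close> has as its length the
  \<open>j\<close>-th partial sum. In a reduced flag edges enter at every step and the sums strictly
  increase, so the sums list the set of lengths in order and the chain consists of sublevel sets of
  \<open>l\<close>.\<close>

lemma reduced_flag_partial_sums:
  assumes m: "metric_flag p G l Es t" and r: "reduced_flag p Es t"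
  shows "sorted_wrt (<) (map (\<lambda>j. \<Sum>i<j. t i) [1..<Suc p])"
    "set (map (\<lambda>j. \<Sum>i<j. t i) [1..<Suc p]) = l ` edges G"
    "\<And>j. 0 < j \<Longrightarrow> j \<le> p \<Longrightarrow> Es ! j = {e \<in> edges G. l e \<le> (\<Sum>i<j. t i)}"
proof -
  let ?v = "\<lambda>j. \<Sum>i<j. t i"
  have P: "flagged_graph p (G, Es)" and ts: "t \<in> standard_simplex p"
    and l: "\<And>e. e \<in> edges G \<Longrightarrow> edge_length Es t e = l e"
    using m unfolding metric_flag_def by blast+
  have sub: "Es ! j \<subseteq> edges G" if "j \<le> p" for j
    using flagged_graph_mono[OF P that] P by simp
  have mono: "?v j < ?v k" if "0 < j" "j < k" "k \<le> p" for j k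
    using that(2,3)
  proof (induction k)
    case (Suc k)
    have "0 < t k" if "0 < k" "k < p"
    proof -
      have "t k \<noteq> 0" using r that unfolding reduced_flag_def by simp
      moreover have "0 \<le> t k" using ts unfolding standard_simplex_def by simp
      ultimately show ?thesis by simp
    qed
    then show ?case
      using Suc that(1) by (cases "j = k") auto
  qed simp
  show "sorted_wrt (<) (map ?v [1..<Suc p])"
    unfolding sorted_wrt_iff_nth_less
  proof (intro allI impI)
    fix i j assume "i < j" "j < length (map ?v [1..<Suc p])"
    then show "map ?v [1..<Suc p] ! i < map ?v [1..<Suc p] ! j"
      using mono[of "Suc i" "Suc j"] by (simp del: upt_Suc sum.lessThan_Suc)
  qed
  have idx: "l e = ?v j" if "e \<in> Es ! j" "e \<notin> Es ! (j - 1)" "0 < j" "j \<le> p" for e j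
    using edge_length_eq_partial_sum[OF P that, of t] l[of e] sub[OF that(4)] that(1) by auto
  have "\<exists>e\<in>edges G. l e = ?v j" if "0 < j" "j \<le> p" for j
  proof -
    have "Es ! (j - 1) \<noteq> Es ! j"
    proof -
      have "j - 1 < p" "Suc (j - 1) = j" using that by simp_all
      then show ?thesis using r unfolding reduced_flag_def by metis
    qed
    moreover have "Es ! (j - 1) \<subseteq> Es ! j"
      using flagged_graph_mono[OF P] that by simp
    ultimately obtain e where "e \<in> Es ! j" "e \<notin> Es ! (j - 1)" by blast
    then show ?thesis using idx that sub by blast
  qed
  moreover have "\<exists>j. 0 < j \<and> j \<le> p \<and> l e = ?v j" if "e \<in> edges G" for e
    using flag_edge_index[OF P that] idx by metis
  ultimately have "?v ` {1..p} = l ` edges G"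
    unfolding set_eq_iff image_iff Bex_def atLeastAtMost_iff One_nat_def Suc_le_eq by metis
  then show "set (map ?v [1..<Suc p]) = l ` edges G"
    by (simp only: set_map set_upt atLeastLessThanSuc_atLeastAtMost)
  show "Es ! j = {e \<in> edges G. l e \<le> ?v j}" if j: "0 < j" "j \<le> p" for j
  proof (intro equalityI subsetI)
    fix e assume e: "e \<in> Es ! j"
    then have eG: "e \<in> edges G" using sub j by blast
    obtain k where k: "0 < k" "k \<le> p" "e \<in> Es ! k" "e \<notin> Es ! (k - 1)"
      by (rule flag_edge_index[OF P eG])
    have "k \<le> j"
    proof (rule ccontr)
      assume "\<not> k \<le> j"
      then have "Es ! j \<subseteq> Es ! (k - 1)"
        using flagged_graph_mono[OF P, of j "k - 1"] k by simp
      then show False using e k(4) by blast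
    qed
    then have "?v k \<le> ?v j"
      using mono[of k j] k j by (cases "k = j") auto
    then show "e \<in> {e \<in> edges G. l e \<le> ?v j}" using eG idx[OF k(3,4,1,2)] by simp
  next
    fix e assume "e \<in> {e \<in> edges G. l e \<le> ?v j}"
    then have eG: "e \<in> edges G" and le: "l e \<le> ?v j" by simp_all
    obtain k where k: "0 < k" "k \<le> p" "e \<in> Es ! k" "e \<notin> Es ! (k - 1)"
      by (rule flag_edge_index[OF P eG])
    have "k \<le> j"
      using mono[of j k] le idx[OF k(3,4,1,2)] j k by linarith
    then show "e \<in> Es ! j"
      using flagged_graph_mono[OF P _ j(2)] k(3) by blast
  qed
qed

text \<open>Two strictly increasing lists with the same entries are equal. This determines all
  partial sums, hence all coordinates but the last, which follows from the total 1.\<close>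

lemma reduced_flag_unique:
  assumes m: "metric_flag p G l Es t" "reduced_flag p Es t"
    and n: "metric_flag q G l Fs u" "reduced_flag q Fs u"
  shows "p = q \<and> Es = Fs \<and> t = u"
proof -
  note A = reduced_flag_partial_sums[OF m] and B = reduced_flag_partial_sums[OF n]
  have ts: "t \<in> standard_simplex p" and us: "u \<in> standard_simplex q"
    and P: "flagged_graph p (G, Es)" and Q: "flagged_graph q (G, Fs)"
    using m n unfolding metric_flag_def by blast+
  have eq: "map (\<lambda>j. \<Sum>i<j. t i) [1..<Suc p] = map (\<lambda>j. \<Sum>i<j. u i) [1..<Suc q]"
    using A(1,2) B(1,2) by (intro strict_sorted_equal) simp_all
  have [simp]: "q = p" using map_eq_imp_length_eq[OF eq] by (simp del: upt_Suc)
  have v: "(\<Sum>i<j. t i) = (\<Sum>i<j. u i)" if "j \<le> p" for j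
  proof (cases "j = 0")
    case False
    then show ?thesis using eq that by (auto simp: map_eq_conv)
  qed simp
  have "t i = u i" for i
  proof (cases i p rule: linorder_cases)
    case less
    then show ?thesis using v[of i] v[of "Suc i"] by simp
  next
    case equal
    then show ?thesis using v[of p] ts us
      by (simp add: standard_simplex_def lessThan_Suc_atMost[symmetric])
  next
    case greater
    then show ?thesis using ts us by (simp add: standard_simplex_def)
  qed
  moreover have "Es ! j = Fs ! j" if "j \<le> p" for j
    using A(3)[of j] B(3)[of j] v[OF that] P Q that by (cases "j = 0") simp_all
  then have "Es = Fs"
    using P Q by (intro nth_equalityI) auto
  ultimately show ?thesis by auto
qed

lemma cell_point_metric_flag_cong:
  assumes "metric_flag p G l Es t" "metric_flag q G l Fs u"
  shows "cell_point p (iso_class (G, Es)) t = cell_point q (iso_class (G, Fs)) u"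
  using metric_flag_reduce[OF assms(1)] metric_flag_reduce[OF assms(2)] reduced_flag_unique by metis

text \<open>Well defined because the point of a cell depends only on the lengths that its flag
  induces. From here on points are handled through \<open>G\<close> and \<open>l\<close>, on any
  vertex and edge types, and not through simplices.\<close>

definition metric_point ::
  "('v, 'e) multigraph \<Rightarrow> ('e \<Rightarrow> real) \<Rightarrow> ((nat \<times> flag_class) \<times> (nat \<Rightarrow> real)) set" where
  "metric_point G l = (THE z. \<exists>p Es t. metric_flag p G l Es t \<and> z = cell_point p (iso_class (G, Es)) t)"

lemma metric_point_eq:
  assumes "metric_flag p G l Es t"
  shows "metric_point G l = cell_point p (iso_class (G, Es)) t"
  unfolding metric_point_def
  using assms cell_point_metric_flag_cong[OF _ assms] by (intro the_equality) blast+

section \<open>Every unit length function comes from a flag; invariance under isomorphism\<close>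

abbreviation unit_lengths :: "('v, 'e) multigraph \<Rightarrow> ('e \<Rightarrow> real) \<Rightarrow> bool" where
  "unit_lengths G l \<equiv> \<forall>e\<in>edges G. 0 \<le> l e \<and> l e \<le> 1"

text \<open>The sorted lengths with 0 put in front and 1 behind. Their consecutive differences will
  be the barycentric coordinates in the simplex of the full flag that the ordering \<open>es\<close>
  defines.\<close>

definition position :: "('e \<Rightarrow> real) \<Rightarrow> 'e list \<Rightarrow> nat \<Rightarrow> real" where
  "position l es j = (if j = 0 then 0 else if j \<le> length es then l (es ! (j - 1)) else 1)"

definition gaps :: "('e \<Rightarrow> real) \<Rightarrow> 'e list \<Rightarrow> nat \<Rightarrow> real" where
  "gaps l es j = position l es (Suc j) - position l es j"

definition prefixes :: "'e list \<Rightarrow> 'e set list" where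
  "prefixes es = map (\<lambda>j. set (take j es)) [0..<Suc (length es)]"

text \<open>The edges are added to the chain one at a time in order of length. Equal lengths are
  harmless, since they only produce vanishing coordinates.\<close>

lemma metric_flag_order:
  assumes G: "finite_multigraph G" and es: "distinct es" "set es = edges G"
    and sorted: "sorted (map l es)" and l: "unit_lengths G l"
  shows "metric_flag (length es) G l (prefixes es) (gaps l es)"
proof -
  let ?N = "length es"
  have len: "length (prefixes es) = Suc ?N" by (simp add: prefixes_def)
  have nth: "prefixes es ! j = set (take j es)" if "j \<le> ?N" for j
    using that by (simp add: prefixes_def del: upt_Suc)
  have le1: "l (es ! j) \<le> 1" and ge0: "0 \<le> l (es ! j)" if "j < ?N" for j
    using l es(2) nth_mem[OF that] by auto
  have mono: "position l es j \<le> position l es (Suc j)" for j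
  proof -
    consider "j = 0" | "0 < j" "j < ?N" | "0 < j" "j = ?N" | "?N < j" by linarith
    then show ?thesis
    proof cases
      case 1
      then show ?thesis using ge0[of 0] by (cases es) (simp_all add: position_def)
    next
      case 2
      then have "l (es ! (j - 1)) \<le> l (es ! j)"
        using sorted_nth_mono[OF sorted, of "j - 1" j] by simp
      then show ?thesis using 2 by (simp add: position_def)
    qed (use le1[of "j - 1"] in \<open>auto simp: position_def\<close>)
  qed
  have sum: "(\<Sum>j<n. gaps l es j) = position l es n" for n
    unfolding gaps_def using sum_lessThan_telescope[of "position l es" n]
      by (simp add: position_def)
  have one: "(\<Sum>j\<le>?N. gaps l es j) = 1"
    using sum[of "Suc ?N"] by (simp add: lessThan_Suc_atMost position_def)
  have pos: "0 \<le> gaps l es j" for j using mono[of j] by (simp add: gaps_def)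
  have le: "gaps l es j \<le> 1" for j
  proof -
    have "0 \<le> position l es j" unfolding sum[symmetric] by (rule sum_nonneg) (rule pos)
    moreover have "position l es (Suc j) \<le> 1"
      using le1[of j] unfolding position_def by (cases "Suc j \<le> ?N") simp_all
    ultimately show ?thesis by (simp add: gaps_def)
  qed
  have zero: "gaps l es j = 0" if "j > ?N" for j
    using that by (simp add: gaps_def position_def)
  have t: "gaps l es \<in> standard_simplex ?N"
    unfolding standard_simplex_def mem_Collect_eq
  proof (intro conjI allI impI)
    fix i show "0 \<le> gaps l es i" by (rule pos)
    show "gaps l es i \<le> 1" by (rule le)
    show "?N < i \<Longrightarrow> gaps l es i = 0" by (rule zero)
  qed (rule one)
  have "edge_length (prefixes es) (gaps l es) e = l e" if "e \<in> edges G" for e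
  proof -
    have "e \<in> set es" using that es(2) by simp
    then obtain k where k: "k < ?N" "e = es ! k"
      unfolding in_set_conv_nth by metis
    have "e \<in> set (take i es) \<longleftrightarrow> k < i" if "i \<le> ?N" for i
    proof
      assume "e \<in> set (take i es)"
      then obtain k' where "k' < i" "k' < ?N" "es ! k' = e"
        by (auto simp: in_set_conv_nth)
      then show "k < i" using nth_eq_iff_index_eq[OF es(1), of k' k] k by simp
    next
      assume "k < i"
      then show "e \<in> set (take i es)"
        using nth_mem[of k "take i es"] k by simp
    qed
    then have "edge_length (prefixes es) (gaps l es) e = (\<Sum>i<Suc ?N. if k < i then 0 else gaps l es i)"
      unfolding edge_length_def len
      by (intro sum.cong refl) (simp only: nth lessThan_iff less_Suc_eq_le)
    also have "\<dots> = (\<Sum>i<Suc k. gaps l es i)"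
      using k by (intro sum.mono_neutral_cong_right) auto
    also have "\<dots> = l e"
      unfolding sum using k by (simp add: position_def)
    finally show ?thesis .
  qed
  moreover have "flagged_graph ?N (G, prefixes es)"
    unfolding flagged_graph.simps
  proof (intro conjI allI impI)
    show "prefixes es ! 0 = {}" "prefixes es ! ?N = edges G"
      using nth[of 0] nth[of ?N] es(2) by simp_all
    show "prefixes es ! j \<subseteq> prefixes es ! Suc j" if "j < ?N" for j
      using nth[of j] nth[of "Suc j"] that set_take_subset_set_take[of j "Suc j" es] by simp
  qed (use G len in simp_all)
  ultimately show ?thesis
    using t unfolding metric_flag_def by blast
qed

lemma ex_metric_flag:
  assumes "finite_multigraph G" "unit_lengths G l"
  obtains p Es t where "metric_flag p G l Es t"
proof -
  obtain xs where xs: "set xs = edges G" "distinct xs"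
    using finite_distinct_list[of "edges G"] assms(1) unfolding finite_multigraph_def by metis
  show ?thesis
    by (rule that[OF metric_flag_order[OF assms(1) _ _ _ assms(2), of "sort_key l xs"]])
      (use xs in simp_all)
qed

lemma edge_length_image:
  assumes "inj_on g E" "\<forall>F\<in>set Es. F \<subseteq> E" "e \<in> E"
  shows "edge_length (map ((`) g) Es) t (g e) = edge_length Es t e"
proof -
  have iff: "g e \<in> map ((`) g) Es ! i \<longleftrightarrow> e \<in> Es ! i" if "i < length Es"
    for i
  proof -
    have "Es ! i \<subseteq> E" using assms(2) nth_mem[OF that] by blast
    then show ?thesis
      using inj_on_image_mem_iff[OF assms(1,3)] that by simp
  qed
  show ?thesis
    unfolding edge_length_def length_map by (intro sum.cong refl) (simp only: iff lessThan_iff)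
qed

lemma metric_flag_iso:
  assumes iso: "multigraph_iso f g G H" and m: "metric_flag p G l Es t"
    and l: "\<And>e. e \<in> edges G \<Longrightarrow> m (g e) = l e"
  shows "metric_flag p H m (map ((`) g) Es) t" "iso_class (G, Es) = iso_class (H, map ((`) g) Es)"
proof -
  have P: "flagged_graph p (G, Es)" using m unfolding metric_flag_def by blast
  have fi: "flagged_iso (G, Es) (H, map ((`) g) Es)"
    by (rule flagged_isoI[OF iso refl])
  show "iso_class (G, Es) = iso_class (H, map ((`) g) Es)"
    by (rule iso_class_eq[OF P fi])
  have g: "inj_on g (edges G)" "edges H = g ` edges G"
    using iso by (auto simp: multigraph_iso_def bij_betw_def)
  have "edge_length (map ((`) g) Es) t (g e) = m (g e)" if "e \<in> edges G" for e
    using edge_length_image[OF g(1) _ that, of Es t] flagged_graph_subset[OF P] m l[OF that] that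
    unfolding metric_flag_def by simp
  then have "\<forall>e\<in>edges H. edge_length (map ((`) g) Es) t e = m e"
    unfolding g(2) by blast
  then show "metric_flag p H m (map ((`) g) Es) t"
    using flagged_iso_flagged_graph[OF P fi] m unfolding metric_flag_def by blast
qed

lemma metric_point_iso:
  assumes "multigraph_iso f g G H" "finite_multigraph G" "unit_lengths G l"
    and "\<And>e. e \<in> edges G \<Longrightarrow> m (g e) = l e"
  shows "metric_point G l = metric_point H m"
proof -
  obtain p Es t where m: "metric_flag p G l Es t"
    by (rule ex_metric_flag[OF assms(2,3)])
  show ?thesis
    using metric_point_eq[OF m] metric_point_eq[OF metric_flag_iso(1)[OF assms(1) m assms(4)]]
      metric_flag_iso(2)[OF assms(1) m assms(4)] by simp
qed

lemma multigraph_iso_id: "multigraph_iso id id G G"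
  by (simp add: multigraph_iso_def)

lemma metric_point_cong:
  assumes "finite_multigraph G" "unit_lengths G l" "\<And>e. e \<in> edges G \<Longrightarrow> m e = l e"
  shows "metric_point G l = metric_point G m"
  using metric_point_iso[OF multigraph_iso_id assms(1,2), of m] assms(3) by simp

section \<open>Outer faces: deletion at length 1 and contraction at length 0\<close>

lemma edge_length_simplical_face:
  assumes "length Es = Suc (Suc p)" "i \<le> Suc p"
  shows "edge_length Es (simplical_face i t) e = edge_length (take i Es @ drop (Suc i) Es) t e"
proof -
  have lenD: "length (take i Es @ drop (Suc i) Es) = Suc p" using assms by simp
  have "edge_length Es (simplical_face i t) e = (\<Sum>j\<le>Suc p. if e \<in> Es ! j then 0 else simplical_face i t j)"
    by (simp only: edge_length_def assms(1) lessThan_Suc_atMost)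
  also have "\<dots> = (\<Sum>j\<le>p. if e \<in> Es ! (if j < i then j else Suc j) then 0
      else simplical_face i t (if j < i then j else Suc j))"
    using sum_remove_nth[OF assms(2), of "\<lambda>j. if e \<in> Es ! j then 0 else simplical_face i t j"]
    by (simp add: simplical_face_def)
  also have "\<dots> = (\<Sum>j\<le>p. if e \<in> (take i Es @ drop (Suc i) Es) ! j then 0 else t j)"
    using nth_remove[OF assms] by (intro sum.cong refl) (simp add: simplical_face_def)
  also have "\<dots> = edge_length (take i Es @ drop (Suc i) Es) t e"
    by (simp only: edge_length_def lenD lessThan_Suc_atMost)
  finally show ?thesis .
qed

lemma edge_length_face_0:
  assumes P: "flagged_graph (Suc p) (G, Es)"
  shows "e \<in> Es ! 1 \<Longrightarrow> edge_length Es (simplical_face 0 t) e = 0"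
    "e \<notin> Es ! 1 \<Longrightarrow>
       edge_length (map (\<lambda>F. F - Es ! 1) (tl Es)) t e = edge_length Es (simplical_face 0 t) e"
proof -
  have len: "length Es = Suc (Suc p)" using P by simp
  have *: "edge_length Es (simplical_face 0 t) e = edge_length (tl Es) t e"
    using edge_length_simplical_face[OF len, of 0 t e] by (simp add: drop_Suc)
  show "edge_length Es (simplical_face 0 t) e = 0" if "e \<in> Es ! 1"
  proof -
    have "e \<in> tl Es ! i" if "i < length (tl Es)" for i
      using flagged_graph_mono[OF P, of 1 "Suc i"] that \<open>e \<in> Es ! 1\<close> len by (auto simp: nth_tl)
    then have "edge_length (tl Es) t e = 0" unfolding edge_length_def by simp
    then show ?thesis unfolding * .
  qed
  show "edge_length (map (\<lambda>F. F - Es ! 1) (tl Es)) t e = edge_length Es (simplical_face 0 t) e" if "e \<notin> Es ! 1"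
    unfolding * using that unfolding edge_length_def by (intro sum.cong) auto
qed

lemma edge_length_face_last:
  assumes P: "flagged_graph (Suc p) (G, Es)" and t: "t \<in> standard_simplex p"
  shows "e \<notin> Es ! p \<Longrightarrow> edge_length Es (simplical_face (Suc p) t) e = 1"
    "edge_length (butlast Es) t e = edge_length Es (simplical_face (Suc p) t) e"
proof -
  have len: "length Es = Suc (Suc p)" using P by simp
  show *: "edge_length (butlast Es) t e = edge_length Es (simplical_face (Suc p) t) e"
    using edge_length_simplical_face[OF len, of "Suc p" t e] len by (simp add: butlast_conv_take)
  show "edge_length Es (simplical_face (Suc p) t) e = 1" if "e \<notin> Es ! p"
  proof -
    have "e \<notin> butlast Es ! i" if "i < Suc p" for i
      using flagged_graph_mono[OF P, of i p] that \<open>e \<notin> Es ! p\<close> len by (auto simp: nth_butlast)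
    then have "edge_length (butlast Es) t e = (\<Sum>i<Suc p. t i)"
      unfolding edge_length_def using len by (intro sum.cong) auto
    then show ?thesis
      using * t by (simp only: lessThan_Suc_atMost standard_simplex_def mem_Collect_eq)
  qed
qed

lemma glue_graph_face:
  assumes P: "flagged_graph (Suc p) (G, Es)" and "i \<le> Suc p" "t \<in> standard_simplex p"
  shows "cell_point (Suc p) (iso_class (G, Es)) (simplical_face i t)
    = cell_point p (graph_face (Suc p) i (iso_class (G, Es))) t"
proof (rule cell_point_glue)
  have "glue graph_simplicial_set ((Suc p, iso_class (G, Es)), simplical_face i t)
     ((p, face graph_simplicial_set (Suc p) i (iso_class (G, Es))), t)"
    by (rule glue_face) (use iso_class_in_graph_simplices[OF P] assms in \<open>auto simp: graph_simplicial_set_def\<close>)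
  then show "glue graph_simplicial_set ((Suc p, iso_class (G, Es)), simplical_face i t)
     ((p, graph_face (Suc p) i (iso_class (G, Es))), t)"
    by (simp add: graph_simplicial_set_def)
qed

lemma simplical_face_in_simplex:
  "i \<le> Suc p \<Longrightarrow> t \<in> standard_simplex p \<Longrightarrow> simplical_face i t \<in> standard_simplex (Suc p)"
  using simplical_face_in_standard_simplex[of "Suc p" i t] by simp

text \<open>A flag of the smaller graph is extended by \<open>edges G\<close>, with last coordinate
  0. The edges of \<open>S\<close> enter in the last step and so have length 1, and the last face of
  the extended simplex is the simplex of the smaller graph.\<close>

lemma metric_point_delete:
  assumes G: "finite_multigraph G" and l: "unit_lengths G l"
    and S: "S \<subseteq> edges G" "\<And>e. e \<in> S \<Longrightarrow> l e = 1"
  shows "metric_point (restrict_edges G (edges G - S)) l = metric_point G l"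
proof -
  let ?H = "restrict_edges G (edges G - S)"
  have H: "finite_multigraph ?H" by (rule finite_restrict_edges[OF G]) simp
  have eH: "edges ?H = edges G - S" by (simp add: restrict_edges_def)
  have lH: "unit_lengths ?H l" unfolding eH using l by blast
  obtain p Es t where m: "metric_flag p ?H l Es t"
    by (rule ex_metric_flag[OF H lH])
  let ?Fs = "Es @ [edges G]"
  have Q: "flagged_graph p (?H, Es)" and t: "t \<in> standard_simplex p"
    and el: "\<And>e. e \<in> edges G - S \<Longrightarrow> edge_length Es t e = l e"
    using m eH unfolding metric_flag_def by auto
  have len: "length Es = Suc p" and last: "Es ! p = edges G - S" using Q eH by simp_all
  have "?Fs ! j \<subseteq> ?Fs ! Suc j" if "j < Suc p" for j
    using that len last flagged_graph_mono[OF Q, of j "Suc j"]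
      by (cases "j = p") (auto simp: nth_append)
  then have P: "flagged_graph (Suc p) (G, ?Fs)"
    using Q G len by (auto simp: nth_append)
  have nthp: "?Fs ! p = edges G - S" using len last by (simp add: nth_append)
  have "edge_length ?Fs (simplical_face (Suc p) t) e = l e" if "e \<in> edges G" for e
    using edge_length_face_last[OF P t, of e] el[of e] S(2)[of e] that unfolding nthp
    by (cases "e \<in> S") simp_all
  then have "metric_flag (Suc p) G l ?Fs (simplical_face (Suc p) t)"
    using P simplical_face_in_simplex[OF order_refl t] unfolding metric_flag_def by blast
  then have "metric_point G l = cell_point p (graph_face (Suc p) (Suc p) (iso_class (G, ?Fs))) t"
    using glue_graph_face[OF P _ t, of "Suc p"] by (simp only: metric_point_eq order_refl)
  also have "graph_face (Suc p) (Suc p) (iso_class (G, ?Fs)) = iso_class (?H, Es)"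
    using graph_face_last[OF P] nthp by simp
  finally show ?thesis using metric_point_eq[OF m] by simp
qed

text \<open>Dual to deletion: a flag of the contracted graph is enlarged by \<open>S\<close>
  throughout and preceded by the empty set, with first coordinate 0. The edges of \<open>S\<close>
  enter in the first step, and the zeroth face contracts them.\<close>

lemma metric_point_contract:
  assumes G: "finite_multigraph G" and l: "unit_lengths G l"
    and S: "S \<subseteq> edges G" "\<And>e. e \<in> S \<Longrightarrow> l e = 0"
  shows "metric_point (contract_edges G S) l = metric_point G l"
proof -
  let ?H = "contract_edges G S"
  have H: "finite_multigraph ?H" by (rule finite_contract_edges[OF G])
  have eH: "edges ?H = edges G - S" by (simp add: contract_edges_def)
  have lH: "unit_lengths ?H l" unfolding eH using l by blast
  obtain p Es t where m: "metric_flag p ?H l Es t"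
    by (rule ex_metric_flag[OF H lH])
  let ?Fs = "{} # map (\<lambda>F. F \<union> S) Es"
  have Q: "flagged_graph p (?H, Es)" and t: "t \<in> standard_simplex p"
    and el: "\<And>e. e \<in> edges G - S \<Longrightarrow> edge_length Es t e = l e"
    using m eH unfolding metric_flag_def by auto
  have len: "length Es = Suc p" and last: "Es ! p = edges G - S" and first: "Es ! 0 = {}"
    using Q eH by simp_all
  have "?Fs ! j \<subseteq> ?Fs ! Suc j" if "j < Suc p" for j
    using that len flagged_graph_mono[OF Q, of "j - 1" j] by (cases j) auto
  then have P: "flagged_graph (Suc p) (G, ?Fs)"
    using G len last S(1) by auto
  have nth1: "?Fs ! 1 = S" using len first by simp
  have "F \<union> S - S = F" if "F \<in> set Es" for F
    using flagged_graph_subset[OF Q that] eH by auto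
  \<comment> \<open>The sets of the flag avoid \<open>S\<close>, so removing \<open>S\<close> again
    in the zeroth face returns \<open>Es\<close> itself.\<close>
  then have Es: "map (\<lambda>F. F - ?Fs ! 1) (tl ?Fs) = Es"
    unfolding nth1 list.sel map_map by (intro map_idI) (simp only: o_def)
  have "edge_length ?Fs (simplical_face 0 t) e = l e" if "e \<in> edges G" for e
  proof (cases "e \<in> S")
    case True
    show ?thesis using edge_length_face_0(1)[OF P, unfolded nth1, OF True] S(2)[OF True] by metis
  next
    case False
    show ?thesis
      using edge_length_face_0(2)[OF P, unfolded Es, unfolded nth1, OF False] el[of e] that False
        by simp
  qed
  then have "metric_flag (Suc p) G l ?Fs (simplical_face 0 t)"
    using P simplical_face_in_simplex[OF le0 t] unfolding metric_flag_def by blast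
  then have "metric_point G l = cell_point p (graph_face (Suc p) 0 (iso_class (G, ?Fs))) t"
    using glue_graph_face[OF P _ t, of 0] by (simp only: metric_point_eq le0)
  also have "graph_face (Suc p) 0 (iso_class (G, ?Fs)) = iso_class (?H, Es)"
    using graph_face_0[OF P] unfolding Es unfolding nth1 .
  finally show ?thesis using metric_point_eq[OF m] by simp
qed

section \<open>Continuity and descent\<close>

abbreviation simplex_space :: "nat \<Rightarrow> (nat \<Rightarrow> real) topology" where
  "simplex_space p \<equiv> subtopology (powertop_real UNIV) (standard_simplex p)"

definition cells :: "((nat \<times> flag_class) \<times> (nat \<Rightarrow> real)) topology" where
  "cells = sum_topology (\<lambda>(p, x). simplex_space p) (SIGMA p:UNIV. graph_simplices p)"

definition cell_map :: "(nat \<times> flag_class) \<times> (nat \<Rightarrow> real) \<Rightarrow> ((nat \<times> flag_class) \<times> (nat \<Rightarrow> real)) set" where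
  "cell_map z = cell_point (fst (fst z)) (snd (fst z)) (snd z)"

lemma quotient_map_cells: "quotient_map cells M_Gr cell_map"
proof -
  have eq: "M_Gr = quotient_topology cells cell_map"
    unfolding M_Gr_def realization_def cells_def cell_map_def cell_point_def graph_simplicial_set_def
    by simp
  show ?thesis
    unfolding eq by (rule quotient_map_quotient_topology)
qed

lemma topspace_cells: "topspace cells = {((p, C), t). C \<in> graph_simplices p \<and> t \<in> standard_simplex p}"
  unfolding cells_def topspace_sum_topology by (auto simp: o_def)

lemma continuous_map_cell_point:
  assumes "C \<in> graph_simplices p"
  shows "continuous_map (simplex_space p) M_Gr (cell_point p C)"
proof -
  have "continuous_map ((\<lambda>(p, x). simplex_space p) (p, C)) cells (\<lambda>t. ((p, C), t))"
    unfolding cells_def by (rule continuous_map_component_injection) (simp add: assms)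
  then have "continuous_map (simplex_space p) cells (\<lambda>t. ((p, C), t))" by simp
  from continuous_map_compose[OF this quotient_imp_continuous_map[OF quotient_map_cells]]
  show ?thesis by (simp add: o_def cell_map_def)
qed

lemma cell_point_eq_metric_point:
  assumes "flagged_graph p (G, Es)" "t \<in> standard_simplex p"
  shows "cell_point p (iso_class (G, Es)) t = metric_point G (edge_length Es t)"
  by (rule metric_point_eq[symmetric]) (use assms in \<open>unfold metric_flag_def, blast\<close>)

lemma flagged_graph_finite: "flagged_graph p (G, Es) \<Longrightarrow> finite_multigraph G"
  by simp

lemma edge_length_unit:
  assumes "flagged_graph p (G, Es)" "t \<in> standard_simplex p"
  shows "unit_lengths G (edge_length Es t)"
proof -
  have len: "length Es = Suc p" using assms(1) by simp
  show ?thesis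
    by (intro ballI conjI edge_length_bounds[OF len assms(2)])
qed

text \<open>Functions obtained by descent are known only on graphs labelled by natural numbers. This
  copy carries their values to other types, such as roses and graphs with a complete graph
  added.\<close>

lemma metric_point_nat_copy:
  assumes "finite_multigraph G" "unit_lengths G l"
  obtains H :: "(nat, nat) multigraph" and f g m where "multigraph_iso f g G H" "finite_multigraph H"
    "unit_lengths H m" "\<And>e. e \<in> edges G \<Longrightarrow> m (g e) = l e" "metric_point G l = metric_point H m"
proof -
  obtain f g and H :: "(nat, nat) multigraph" where iso: "multigraph_iso f g G H"
    by (rule ex_nat_multigraph_iso[OF assms(1)])
  let ?m = "\<lambda>d. l (inv_into (edges G) g d)"
  have g: "inj_on g (edges G)" "edges H = g ` edges G"
    using iso by (auto simp: multigraph_iso_def bij_betw_def)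
  have m: "?m (g e) = l e" if "e \<in> edges G" for e
    using g(1) that by simp
  have "unit_lengths H ?m"
    unfolding g(2) using m assms(2) by simp
  then show ?thesis
    using that[OF iso finite_multigraph_iso[OF iso assms(1)] _ m metric_point_iso[OF iso assms m]]
      by blast
qed

lemma metric_point_in_topspace:
  assumes "finite_multigraph G" "unit_lengths G l"
  shows "metric_point G l \<in> topspace M_Gr"
proof -
  obtain p Es t where m: "metric_flag p G l Es t"
    by (rule ex_metric_flag[OF assms])
  then have P: "flagged_graph p (G, Es)" and t: "t \<in> standard_simplex p"
    unfolding metric_flag_def by blast+
  show ?thesis
    unfolding metric_point_eq[OF m]
    using continuous_map_image_subset_topspace[OF continuous_map_cell_point[OF iso_class_in_graph_simplices[OF P]]] t
    by auto
qed

lemma topspace_M_Gr_cases: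
  assumes "z \<in> topspace M_Gr"
  obtains G :: "(nat, nat) multigraph" and l where "finite_multigraph G" "unit_lengths G l" "z = metric_point G l"
proof -
  have "z \<in> cell_map ` topspace cells"
    using assms quotient_imp_surjective_map[OF quotient_map_cells] by simp
  then obtain p C t where C: "C \<in> graph_simplices p" and t: "t \<in> standard_simplex p"
    and z: "z = cell_point p C t"
    unfolding topspace_cells cell_map_def by auto
  obtain G :: "(nat, nat) multigraph" and Es where "C = iso_class (G, Es)" and P: "flagged_graph p (G, Es)"
    using C unfolding graph_simplices_def by fast
  then show ?thesis
    using that[OF flagged_graph_finite[OF P] edge_length_unit[OF P t]] cell_point_eq_metric_point[OF P t] z by simp
qed

section \<open>Continuity of the point in the lengths\<close>

lemma closedin_all_nonneg:
  assumes "\<And>i. i \<in> J \<Longrightarrow> continuous_map X euclideanreal (g i)"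
  shows "closedin X {x \<in> topspace X. \<forall>i\<in>J. 0 \<le> g i x}"
proof (cases "J = {}")
  case False
  have "closedin X {x \<in> topspace X. g i x \<in> {0..}}" if "i \<in> J" for i
    by (rule closedin_continuous_map_preimage[OF assms[OF that]]) simp
  then have "closedin X (\<Inter>i\<in>J. {x \<in> topspace X. g i x \<in> {0..}})"
    using False by (intro closedin_Inter) auto
  also have "(\<Inter>i\<in>J. {x \<in> topspace X. g i x \<in> {0..}}) = {x \<in> topspace X. \<forall>i\<in>J. 0 \<le> g i x}"
    using False by auto
  finally show ?thesis .
qed simp

text \<open>The regions on which the lengths have a given weak order form a finite closed cover, so
  one continuous formula per order suffices. On overlaps the formulas agree because each equals
  \<open>h\<close>.\<close>

lemma continuous_map_by_orders:
  fixes l :: "'a \<Rightarrow> 'e \<Rightarrow> real"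
  assumes E: "finite E" and l: "\<And>e. e \<in> E \<Longrightarrow> continuous_map X euclideanreal (\<lambda>x. l x e)"
    and f: "\<And>es. distinct es \<Longrightarrow> set es = E \<Longrightarrow>
      continuous_map (subtopology X {x \<in> topspace X. sorted (map (l x) es)}) Y (f es)"
    and h: "\<And>es x. distinct es \<Longrightarrow> set es = E \<Longrightarrow> x \<in> topspace X \<Longrightarrow> sorted (map (l x) es) \<Longrightarrow> h x = f es x"
  shows "continuous_map X Y h"
proof (rule pasting_lemma_closed[where I = "{es. distinct es \<and> set es = E}"
      and T = "\<lambda>es. {x \<in> topspace X. sorted (map (l x) es)}" and f = f])
  have "{es. distinct es \<and> set es = E} \<subseteq> {es. set es \<subseteq> E \<and> distinct es}" by auto
  then show "finite {es. distinct es \<and> set es = E}"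
    by (rule finite_subset) (rule finite_subset_distinct[OF E])
  show "closedin X {x \<in> topspace X. sorted (map (l x) es)}"
    if "es \<in> {es. distinct es \<and> set es = E}" for es
  proof -
    let ?J = "{(i, j). i \<le> j \<and> j < length es}"
    have "continuous_map X euclideanreal (case ij of (i, j) \<Rightarrow> \<lambda>x. l x (es ! j) - l x (es ! i))"
      if ijJ: "ij \<in> ?J" for ij
    proof -
      obtain i j where ij: "ij = (i, j)" "i \<le> j" "j < length es"
        using ijJ by (cases ij) simp
      have "es ! i \<in> E" "es ! j \<in> E"
        using ij \<open>es \<in> {es. distinct es \<and> set es = E}\<close> nth_mem[of i es] nth_mem[of j es] by auto
      then show ?thesis
        unfolding ij prod.case by (intro continuous_map_diff l)
    qed
    then have "closedin X {x \<in> topspace X. \<forall>ij\<in>?J. 0 \<le> (case ij of (i, j) \<Rightarrow> \<lambda>x. l x (es ! j) - l x (es ! i)) x}"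
      by (rule closedin_all_nonneg)
    also have "{x \<in> topspace X. \<forall>ij\<in>?J. 0 \<le> (case ij of (i, j) \<Rightarrow> \<lambda>x. l x (es ! j) - l x (es ! i)) x}
      = {x \<in> topspace X. sorted (map (l x) es)}"
      unfolding sorted_iff_nth_mono by auto
    finally show ?thesis .
  qed
  show "continuous_map (subtopology X {x \<in> topspace X. sorted (map (l x) es)}) Y (f es)"
    if "es \<in> {es. distinct es \<and> set es = E}" for es
    using f that by blast
  show "f i x = f j x" if "i \<in> {es. distinct es \<and> set es = E}" "j \<in> {es. distinct es \<and> set es = E}"
    "x \<in> topspace X \<inter> {x \<in> topspace X. sorted (map (l x) i)} \<inter> {x \<in> topspace X. sorted (map (l x) j)}" for i j x
  proof -
    have "h x = f i x" using that by (intro h) auto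
    moreover have "h x = f j x" using that by (intro h) auto
    ultimately show ?thesis by simp
  qed
  show "\<exists>j. j \<in> {es. distinct es \<and> set es = E} \<and> x \<in> {x \<in> topspace X. sorted (map (l x) j)} \<and> h x = f j x"
    if "x \<in> topspace X" for x
  proof -
    obtain xs where "set xs = E" "distinct xs"
      using finite_distinct_list[OF E] by metis
    then show ?thesis
      using that h[of "sort_key (l x) xs" x] by (intro exI[of _ "sort_key (l x) xs"]) simp
  qed
qed

text \<open>On a region of fixed order the point stays in a single simplex, and its coordinates are
  differences of consecutive lengths.\<close>

lemma continuous_map_metric_point:
  assumes G: "finite_multigraph G"
    and l: "\<And>e. e \<in> edges G \<Longrightarrow> continuous_map X euclideanreal (\<lambda>x. l x e)"
    and unit: "\<And>x. x \<in> topspace X \<Longrightarrow> unit_lengths G (l x)"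
  shows "continuous_map X M_Gr (\<lambda>x. metric_point G (l x))"
proof (rule continuous_map_by_orders[where E = "edges G" and l = l
      and f = "\<lambda>es x. cell_point (length es) (iso_class (G, prefixes es)) (gaps (l x) es)"])
  show "finite (edges G)" using G by (simp add: finite_multigraph_def)
  show "continuous_map X euclideanreal (\<lambda>x. l x e)" if "e \<in> edges G" for e
    using l[OF that] .
  fix es assume es: "distinct es" "set es = edges G"
  let ?X = "subtopology X {x \<in> topspace X. sorted (map (l x) es)}"
  have flag: "metric_flag (length es) G (l x) (prefixes es) (gaps (l x) es)"
    if "x \<in> topspace X" "sorted (map (l x) es)" for x
    by (rule metric_flag_order[OF G es that(2) unit[OF that(1)]])
  then show "metric_point G (l x) = cell_point (length es) (iso_class (G, prefixes es)) (gaps (l x) es)"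
    if "x \<in> topspace X" "sorted (map (l x) es)" for x
    using metric_point_eq that by blast
  show "continuous_map ?X M_Gr (\<lambda>x. cell_point (length es) (iso_class (G, prefixes es)) (gaps (l x) es))"
  \<comment> \<open>That the prefixes form a flag is read off from a point of the region, so an
    empty region is set aside.\<close>
  proof (cases "topspace ?X = {}")
    case True
    then show ?thesis by (simp add: continuous_map_def)
  next
    case False
    then obtain x where "x \<in> topspace X" "sorted (map (l x) es)" by auto
    then have P: "flagged_graph (length es) (G, prefixes es)"
      using flag unfolding metric_flag_def by blast
    have pos: "continuous_map ?X euclideanreal (\<lambda>x. position (l x) es j)" for j
    proof -
      consider "j = 0" | "0 < j" "j \<le> length es" | "length es < j" by linarith
      then show ?thesis
      proof cases
        case 2
        then have "es ! (j - 1) \<in> edges G" using es(2) nth_mem[of "j - 1" es] by auto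
        then show ?thesis
          using 2 l by (simp add: position_def continuous_map_from_subtopology)
      qed (simp_all add: position_def)
    qed
    have "continuous_map ?X (simplex_space (length es)) (\<lambda>x. gaps (l x) es)"
      unfolding continuous_map_in_subtopology continuous_map_componentwise_UNIV
    proof (intro conjI allI)
      show "continuous_map ?X euclideanreal (\<lambda>x. gaps (l x) es k)" for k
        unfolding gaps_def by (intro continuous_map_diff pos)
      show "(\<lambda>x. gaps (l x) es) \<in> topspace ?X \<rightarrow> standard_simplex (length es)"
        using flag unfolding metric_flag_def by auto
    qed
    from continuous_map_compose[OF this continuous_map_cell_point[OF iso_class_in_graph_simplices[OF P]]]
    show ?thesis by (simp add: o_def)
  qed
qed

text \<open>\<open>F'\<close> is the same function as \<open>F\<close>, on the vertex type that arises by a contraction.\<close>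

lemma metric_point_descent:
  fixes F :: "(nat, nat) multigraph \<Rightarrow> (nat \<Rightarrow> real) \<Rightarrow> 'c"
    and F' :: "(nat set, nat) multigraph \<Rightarrow> (nat \<Rightarrow> real) \<Rightarrow> 'c"
  assumes iso: "\<And>G H f g l m. finite_multigraph G \<Longrightarrow> unit_lengths G l \<Longrightarrow> multigraph_iso f g G H \<Longrightarrow>
      (\<And>e. e \<in> edges G \<Longrightarrow> m (g e) = l e) \<Longrightarrow> F G l = F H m"
    and iso': "\<And>G H f g l m. finite_multigraph G \<Longrightarrow> unit_lengths G l \<Longrightarrow> multigraph_iso f g G H \<Longrightarrow>
      (\<And>e. e \<in> edges G \<Longrightarrow> m (g e) = l e) \<Longrightarrow> F' G l = F H m"
    and delete: "\<And>G l S. finite_multigraph G \<Longrightarrow> unit_lengths G l \<Longrightarrow> S \<subseteq> edges G \<Longrightarrow>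
      (\<And>e. e \<in> S \<Longrightarrow> l e = 1) \<Longrightarrow> F (restrict_edges G (edges G - S)) l = F G l"
    and contract: "\<And>G l S. finite_multigraph G \<Longrightarrow> unit_lengths G l \<Longrightarrow> S \<subseteq> edges G \<Longrightarrow>
      (\<And>e. e \<in> S \<Longrightarrow> l e = 0) \<Longrightarrow> F' (contract_edges G S) l = F G l"
  obtains f where "\<And>G l. finite_multigraph G \<Longrightarrow> unit_lengths G l \<Longrightarrow> f (metric_point G l) = F G l"
proof -
  \<comment> \<open>\<open>\<phi>\<close> evaluates \<open>F\<close> on a chosen representative of
    the cell. Invariance under isomorphism makes the choice irrelevant, and \<open>\<phi>\<close>
    will be constant on glued points.\<close>
  define \<phi> where "\<phi> z = (case SOME P. P \<in> snd (fst z) of (G, Es) \<Rightarrow> F G (edge_length Es (snd z)))"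
    for z :: "(nat \<times> flag_class) \<times> (nat \<Rightarrow> real)"
  \<comment> \<open>The vertex type is left arbitrary: the fact serves for \<open>F\<close> on
    natural numbers and for \<open>F'\<close> on the sets of vertices that a contraction
    produces.\<close>
  have some: "\<exists>H Fs f g. multigraph_iso f g G H \<and> Fs = map ((`) g) Es \<and>
      \<phi> ((p, iso_class (G, Es)), t) = F H (edge_length Fs t) \<and>
      (\<forall>e\<in>edges G. edge_length Fs t (g e) = edge_length Es t e)"
    if P: "flagged_graph p (G, Es)" for p t and G :: "('v, nat) multigraph" and Es
  proof -
    obtain Q :: "(nat, nat) multigraph \<times> nat set list" where "flagged_iso (G, Es) Q"
      by (rule ex_nat_flagged_iso[OF P])
    then have "Q \<in> iso_class (G, Es)" by (simp add: iso_class_def)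
    then have "(SOME P. P \<in> iso_class (G, Es)) \<in> iso_class (G, Es)" by (rule someI)
    then have *: "flagged_iso (G, Es) (SOME P. P \<in> iso_class (G, Es))"
      by (simp add: iso_class_def)
    obtain H Fs where HFs: "(SOME P. P \<in> iso_class (G, Es)) = (H, Fs)"
      by (cases "SOME P. P \<in> iso_class (G, Es)")
    obtain f g where fg: "multigraph_iso f g G H" "Fs = map ((`) g) Es"
      using * unfolding HFs by (rule flagged_isoE)
    have "\<phi> ((p, iso_class (G, Es)), t) = F H (edge_length Fs t)"
      by (simp add: \<phi>_def HFs)
    moreover have "edge_length Fs t (g e) = edge_length Es t e" if "e \<in> edges G" for e
      unfolding fg(2)
    proof (rule edge_length_image)
      show "inj_on g (edges G)" using fg(1) by (simp add: multigraph_iso_def bij_betw_def)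
      show "\<forall>F\<in>set Es. F \<subseteq> edges G" using flagged_graph_subset[OF P] by blast
    qed (rule that)
    ultimately show ?thesis using fg by blast
  qed
  have phi: "\<phi> ((p, iso_class (G, Es)), t) = F G l"
    if P: "flagged_graph p (G, Es)" and t: "t \<in> standard_simplex p"
      and l: "\<And>e. e \<in> edges G \<Longrightarrow> l e = edge_length Es t e" for p G Es t l
  proof -
    obtain H Fs f g where H: "multigraph_iso f g G H"
      "\<phi> ((p, iso_class (G, Es)), t) = F H (edge_length Fs t)"
      "\<And>e. e \<in> edges G \<Longrightarrow> edge_length Fs t (g e) = edge_length Es t e"
      using some[OF P, of t] by blast
    have "unit_lengths G l"
    proof
      fix e assume e: "e \<in> edges G"
      show "0 \<le> l e \<and> l e \<le> 1"
        unfolding l[OF e] using edge_length_unit[OF P t] e by blast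
    qed
    then have "F G l = F H (edge_length Fs t)"
      by (rule iso[OF flagged_graph_finite[OF P] _ H(1)]) (simp only: l H(3))
    then show ?thesis using H(2) by simp
  qed
  have phi': "\<phi> ((p, iso_class (G, Es)), t) = F' G l"
    if P: "flagged_graph p (G, Es)" and t: "t \<in> standard_simplex p"
      and l: "\<And>e. e \<in> edges G \<Longrightarrow> l e = edge_length Es t e" for p G Es t l
  proof -
    obtain H Fs f g where H: "multigraph_iso f g G H"
      "\<phi> ((p, iso_class (G, Es)), t) = F H (edge_length Fs t)"
      "\<And>e. e \<in> edges G \<Longrightarrow> edge_length Fs t (g e) = edge_length Es t e"
      using some[OF P, of t] by blast
    have "unit_lengths G l"
    proof
      fix e assume e: "e \<in> edges G"
      show "0 \<le> l e \<and> l e \<le> 1"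
        unfolding l[OF e] using edge_length_unit[OF P t] e by blast
    qed
    then have "F' G l = F H (edge_length Fs t)"
      by (rule iso'[OF flagged_graph_finite[OF P] _ H(1)]) (simp only: l H(3))
    then show ?thesis using H(2) by simp
  qed
  have glue: "\<phi> z = \<phi> w" if "glue graph_simplicial_set z w" for z w
    using that
  proof (cases rule: glue.cases)
    case (glue_face x p i t)
    obtain G :: "(nat, nat) multigraph" and Es where x: "x = iso_class (G, Es)" and P: "flagged_graph (Suc p) (G, Es)"
      using glue_face(3) unfolding graph_simplicial_set_def graph_simplices_def
        by (simp del: flagged_graph.simps) fast
    have i: "i \<le> Suc p" and t: "t \<in> standard_simplex p" by fact+
    let ?t = "simplical_face i t"
    have t': "?t \<in> standard_simplex (Suc p)" by (rule simplical_face_in_simplex[OF i t])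
    have w: "w = ((p, graph_face (Suc p) i x), t)"
      using glue_face(2) by (simp add: graph_simplicial_set_def)
    have len: "length Es = Suc (Suc p)" and G: "finite_multigraph G" using P by simp_all
    have z: "\<phi> z = F G (edge_length Es ?t)"
      unfolding glue_face(1) x by (rule phi[OF P t']) simp
    note u = edge_length_unit[OF P t']
    consider "i = 0" | "0 < i" "i \<le> p" | "i = Suc p" using i by linarith
    then show ?thesis
    proof cases
      case 1
      have "\<phi> w = F' (contract_edges G (Es ! 1)) (edge_length Es ?t)"
        unfolding w x 1 graph_face_0[OF P]
        by (rule phi'[OF flagged_graph_contract[OF P] t])
          (simp add: contract_edges_def edge_length_face_0(2)[OF P, simplified])
      also have "\<dots> = F G (edge_length Es ?t)"
        using edge_length_face_0(1)[OF P, of _ t] flagged_graph_subset[OF P, of "Es ! 1"] len 1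
        by (intro contract[OF G u]) simp_all
      finally show ?thesis using z by simp
    next
      case 2
      have "\<phi> w = F G (edge_length Es ?t)"
        unfolding w x graph_face_mid[OF P 2]
        by (rule phi[OF flagged_graph_drop_nth[OF P 2] t]) (rule edge_length_simplical_face[OF len i])
      then show ?thesis using z by simp
    next
      case 3
      have "Es ! p \<subseteq> edges G"
        using flagged_graph_subset[OF P, of "Es ! p"] len by simp
      then have eq: "edges G - (edges G - Es ! p) = Es ! p" by blast
      have "\<phi> w = F (restrict_edges G (edges G - (edges G - Es ! p))) (edge_length Es ?t)"
        unfolding w x 3 graph_face_last[OF P] eq
        by (rule phi[OF flagged_graph_restrict[OF P] t]) (simp add: edge_length_face_last(2)[OF P t])
      also have "\<dots> = F G (edge_length Es ?t)"
        using edge_length_face_last(1)[OF P t] 3 by (intro delete[OF G u]) simp_all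
      finally show ?thesis using z by simp
    qed
  next
    case (glue_degen x p i t)
    obtain G :: "(nat, nat) multigraph" and Es where x: "x = iso_class (G, Es)" and P: "flagged_graph p (G, Es)"
      using glue_degen(3) unfolding graph_simplicial_set_def graph_simplices_def
        by (simp del: flagged_graph.simps) fast
    have i: "i \<le> p" and t: "t \<in> standard_simplex (Suc p)" by fact+
    let ?Ds = "take (Suc i) Es @ drop i Es"
    have z: "z = ((Suc p, graph_degen p i x), t)"
      using glue_degen(1) by (simp add: graph_simplicial_set_def)
    have D: "flagged_graph (Suc p) (G, ?Ds)" by (rule flagged_graph_repeat_nth[OF P i])
    have len: "length Es = Suc p" using P by simp
    have "?Ds ! i = ?Ds ! Suc i"
      using len i by (simp add: nth_append)
    moreover have "metric_flag (Suc p) G (edge_length ?Ds t) ?Ds t"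
      using D t unfolding metric_flag_def by blast
    ultimately have "metric_flag p G (edge_length ?Ds t) (take i ?Ds @ drop (Suc i) ?Ds) (codegeneracy i t)"
      using metric_flag_merge(1)[of p G "edge_length ?Ds t" ?Ds t i] i by blast
    moreover have "take i ?Ds @ drop (Suc i) ?Ds = Es"
      using len i by (simp add: min_def)
    ultimately have "edge_length Es (codegeneracy i t) e = edge_length ?Ds t e" if "e \<in> edges G"
      for e
      using that unfolding metric_flag_def by simp
    moreover have "\<phi> w = F G (edge_length Es (codegeneracy i t))"
      unfolding glue_degen(2) x by (rule phi[OF P codegeneracy_in_standard_simplex[OF t i]]) simp
    moreover have "\<phi> z = F G (edge_length Es (codegeneracy i t))"
      unfolding z x graph_degen_iso_class[OF P i] using calculation(1)
      by (intro phi[OF D t]) simp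
    ultimately show ?thesis by simp
  qed
  have eq: "\<phi> z = \<phi> w" if "equivclp (glue graph_simplicial_set) z w" for z w
    using that by (induction rule: equivclp_induct) (auto dest: glue)
  have F: "F G l = F H m" if G: "finite_multigraph G" "unit_lengths G l"
    and H: "finite_multigraph H" "unit_lengths H m" and "metric_point G l = metric_point H m"
      for G H l m
  proof -
    obtain p Es t where P: "metric_flag p G l Es t" by (rule ex_metric_flag[OF G])
    obtain q Fs u where Q: "metric_flag q H m Fs u" by (rule ex_metric_flag[OF H])
    have "cell_point p (iso_class (G, Es)) t = cell_point q (iso_class (H, Fs)) u"
      using that(5) unfolding metric_point_eq[OF P] metric_point_eq[OF Q] .
    moreover have "((q, iso_class (H, Fs)), u) \<in> cell_point q (iso_class (H, Fs)) u"
      by (simp add: cell_point_def)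
    ultimately have "((q, iso_class (H, Fs)), u) \<in> cell_point p (iso_class (G, Es)) t" by simp
    then have *: "\<phi> ((p, iso_class (G, Es)), t) = \<phi> ((q, iso_class (H, Fs)), u)"
      unfolding cell_point_def by (intro eq) simp
    have "\<phi> ((p, iso_class (G, Es)), t) = F G l"
      using P unfolding metric_flag_def by (intro phi) (blast, blast, metis)
    moreover have "\<phi> ((q, iso_class (H, Fs)), u) = F H m"
      using Q unfolding metric_flag_def by (intro phi) (blast, blast, metis)
    ultimately show ?thesis using * by simp
  qed
  define Q where "Q z P \<longleftrightarrow> finite_multigraph (fst P) \<and> unit_lengths (fst P) (snd P) \<and>
     metric_point (fst P) (snd P) = z" for z and P :: "(nat, nat) multigraph \<times> (nat \<Rightarrow> real)"
  define f where "f z = F (fst (SOME P. Q z P)) (snd (SOME P. Q z P))" for z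
  show ?thesis
  proof (rule that)
    fix G :: "(nat, nat) multigraph" and l assume G: "finite_multigraph G" "unit_lengths G l"
    have "Q (metric_point G l) (G, l)" using G unfolding Q_def by simp
    then have "Q (metric_point G l) (SOME P. Q (metric_point G l) P)" by (rule someI)
    then show "f (metric_point G l) = F G l"
      unfolding f_def Q_def by (intro F G) blast+
  qed
qed

section \<open>Open sets of the realization and homotopies on its subspaces, tested on
  lengths\<close>

lemma continuous_map_edge_length:
  assumes "continuous_map X (powertop_real UNIV) \<tau>"
  shows "continuous_map X (powertop_real UNIV) (\<lambda>x. edge_length Es (\<tau> x))"
  unfolding continuous_map_componentwise_UNIV edge_length_def
proof (intro allI continuous_map_sum finite_lessThan)
  fix e i
  have "continuous_map X euclideanreal (\<lambda>x. \<tau> x i)"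
    using assms unfolding continuous_map_componentwise_UNIV by blast
  then show "continuous_map X euclideanreal (\<lambda>x. if e \<in> Es ! i then 0 else \<tau> x i)"
    by (cases "e \<in> Es ! i") simp_all
qed

lemma continuous_map_snd_cells: "continuous_map cells (powertop_real UNIV) snd"
  unfolding continuous_map_def
proof (intro conjI allI impI)
  fix U :: "(nat \<Rightarrow> real) set" assume U: "openin (powertop_real UNIV) U"
  have "{t. ((p, C), t) \<in> {z \<in> topspace cells. snd z \<in> U}} = standard_simplex p \<inter> U"
    if "C \<in> graph_simplices p" for p C
    using that by (auto simp: topspace_cells)
  then show "openin cells {z \<in> topspace cells. snd z \<in> U}"
    unfolding cells_def openin_sum_topology using U
    by (auto simp: cells_def[symmetric] topspace_cells intro: openin_subtopology_Int2)
qed auto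

lemma graph_simplices_cases:
  assumes "C \<in> graph_simplices p"
  obtains G :: "(nat, nat) multigraph" and Es where "C = iso_class (G, Es)" "flagged_graph p (G, Es)"
  using assms unfolding graph_simplices_def by fast

text \<open>A simplex maps to the realization through the space of lengths of its graph, by the
  continuous map \<open>edge_length\<close>. So a set that is open in the lengths of every fixed
  graph has open preimage in all cells.\<close>

lemma openin_M_Gr:
  assumes V: "V \<subseteq> topspace M_Gr"
    and *: "\<And>G :: (nat, nat) multigraph. finite_multigraph G \<Longrightarrow>
      openin (subtopology (powertop_real UNIV) {l. unit_lengths G l}) {l. unit_lengths G l \<and> metric_point G l \<in> V}"
  shows "openin M_Gr V"
proof -
  have "openin cells {z \<in> topspace cells. cell_map z \<in> V}"
    unfolding cells_def openin_sum_topology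
  proof (intro conjI ballI)
    fix k assume "k \<in> (SIGMA p:UNIV. graph_simplices p)"
    then obtain p C where k: "k = (p, C)" "C \<in> graph_simplices p" by auto
    obtain G :: "(nat, nat) multigraph" and Es where C: "C = iso_class (G, Es)" and P: "flagged_graph p (G, Es)"
      by (rule graph_simplices_cases[OF k(2)])
    let ?U = "{l. unit_lengths G l \<and> metric_point G l \<in> V}"
    have "continuous_map (simplex_space p) (subtopology (powertop_real UNIV) {l. unit_lengths G l}) (edge_length Es)"
      unfolding continuous_map_in_subtopology
    proof
      show "continuous_map (simplex_space p) (powertop_real UNIV) (edge_length Es)"
        by (rule continuous_map_edge_length[of _ "\<lambda>x. x"])
          (rule continuous_map_from_subtopology[OF continuous_map_id[unfolded id_def]])
      show "edge_length Es \<in> topspace (simplex_space p) \<rightarrow> {l. unit_lengths G l}"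
        using edge_length_unit[OF P] by auto
    qed
    from openin_continuous_map_preimage[OF this *[OF flagged_graph_finite[OF P]]]
    have "openin (simplex_space p) {t \<in> topspace (simplex_space p). edge_length Es t \<in> ?U}" .
    moreover have "{t. (k, t) \<in> {z \<in> topspace cells. cell_map z \<in> V}}
      = {t \<in> topspace (simplex_space p). edge_length Es t \<in> ?U}"
      unfolding k(1) topspace_cells cell_map_def
      using k(2) cell_point_eq_metric_point[OF P] edge_length_unit[OF P] C by auto
    ultimately show "openin (case k of (p, x) \<Rightarrow> simplex_space p)
       {x. (k, x) \<in> {z \<in> topspace (sum_topology (\<lambda>(p, x). simplex_space p) (SIGMA p:UNIV. graph_simplices p)).
          cell_map z \<in> V}}"
      by (simp add: k(1) cells_def[symmetric])
  qed auto
  then show ?thesis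
    using quotient_map_cells V unfolding quotient_map_def by blast
qed

lemma closedin_M_Gr:
  assumes V: "V \<subseteq> topspace M_Gr"
    and *: "\<And>G :: (nat, nat) multigraph. finite_multigraph G \<Longrightarrow>
      closedin (subtopology (powertop_real UNIV) {l. unit_lengths G l}) {l. unit_lengths G l \<and> metric_point G l \<in> V}"
  shows "closedin M_Gr V"
  unfolding closedin_def
proof (intro conjI V openin_M_Gr)
  fix G :: "(nat, nat) multigraph" assume G: "finite_multigraph G"
  let ?X = "subtopology (powertop_real UNIV) {l. unit_lengths G l}"
  have "{l. unit_lengths G l \<and> metric_point G l \<in> topspace M_Gr - V}
    = topspace ?X - {l. unit_lengths G l \<and> metric_point G l \<in> V}"
    using metric_point_in_topspace[OF G] by auto
  then show "openin ?X {l. unit_lengths G l \<and> metric_point G l \<in> topspace M_Gr - V}"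
    using *[OF G] by (simp only: openin_diff openin_topspace)
qed auto

text \<open>A quotient map restricts to preimages of open and of closed sets, but not of arbitrary
  ones. The graphs with exactly \<open>n\<close> vertices form an open set intersected with a closed
  one, so the restriction is done twice.\<close>

lemma quotient_map_cells_restrict:
  assumes A: "openin M_Gr A" and B: "closedin M_Gr B"
  shows "quotient_map (subtopology cells {z \<in> topspace cells. cell_map z \<in> A \<inter> B}) (subtopology M_Gr (A \<inter> B)) cell_map"
proof -
  have 1: "quotient_map (subtopology cells {z \<in> topspace cells. cell_map z \<in> A}) (subtopology M_Gr A) cell_map"
    by (rule quotient_map_restriction[OF quotient_map_cells refl]) (use A in blast)
  have "quotient_map (subtopology (subtopology cells {z \<in> topspace cells. cell_map z \<in> A})
       {z \<in> topspace cells. cell_map z \<in> A \<inter> B})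
     (subtopology (subtopology M_Gr A) (A \<inter> B)) cell_map"
  proof (rule quotient_map_restriction[OF 1])
    show "openin (subtopology M_Gr A) (A \<inter> B) \<or> closedin (subtopology M_Gr A) (A \<inter> B)"
      using closedin_subtopology_Int_closed[OF B] by blast
  qed auto
  moreover have "{z \<in> topspace cells. cell_map z \<in> A} \<inter> {z \<in> topspace cells. cell_map z \<in> A \<inter> B}
    = {z \<in> topspace cells. cell_map z \<in> A \<inter> B}" by blast
  ultimately show ?thesis
    by (simp add: subtopology_subtopology)
qed

text \<open>The interval is locally compact and Hausdorff, so its product with a quotient map is
  again a quotient map. A homotopy may therefore be checked upstairs on the cells, and there through
  the lengths of one graph at a time.\<close>

lemma continuous_map_homotopy_M_Gr:
  fixes h :: "real \<times> ((nat \<times> flag_class) \<times> (nat \<Rightarrow> real)) set \<Rightarrow> 'b"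
  assumes AB: "openin M_Gr A" "closedin M_Gr B"
    and h: "\<And>G :: (nat, nat) multigraph. finite_multigraph G \<Longrightarrow>
      continuous_map (subtopology (prod_topology (top_of_set {0..1}) (powertop_real UNIV))
          {(s, l). unit_lengths G l \<and> metric_point G l \<in> A \<inter> B}) Y (\<lambda>(s, l). h (s, metric_point G l))"
  shows "continuous_map (prod_topology (top_of_set {0..1}) (subtopology M_Gr (A \<inter> B))) Y h"
proof -
  let ?I = "top_of_set {0..1 :: real}" and ?D = "{z \<in> topspace cells. cell_map z \<in> A \<inter> B}"
  let ?P = "prod_topology ?I (subtopology cells ?D)"
  have I: "locally_compact_space ?I" "Hausdorff_space ?I"
    by (auto intro!: compact_imp_locally_compact_space Hausdorff_space_subtopology simp: compact_space_subtopology)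
  have Q: "quotient_map ?P (prod_topology ?I (subtopology M_Gr (A \<inter> B))) (\<lambda>(x, y). (x, cell_map y))"
    using quotient_map_prod_right[OF I(1) _ quotient_map_cells_restrict[OF AB]] I(2) by blast
  have "continuous_map ?P Y (\<lambda>w. h (fst w, cell_map (snd w)))"
  \<comment> \<open>The single cells are open in their disjoint sum, so continuity is a question
    about each cell alone.\<close>
  proof (rule pasting_lemma[where I = "SIGMA p:UNIV. graph_simplices p"
        and T = "\<lambda>k. {w \<in> topspace ?P. snd w \<in> {z \<in> topspace cells. fst z = k}}"
        and f = "\<lambda>_ w. h (fst w, cell_map (snd w))"])
    have snd: "continuous_map ?P cells snd"
      using continuous_map_into_fulltopology[OF continuous_map_snd] by blast
    fix k assume "k \<in> (SIGMA p:UNIV. graph_simplices p)"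
    then obtain p C where k: "k = (p, C)" "C \<in> graph_simplices p" by auto
    obtain G :: "(nat, nat) multigraph" and Es where C: "C = iso_class (G, Es)" and P: "flagged_graph p (G, Es)"
      by (rule graph_simplices_cases[OF k(2)])
    let ?T = "{w \<in> topspace ?P. snd w \<in> {z \<in> topspace cells. fst z = k}}"
    have "openin cells {z \<in> topspace cells. fst z = k}"
      unfolding cells_def openin_sum_topology
    proof (intro conjI ballI)
      fix k' :: "nat \<times> flag_class" assume k': "k' \<in> (SIGMA p:UNIV. graph_simplices p)"
      have "{t. (k', t) \<in> {z \<in> topspace (sum_topology (\<lambda>(p, x). simplex_space p) (SIGMA p:UNIV. graph_simplices p)). fst z = k}}
        = (if k' = k then topspace (case k' of (p, x) \<Rightarrow> simplex_space p) else {})"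
        using k' by auto
      then show "openin (case k' of (p, x) \<Rightarrow> simplex_space p)
         {t. (k', t) \<in> {z \<in> topspace (sum_topology (\<lambda>(p, x). simplex_space p) (SIGMA p:UNIV. graph_simplices p)). fst z = k}}"
        by (simp only: openin_topspace openin_empty split: if_split) simp
    qed auto
    then show "openin ?P ?T"
      by (rule openin_continuous_map_preimage[OF snd])
    let ?l = "\<lambda>w. edge_length Es (snd (snd w))"
    let ?W = "{(s, l). unit_lengths G l \<and> metric_point G l \<in> A \<inter> B}"
    have simp: "snd (snd w) \<in> standard_simplex p \<and> cell_map (snd w) = metric_point G (?l w)
      \<and> cell_map (snd w) \<in> A \<inter> B"
      if "w \<in> ?T" for w
    proof -
      have "snd w = (k, snd (snd w))" "snd w \<in> topspace cells" and D: "snd w \<in> ?D"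
        using that by (auto simp: prod_eq_iff)
      then have s: "snd (snd w) \<in> standard_simplex p"
        unfolding k(1) topspace_cells by auto
      moreover have "cell_map (snd w) = metric_point G (?l w)"
        using cell_point_eq_metric_point[OF P s] that unfolding cell_map_def k(1) C by simp
      ultimately show ?thesis using D by blast
    qed
    have "continuous_map (subtopology ?P ?T) (subtopology (prod_topology ?I (powertop_real UNIV)) ?W)
       (\<lambda>w. (fst w, ?l w))"
    proof (rule continuous_map_into_subtopology)
      have "continuous_map (subtopology ?P ?T) ?I fst"
        by (rule continuous_map_from_subtopology[OF continuous_map_fst])
      moreover have "continuous_map (subtopology ?P ?T) (powertop_real UNIV) ?l"
        using continuous_map_compose[OF snd continuous_map_snd_cells]
        by (intro continuous_map_edge_length continuous_map_from_subtopology) (simp add: o_def)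
      ultimately show "continuous_map (subtopology ?P ?T) (prod_topology ?I (powertop_real UNIV)) (\<lambda>w. (fst w, ?l w))"
        by (simp add: continuous_map_pairwise o_def)
      show "(\<lambda>w. (fst w, ?l w)) \<in> topspace (subtopology ?P ?T) \<rightarrow> ?W"
      proof
        fix w assume "w \<in> topspace (subtopology ?P ?T)"
        then have "w \<in> ?T" by auto
        then show "(fst w, ?l w) \<in> ?W"
          using simp[of w] edge_length_unit[OF P, of "snd (snd w)"] by auto
      qed
    qed
    from continuous_map_compose[OF this h[OF flagged_graph_finite[OF P]]]
    have "continuous_map (subtopology ?P ?T) Y (\<lambda>w. h (fst w, metric_point G (?l w)))"
      by (simp add: o_def)
    then show "continuous_map (subtopology ?P ?T) Y (\<lambda>w. h (fst w, cell_map (snd w)))"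
      by (rule continuous_map_eq) (use simp in auto)
  next
    fix w assume "w \<in> topspace ?P"
    then have "snd w \<in> topspace cells" by auto
    then show "\<exists>j. j \<in> (SIGMA p:UNIV. graph_simplices p) \<and>
       w \<in> {w \<in> topspace ?P. snd w \<in> {z \<in> topspace cells. fst z = j}} \<and>
       h (fst w, cell_map (snd w)) = h (fst w, cell_map (snd w))"
      using \<open>w \<in> topspace ?P\<close> by (intro exI[of _ "fst (snd w)"]) (auto simp: topspace_cells)
  qed simp
  moreover have "(\<lambda>w. h (fst w, cell_map (snd w))) = h \<circ> (\<lambda>(x, y). (x, cell_map y))"
    by auto
  ultimately show ?thesis
    using continuous_compose_quotient_map_eq[OF Q, of Y h] by simp
qed

section \<open>Counting components\<close>

definition num_comps :: "('v, 'e) multigraph \<Rightarrow> 'e set \<Rightarrow> nat" where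
  "num_comps G S = card (verts G // connected_via G S)"

lemma card_quotient_eq:
  assumes r: "equiv A r" and s: "equiv B s" and f: "f ` A = B"
    and iff: "\<And>u v. u \<in> A \<Longrightarrow> v \<in> A \<Longrightarrow> (f u, f v) \<in> s \<longleftrightarrow> (u, v) \<in> r"
  shows "card (A // r) = card (B // s)"
proof -
  have rA: "(u, v) \<in> r \<Longrightarrow> v \<in> A" for u v using r by (auto elim: equivE)
  have sB: "(u, v) \<in> s \<Longrightarrow> v \<in> B" for u v using s by (auto elim: equivE)
  have img: "f ` (r `` {u}) = s `` {f u}" if "u \<in> A" for u
  proof (intro equalityI subsetI)
    fix y assume "y \<in> s `` {f u}"
    then have y: "(f u, y) \<in> s" by simp
    then obtain v where "v \<in> A" "y = f v" using sB f by blast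
    then show "y \<in> f ` (r `` {u})" using iff[OF that, of v] y by blast
  qed (use iff[OF that] rA in blast)
  have "inj_on ((`) f) (A // r)"
  proof (rule inj_onI)
    fix X Y assume "X \<in> A // r" "Y \<in> A // r" and eq: "f ` X = f ` Y"
    then obtain u v where u: "u \<in> A" "X = r `` {u}" and v: "v \<in> A" "Y = r `` {v}"
      by (auto elim!: quotientE)
    have "(f u, f v) \<in> s"
      using eq img[OF u(1)] img[OF v(1)] u(2) v(2) f u(1) v(1) eq_equiv_class_iff[OF s, of "f u" "f v"] by auto
    then show "X = Y"
      using iff[OF u(1) v(1)] u(2) v(2) equiv_class_eq[OF r] by simp
  qed
  moreover have "(`) f ` (A // r) = B // s"
    unfolding quotient_as_image f[symmetric] image_image by (intro image_cong refl img)
  ultimately show ?thesis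
    using card_image by metis
qed

lemma ends_doubleton:
  assumes "finite_multigraph G" "e \<in> edges G"
  obtains a b where "ends G e = {a, b}" "a \<in> verts G" "b \<in> verts G"
proof -
  have *: "ends G e \<subseteq> verts G" "card (ends G e) = 1 \<or> card (ends G e) = 2"
    using assms unfolding finite_multigraph_def by auto
  from *(2) show ?thesis
  proof
    assume "card (ends G e) = 1"
    then obtain a where "ends G e = {a}" by (rule card_1_singletonE)
    then show ?thesis using that[of a a] *(1) by simp
  next
    assume "card (ends G e) = 2"
    then obtain a b where "ends G e = {a, b}" unfolding card_2_iff by metis
    then show ?thesis using that[of a b] *(1) by simp
  qed
qed

text \<open>A walk through \<open>S \<union> T\<close> maps to the contracted graph, its steps in
  \<open>S\<close> becoming constant. Conversely an edge of \<open>T\<close> between components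
  lifts, but possibly to another vertex of the component than the one reached so far; a detour
  inside the component along \<open>S\<close> closes the gap.\<close>

lemma connected_via_contract:
  assumes G: "finite_multigraph G" and S: "S \<subseteq> edges G" and T: "T \<subseteq> edges G - S"
    and u: "u \<in> verts G" and v: "v \<in> verts G"
  shows "(connected_via G S `` {u}, connected_via G S `` {v}) \<in> connected_via (contract_edges G S) T
    \<longleftrightarrow> (u, v) \<in> connected_via G (S \<union> T)"
proof
  let ?c = "\<lambda>v. connected_via G S `` {v}" and ?H = "contract_edges G S"
  note H = finite_contract_edges[OF G, of S]
  have c_eq: "?c x = ?c y \<longleftrightarrow> (x, y) \<in> connected_via G S"
    if "x \<in> verts G" "y \<in> verts G" for x y
    by (rule eq_equiv_class_iff[OF equiv_connected_via that])
  have vH: "verts ?H = ?c ` verts G" by (simp add: contract_edges_def quotient_as_image)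
  have eH: "ends ?H e = ?c ` ends G e" for e by (simp add: contract_edges_def)
  {
    assume "(u, v) \<in> connected_via G (S \<union> T)"
    then show "(?c u, ?c v) \<in> connected_via ?H T"
    proof (rule connected_via_map[OF _ G])
      show "S \<union> T \<subseteq> edges G" using S T by blast
      show "?c ` verts G \<subseteq> verts ?H" using vH by simp
      fix e x y assume e: "e \<in> S \<union> T" "ends G e = {x, y}"
      have "e \<in> edges G" using e(1) S T by blast
      then have xy: "{x, y} \<subseteq> verts G"
        using G unfolding finite_multigraph_def e(2)[symmetric] by blast
      show "(?c x, ?c y) \<in> connected_via ?H T"
      proof (cases "e \<in> S")
        case True
        then have "?c x = ?c y"
          using c_eq connected_via_edge[OF _ e(2) xy] xy by simp
        then show ?thesis using connected_via_refl[of "?c x" ?H T] vH xy by simp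
      next
        case False
        then have "e \<in> T" using e(1) by blast
        moreover have "ends ?H e = {?c x, ?c y}" unfolding eH e(2) by simp
        moreover have "{?c x, ?c y} \<subseteq> verts ?H" using vH xy by simp
        ultimately show ?thesis by (rule connected_via_edge)
      qed
    qed
  }
  assume "(?c u, ?c v) \<in> connected_via ?H T"
  then have "\<exists>w\<in>verts G. ?c v = ?c w \<and> (u, w) \<in> connected_via G (S \<union> T)"
    using H
  proof (rule connected_via_induct)
    show "T \<subseteq> edges ?H" using T by (simp add: contract_edges_def)
    show "\<exists>w\<in>verts G. ?c u = ?c w \<and> (u, w) \<in> connected_via G (S \<union> T)"
      using u connected_via_refl[OF u, of "S \<union> T"] by blast
    fix X Y e
    assume "\<exists>w\<in>verts G. X = ?c w \<and> (u, w) \<in> connected_via G (S \<union> T)"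
      and e: "e \<in> T" "ends ?H e = {X, Y}"
    then obtain w where w: "w \<in> verts G" "X = ?c w" "(u, w) \<in> connected_via G (S \<union> T)" by blast
    have eG: "e \<in> edges G" using e(1) T by blast
    obtain a b where ab: "ends G e = {a, b}" "a \<in> verts G" "b \<in> verts G"
      by (rule ends_doubleton[OF G eG])
    have "(a, b) \<in> connected_via G (S \<union> T)"
      using ab e(1) by (intro connected_via_edge[of e]) simp_all
    note abST = this connected_via_sym[OF this]
    have "{?c a, ?c b} = {?c w, Y}"
      using e(2) unfolding eH ab(1) w(2) by simp
    then have "(?c a = ?c w \<and> ?c b = Y) \<or> (?c a = Y \<and> ?c b = ?c w)"
      unfolding doubleton_eq_iff .
    then obtain x y where "x \<in> verts G" "y \<in> verts G" "?c w = ?c x" "Y = ?c y" "(x, y) \<in> connected_via G (S \<union> T)"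
      using ab abST by metis
    moreover have "(w, x) \<in> connected_via G (S \<union> T)"
      using c_eq[OF w(1) \<open>x \<in> verts G\<close>] \<open>?c w = ?c x\<close> connected_via_mono[of S "S \<union> T" G] by blast
    ultimately show "\<exists>w\<in>verts G. Y = ?c w \<and> (u, w) \<in> connected_via G (S \<union> T)"
      using connected_via_trans[OF connected_via_trans[OF w(3)]] by blast
  qed
  then obtain w where w: "w \<in> verts G" "?c v = ?c w" "(u, w) \<in> connected_via G (S \<union> T)" by blast
  have "(w, v) \<in> connected_via G (S \<union> T)"
    using c_eq[OF w(1) v] w(2) connected_via_mono[of S "S \<union> T" G] by blast
  then show "(u, v) \<in> connected_via G (S \<union> T)"
    by (rule connected_via_trans[OF w(3)])
qed

lemma num_comps_contract:
  assumes G: "finite_multigraph G" and ST: "S \<subseteq> T" "T \<subseteq> edges G"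
  shows "num_comps (contract_edges G S) (T - S) = num_comps G T"
  unfolding num_comps_def
proof (rule card_quotient_eq[OF equiv_connected_via equiv_connected_via, symmetric])
  show "(\<lambda>v. connected_via G S `` {v}) ` verts G = verts (contract_edges G S)"
    by (simp add: contract_edges_def quotient_as_image)
  have "S \<union> (T - S) = T" using ST(1) by blast
  then show "(connected_via G S `` {u}, connected_via G S `` {v}) \<in> connected_via (contract_edges G S) (T - S)
    \<longleftrightarrow> (u, v) \<in> connected_via G T" if "u \<in> verts G" "v \<in> verts G" for u v
    using connected_via_contract[OF G _ _ that, of S "T - S"] ST by fastforce
qed

lemma num_comps_iso:
  assumes "multigraph_iso f g G H" "finite_multigraph G" "S \<subseteq> edges G"
  shows "num_comps H (g ` S) = num_comps G S"
  unfolding num_comps_def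
  by (rule card_quotient_eq[OF equiv_connected_via equiv_connected_via, symmetric, where f = f])
    (use assms(1) connected_via_iso[OF assms] in \<open>auto simp: multigraph_iso_def bij_betw_def\<close>)

lemma connected_via_restrict_edges [simp]: "connected_via (restrict_edges G A) S = connected_via G S"
  by (simp add: connected_via_def restrict_edges_def)

lemma num_comps_restrict_edges [simp]: "num_comps (restrict_edges G A) S = num_comps G S"
  unfolding num_comps_def connected_via_restrict_edges by (simp add: restrict_edges_def)

lemma connected_via_absorb:
  assumes "S \<subseteq> T" "v \<in> verts G"
  shows "connected_via G T `` (connected_via G S `` {v}) = connected_via G T `` {v}"
proof -
  have "(v, v) \<in> connected_via G S" by (rule connected_via_refl[OF assms(2)])
  then show ?thesis
    using connected_via_mono[OF assms(1), of G] connected_via_trans[of v _ G T] by blast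
qed

lemma image_comps:
  assumes "S \<subseteq> T"
  shows "verts G // connected_via G T = (\<lambda>X. connected_via G T `` X) ` (verts G // connected_via G S)"
  unfolding quotient_as_image image_image
  by (intro image_cong refl connected_via_absorb[OF assms, symmetric])

lemma num_comps_mono:
  assumes "finite_multigraph G" "S \<subseteq> T"
  shows "num_comps G T \<le> num_comps G S"
  unfolding num_comps_def image_comps[OF assms(2)]
  using assms(1) by (intro card_image_le) (simp add: quotient_as_image finite_multigraph_def)

text \<open>Components for \<open>T\<close> are unions of components for \<open>S\<close>, and equal
  finite numbers leave no room for merging. Later this makes the collapsed graph locally constant
  where the number of vertices is constant.\<close>

lemma connected_via_eq:
  assumes G: "finite_multigraph G" and ST: "S \<subseteq> T" and eq: "num_comps G S = num_comps G T"
  shows "connected_via G S = connected_via G T"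
proof
  have "finite (verts G // connected_via G S)"
    using G by (simp add: quotient_as_image finite_multigraph_def)
  then have inj: "inj_on (\<lambda>X. connected_via G T `` X) (verts G // connected_via G S)"
    using eq unfolding num_comps_def image_comps[OF ST] by (intro eq_card_imp_inj_on) simp_all
  show "connected_via G T \<subseteq> connected_via G S"
  proof (rule subrelI)
    fix u v assume uv: "(u, v) \<in> connected_via G T"
    then have u: "u \<in> verts G" and v: "v \<in> verts G" by (simp_all add: connected_via_iff)
    have "connected_via G T `` (connected_via G S `` {u}) = connected_via G T `` (connected_via G S `` {v})"
      unfolding connected_via_absorb[OF ST u] connected_via_absorb[OF ST v]
      by (rule equiv_class_eq[OF equiv_connected_via uv])
    then have "connected_via G S `` {u} = connected_via G S `` {v}"
      by (rule inj_onD[OF inj]) (simp_all add: quotient_as_image u v)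
    then show "(u, v) \<in> connected_via G S"
      using eq_equiv_class_iff[OF equiv_connected_via u v] by blast
  qed
qed (rule connected_via_mono[OF ST])

lemma num_comps_eq_0:
  "finite_multigraph G \<Longrightarrow> num_comps G S = 0 \<longleftrightarrow> verts G = {}"
  unfolding num_comps_def by (simp add: quotient_as_image finite_multigraph_def)

text \<open>The choice is justified by descent whenever \<open>P\<close> holds at 0 and fails at 1:
  contracted edges then belong to the set that is counted with, so \<open>num_comps_contract\<close>
  applies, and deleted edges do not belong to it.\<close>

definition comps :: "(real \<Rightarrow> bool) \<Rightarrow> ((nat \<times> flag_class) \<times> (nat \<Rightarrow> real)) set \<Rightarrow> nat" where
  "comps P = (SOME c. \<forall>G :: (nat, nat) multigraph. \<forall>l. finite_multigraph G \<longrightarrow> unit_lengths G l \<longrightarrow>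
     c (metric_point G l) = num_comps G {e \<in> edges G. P (l e)})"

lemma image_length_set:
  assumes "multigraph_iso f g G H" "\<And>e. e \<in> edges G \<Longrightarrow> m (g e) = l e"
  shows "{e \<in> edges H. P (m e)} = g ` {e \<in> edges G. P (l e)}"
proof -
  have "edges H = g ` edges G"
    using assms(1) by (simp add: multigraph_iso_def bij_betw_def)
  then show ?thesis using assms(2) by auto
qed

lemma num_comps_length_set_iso:
  assumes "finite_multigraph G" "multigraph_iso f g G H" "\<And>e. e \<in> edges G \<Longrightarrow> m (g e) = l e"
  shows "num_comps G {e \<in> edges G. P (l e)} = num_comps H {e \<in> edges H. P (m e)}"
proof -
  have eq: "{e \<in> edges H. P (m e)} = g ` {e \<in> edges G. P (l e)}"
    by (rule image_length_set[OF assms(2)]) (rule assms(3))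
  have "num_comps H (g ` {e \<in> edges G. P (l e)}) = num_comps G {e \<in> edges G. P (l e)}"
    by (rule num_comps_iso[OF assms(2,1)]) blast
  then show ?thesis unfolding eq ..
qed

lemma comps_nat_metric_point:
  fixes G :: "(nat, nat) multigraph"
  assumes P: "P 0" "\<not> P 1" and G: "finite_multigraph G" "unit_lengths G l"
  shows "comps P (metric_point G l) = num_comps G {e \<in> edges G. P (l e)}"
proof -
  obtain c where c: "\<And>G :: (nat, nat) multigraph. \<And>l. finite_multigraph G \<Longrightarrow> unit_lengths G l \<Longrightarrow>
     c (metric_point G l) = num_comps G {e \<in> edges G. P (l e)}"
  proof (rule metric_point_descent[where F = "\<lambda>G l. num_comps G {e \<in> edges G. P (l e)}"
      and F' = "\<lambda>G l. num_comps G {e \<in> edges G. P (l e)}"])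
    show "num_comps G {e \<in> edges G. P (l e)} = num_comps H {e \<in> edges H. P (m e)}"
      if "finite_multigraph G" "multigraph_iso f g G H" "\<And>e. e \<in> edges G \<Longrightarrow> m (g e) = l e"
      for G H :: "(nat, nat) multigraph" and f g l m
      by (rule num_comps_length_set_iso[where m = m and l = l, OF that])
    show "num_comps G {e \<in> edges G. P (l e)} = num_comps H {e \<in> edges H. P (m e)}"
      if "finite_multigraph G" "multigraph_iso f g G H" "\<And>e. e \<in> edges G \<Longrightarrow> m (g e) = l e"
      for G :: "(nat set, nat) multigraph" and H :: "(nat, nat) multigraph" and f g l m
      by (rule num_comps_length_set_iso[where m = m and l = l, OF that])
    fix G :: "(nat, nat) multigraph" and l and S :: "nat set"
    assume G: "finite_multigraph G" and S: "S \<subseteq> edges G"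
    show "num_comps (restrict_edges G (edges G - S)) {e \<in> edges (restrict_edges G (edges G - S)). P (l e)}
      = num_comps G {e \<in> edges G. P (l e)}" if "\<And>e. e \<in> S \<Longrightarrow> l e = 1"
    proof -
      have "{e \<in> edges (restrict_edges G (edges G - S)). P (l e)} = {e \<in> edges G. P (l e)}"
        using that P(2) by (auto simp: restrict_edges_def)
      then show ?thesis by simp
    qed
    show "num_comps (contract_edges G S) {e \<in> edges (contract_edges G S). P (l e)}
      = num_comps G {e \<in> edges G. P (l e)}" if "\<And>e. e \<in> S \<Longrightarrow> l e = 0"
    proof -
      have "{e \<in> edges (contract_edges G S). P (l e)} = {e \<in> edges G. P (l e)} - S"
        by (auto simp: contract_edges_def)
      moreover have "S \<subseteq> {e \<in> edges G. P (l e)}"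
        using that P(1) S by auto
      ultimately show ?thesis
        using num_comps_contract[OF G] by simp
    qed
  qed blast
  then have "\<exists>c. \<forall>G :: (nat, nat) multigraph. \<forall>l. finite_multigraph G \<longrightarrow> unit_lengths G l \<longrightarrow>
     c (metric_point G l) = num_comps G {e \<in> edges G. P (l e)}" by blast
  from someI_ex[OF this, folded comps_def] show ?thesis
    using G by blast
qed

lemma comps_metric_point:
  assumes P: "P 0" "\<not> P 1" and G: "finite_multigraph G" "unit_lengths G l"
  shows "comps P (metric_point G l) = num_comps G {e \<in> edges G. P (l e)}"
proof -
  obtain H :: "(nat, nat) multigraph" and f g m where H: "multigraph_iso f g G H" "finite_multigraph H"
    "unit_lengths H m" "\<And>e. e \<in> edges G \<Longrightarrow> m (g e) = l e" "metric_point G l = metric_point H m"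
    by (rule metric_point_nat_copy[OF G]) (rule that; assumption)
  show ?thesis
    unfolding H(5) comps_nat_metric_point[of P, OF P H(2,3)]
    by (rule num_comps_length_set_iso[where m = m and l = l, OF G(1) H(1,4), symmetric])
qed

abbreviation zero_comps :: "((nat \<times> flag_class) \<times> (nat \<Rightarrow> real)) set \<Rightarrow> nat" where
  "zero_comps \<equiv> comps (\<lambda>x. x = 0)"

abbreviation short_comps :: "((nat \<times> flag_class) \<times> (nat \<Rightarrow> real)) set \<Rightarrow> nat" where
  "short_comps \<equiv> comps (\<lambda>x. x < 1 / 2)"

lemma zero_comps_metric_point:
  assumes "finite_multigraph G" "unit_lengths G l"
  shows "zero_comps (metric_point G l) = num_comps G {e \<in> edges G. l e = 0}"
  by (rule comps_metric_point[OF _ _ assms]) simp_all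

lemma short_comps_metric_point:
  assumes "finite_multigraph G" "unit_lengths G l"
  shows "short_comps (metric_point G l) = num_comps G {e \<in> edges G. l e < 1 / 2}"
  by (rule comps_metric_point[OF _ _ assms]) simp_all

lemma short_comps_le_zero_comps:
  assumes "z \<in> topspace M_Gr"
  shows "short_comps z \<le> zero_comps z" "short_comps z = 0 \<longleftrightarrow> zero_comps z = 0"
proof -
  obtain G :: "(nat, nat) multigraph" and l where G: "finite_multigraph G" "unit_lengths G l"
    and z: "z = metric_point G l"
    by (rule topspace_M_Gr_cases[OF assms])
  show "short_comps z \<le> zero_comps z"
    unfolding z zero_comps_metric_point[OF G] short_comps_metric_point[OF G]
    by (rule num_comps_mono[OF G(1)]) auto
  show "short_comps z = 0 \<longleftrightarrow> zero_comps z = 0"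
    unfolding z zero_comps_metric_point[OF G] short_comps_metric_point[OF G] num_comps_eq_0[OF G(1)] ..
qed

section \<open>The filtration by the number of vertices and its open thickening\<close>

definition nonempty_graphs :: "((nat \<times> flag_class) \<times> (nat \<Rightarrow> real)) set set" where
  "nonempty_graphs = {z \<in> topspace M_Gr. 1 \<le> zero_comps z}"

text \<open>The lower bound excludes exactly the graph without vertices, which would otherwise
  belong to every stage.\<close>

definition vertices_le :: "nat \<Rightarrow> ((nat \<times> flag_class) \<times> (nat \<Rightarrow> real)) set set" where
  "vertices_le n = {z \<in> topspace M_Gr. 1 \<le> zero_comps z \<and> zero_comps z \<le> n}"

definition clusters_le :: "nat \<Rightarrow> ((nat \<times> flag_class) \<times> (nat \<Rightarrow> real)) set set" where
  "clusters_le n = {z \<in> topspace M_Gr. 1 \<le> short_comps z \<and> short_comps z \<le> n}"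

lemma vertices_le_subset_clusters_le: "vertices_le n \<subseteq> clusters_le n"
proof
  fix z assume "z \<in> vertices_le n"
  then have z: "z \<in> topspace M_Gr" "1 \<le> zero_comps z" "zero_comps z \<le> n"
    by (simp_all add: vertices_le_def)
  then show "z \<in> clusters_le n"
    using short_comps_le_zero_comps[OF z(1)] by (simp add: clusters_le_def)
qed

lemma openin_all_pos:
  assumes "finite J" "\<And>i. i \<in> J \<Longrightarrow> continuous_map X euclideanreal (g i)"
  shows "openin X {x \<in> topspace X. \<forall>i\<in>J. 0 < g i x}"
  using assms
proof (induction J)
  case (insert j J)
  have "openin X {x \<in> topspace X. g j x \<in> {0<..}}"
    by (rule openin_continuous_map_preimage[of _ euclideanreal]) (use insert.prems in auto)
  moreover have "openin X {x \<in> topspace X. \<forall>i\<in>J. 0 < g i x}"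
    using insert by simp
  ultimately have "openin X ({x \<in> topspace X. g j x \<in> {0<..}} \<inter> {x \<in> topspace X. \<forall>i\<in>J. 0 < g i x})"
    by (rule openin_Int)
  then show ?case
    by (rule back_subst[of "openin X"]) auto
qed simp

lemma continuous_map_coordinate:
  "continuous_map (subtopology (powertop_real UNIV) A) euclideanreal (\<lambda>l. l e)"
  by (rule continuous_map_from_subtopology) (rule continuous_map_product_projection, simp)

text \<open>Short edges stay short under small changes of the lengths, and additional short edges
  can only reduce the number of components. So the condition is a union of open conditions, one for
  each edge set \<open>A\<close> that leaves few components.\<close>

lemma openin_clusters_le: "openin M_Gr (clusters_le n)"
proof (rule openin_M_Gr)
  fix G :: "(nat, nat) multigraph" assume G: "finite_multigraph G"
  let ?X = "subtopology (powertop_real UNIV) {l :: nat \<Rightarrow> real. unit_lengths G l}"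
  let ?J = "{A. A \<subseteq> edges G \<and> 1 \<le> num_comps G A \<and> num_comps G A \<le> n}"
  let ?U = "\<lambda>A. {l \<in> topspace ?X. \<forall>e\<in>A. 0 < 1 / 2 - l e}"
  have "openin ?X (?U A)" if "A \<in> ?J" for A
  proof (rule openin_all_pos)
    show "finite A" using that G by (auto simp: finite_multigraph_def intro: finite_subset)
    show "continuous_map ?X euclideanreal (\<lambda>l. 1 / 2 - l e)" for e
      by (intro continuous_map_diff continuous_map_coordinate) simp
  qed
  then have "openin ?X (\<Union>A\<in>?J. ?U A)" by blast
  moreover have "{l. unit_lengths G l \<and> metric_point G l \<in> clusters_le n} = (\<Union>A\<in>?J. ?U A)"
  proof (intro equalityI subsetI)
    fix l assume "l \<in> {l. unit_lengths G l \<and> metric_point G l \<in> clusters_le n}"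
    then have l: "unit_lengths G l" and c: "metric_point G l \<in> clusters_le n" by simp_all
    let ?A = "{e \<in> edges G. l e < 1 / 2}"
    have "?A \<in> ?J" using c short_comps_metric_point[OF G l] unfolding clusters_le_def by simp
    moreover have "l \<in> ?U ?A" using l by simp
    ultimately show "l \<in> (\<Union>A\<in>?J. ?U A)" by blast
  next
    fix l assume "l \<in> (\<Union>A\<in>?J. ?U A)"
    then obtain A where A: "A \<subseteq> edges G" "1 \<le> num_comps G A" "num_comps G A \<le> n"
      and l: "unit_lengths G l" and s: "\<And>e. e \<in> A \<Longrightarrow> l e < 1 / 2" by auto
    let ?A = "{e \<in> edges G. l e < 1 / 2}"
    have "num_comps G ?A \<le> num_comps G A"
      using s A(1) by (intro num_comps_mono[OF G]) auto
    moreover have "num_comps G ?A \<noteq> 0"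
      using A(2) num_comps_eq_0[OF G, of A] num_comps_eq_0[OF G, of ?A] by simp
    ultimately have "metric_point G l \<in> clusters_le n"
      using A metric_point_in_topspace[OF G l] short_comps_metric_point[OF G l]
      unfolding clusters_le_def by simp
    then show "l \<in> {l. unit_lengths G l \<and> metric_point G l \<in> clusters_le n}" using l
      by simp
  qed
  ultimately show "openin ?X {l. unit_lengths G l \<and> metric_point G l \<in> clusters_le n}"
    by simp
qed (auto simp: clusters_le_def)

text \<open>The same decomposition by edge sets \<open>A\<close>, now with the closed conditions
  that all edges of \<open>A\<close> have length 0. The union stays closed because a finite graph
  has only finitely many edge sets.\<close>

lemma closedin_vertices_le: "closedin M_Gr (vertices_le n)"
proof (rule closedin_M_Gr)
  fix G :: "(nat, nat) multigraph" assume G: "finite_multigraph G"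
  let ?X = "subtopology (powertop_real UNIV) {l :: nat \<Rightarrow> real. unit_lengths G l}"
  let ?J = "{A. A \<subseteq> edges G \<and> 1 \<le> num_comps G A \<and> num_comps G A \<le> n}"
  let ?U = "\<lambda>A. {l \<in> topspace ?X. \<forall>e\<in>A. 0 \<le> - l e}"
  have "closedin ?X (?U A)" if "A \<in> ?J" for A
    by (intro closedin_all_nonneg continuous_map_minus continuous_map_coordinate)
  moreover have "finite ?J"
    using G unfolding finite_multigraph_def by simp
  ultimately have "closedin ?X (\<Union>A\<in>?J. ?U A)" by (intro closedin_Union) auto
  moreover have "{l. unit_lengths G l \<and> metric_point G l \<in> vertices_le n} = (\<Union>A\<in>?J. ?U A)"
  proof (intro equalityI subsetI)
    fix l assume "l \<in> {l. unit_lengths G l \<and> metric_point G l \<in> vertices_le n}"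
    then have l: "unit_lengths G l" and c: "metric_point G l \<in> vertices_le n" by simp_all
    let ?A = "{e \<in> edges G. l e = 0}"
    have "?A \<in> ?J" using c zero_comps_metric_point[OF G l] unfolding vertices_le_def by simp
    moreover have "l \<in> ?U ?A" using l by simp
    ultimately show "l \<in> (\<Union>A\<in>?J. ?U A)" by blast
  next
    fix l assume "l \<in> (\<Union>A\<in>?J. ?U A)"
    then obtain A where A: "A \<subseteq> edges G" "1 \<le> num_comps G A" "num_comps G A \<le> n"
      and l: "unit_lengths G l" and s: "\<And>e. e \<in> A \<Longrightarrow> l e \<le> 0" by auto
    let ?A = "{e \<in> edges G. l e = 0}"
    have "A \<subseteq> ?A"
    proof
      fix e assume "e \<in> A"
      then show "e \<in> ?A" using s[of e] l A(1) by (simp add: subset_iff order_antisym)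
    qed
    then have "num_comps G ?A \<le> num_comps G A"
      by (rule num_comps_mono[OF G])
    moreover have "num_comps G ?A \<noteq> 0"
      using A(2) num_comps_eq_0[OF G, of A] num_comps_eq_0[OF G, of ?A] by simp
    ultimately have "metric_point G l \<in> vertices_le n"
      using A metric_point_in_topspace[OF G l] unfolding vertices_le_def
      by (simp add: zero_comps_metric_point[OF G l])
    then show "l \<in> {l. unit_lengths G l \<and> metric_point G l \<in> vertices_le n}" using l
      by simp
  qed
  ultimately show "closedin ?X {l. unit_lengths G l \<and> metric_point G l \<in> vertices_le n}"
    by simp
qed (auto simp: vertices_le_def)

lemma nonempty_graphs_eq_Union: "nonempty_graphs = (\<Union>n. clusters_le n)"
proof (intro equalityI subsetI)
  fix z assume "z \<in> nonempty_graphs"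
  then have "z \<in> vertices_le (zero_comps z)" by (simp add: nonempty_graphs_def vertices_le_def)
  then show "z \<in> (\<Union>n. clusters_le n)" using vertices_le_subset_clusters_le by blast
next
  fix z assume "z \<in> (\<Union>n. clusters_le n)"
  then obtain n where z: "z \<in> topspace M_Gr" "1 \<le> short_comps z"
    by (auto simp: clusters_le_def)
  then show "z \<in> nonempty_graphs"
    using short_comps_le_zero_comps[OF z(1)] by (simp add: nonempty_graphs_def)
qed

lemma openin_nonempty_graphs: "openin M_Gr nonempty_graphs"
  unfolding nonempty_graphs_eq_Union by (intro openin_Union) (auto intro: openin_clusters_le)

section \<open>Contracting short edges\<close>

text \<open>At \<open>\<tau> = 1\<close> this is \<open>max 0 (2 * x - 1)\<close>: lengths up to 1/2
  become 0 and the rest is stretched onto [0, 1]. The values 0 and 1 stay fixed for every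
  \<open>\<tau>\<close>, which is what descent requires.\<close>

definition shrink_length :: "real \<Rightarrow> real \<Rightarrow> real" where
  "shrink_length \<tau> x = (1 - \<tau>) * x + \<tau> * max 0 (2 * x - 1)"

lemma shrink_length_bounds:
  assumes "0 \<le> \<tau>" "\<tau> \<le> 1" "0 \<le> x" "x \<le> 1"
  shows "0 \<le> shrink_length \<tau> x" "shrink_length \<tau> x \<le> x" "shrink_length \<tau> x \<le> 1"
proof -
  have m: "0 \<le> max 0 (2 * x - 1)" "max 0 (2 * x - 1) \<le> x" using assms by auto
  show "0 \<le> shrink_length \<tau> x"
    unfolding shrink_length_def using assms m
      by (intro add_nonneg_nonneg mult_nonneg_nonneg) simp_all
  have "\<tau> * max 0 (2 * x - 1) \<le> \<tau> * x" using m assms by (intro mult_left_mono)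
  then show "shrink_length \<tau> x \<le> x"
    unfolding shrink_length_def by (simp add: algebra_simps)
  then show "shrink_length \<tau> x \<le> 1" using assms by simp
qed

lemma unit_lengths_shrink:
  "0 \<le> \<tau> \<Longrightarrow> \<tau> \<le> 1 \<Longrightarrow> unit_lengths G l \<Longrightarrow> unit_lengths G (\<lambda>e. shrink_length \<tau> (l e))"
  using shrink_length_bounds by blast

definition shrink ::
  "real \<Rightarrow> ((nat \<times> flag_class) \<times> (nat \<Rightarrow> real)) set \<Rightarrow> ((nat \<times> flag_class) \<times> (nat \<Rightarrow> real)) set" where
  "shrink \<tau> = (SOME h. \<forall>G :: (nat, nat) multigraph. \<forall>l. finite_multigraph G \<longrightarrow> unit_lengths G l \<longrightarrow>
     h (metric_point G l) = metric_point G (\<lambda>e. shrink_length \<tau> (l e)))"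

lemma shrink_metric_point:
  fixes G :: "(nat, nat) multigraph"
  assumes \<tau>: "0 \<le> \<tau>" "\<tau> \<le> 1" and G: "finite_multigraph G" "unit_lengths G l"
  shows "shrink \<tau> (metric_point G l) = metric_point G (\<lambda>e. shrink_length \<tau> (l e))"
proof -
  obtain h where h: "\<And>G :: (nat, nat) multigraph. \<And>l. finite_multigraph G \<Longrightarrow> unit_lengths G l \<Longrightarrow>
     h (metric_point G l) = metric_point G (\<lambda>e. shrink_length \<tau> (l e))"
  proof (rule metric_point_descent[where F = "\<lambda>G l. metric_point G (\<lambda>e. shrink_length \<tau> (l e))"
      and F' = "\<lambda>G l. metric_point G (\<lambda>e. shrink_length \<tau> (l e))"])
    show "metric_point G (\<lambda>e. shrink_length \<tau> (l e)) = metric_point H (\<lambda>e. shrink_length \<tau> (m e))"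
      if "finite_multigraph G" "unit_lengths G l" "multigraph_iso f g G H" "\<And>e. e \<in> edges G \<Longrightarrow> m (g e) = l e"
      for G H :: "(nat, nat) multigraph" and f g l m
      by (rule metric_point_iso[OF that(3,1) unit_lengths_shrink[OF \<tau> that(2)]]) (simp add: that(4))
    show "metric_point G (\<lambda>e. shrink_length \<tau> (l e)) = metric_point H (\<lambda>e. shrink_length \<tau> (m e))"
      if "finite_multigraph G" "unit_lengths G l" "multigraph_iso f g G H" "\<And>e. e \<in> edges G \<Longrightarrow> m (g e) = l e"
      for G :: "(nat set, nat) multigraph" and H :: "(nat, nat) multigraph" and f g l m
      by (rule metric_point_iso[OF that(3,1) unit_lengths_shrink[OF \<tau> that(2)]]) (simp add: that(4))
    fix G :: "(nat, nat) multigraph" and l and S :: "nat set"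
    assume G: "finite_multigraph G" "unit_lengths G l" and S: "S \<subseteq> edges G"
    show "metric_point (restrict_edges G (edges G - S)) (\<lambda>e. shrink_length \<tau> (l e))
      = metric_point G (\<lambda>e. shrink_length \<tau> (l e))" if "\<And>e. e \<in> S \<Longrightarrow> l e = 1"
      by (rule metric_point_delete[OF G(1) unit_lengths_shrink[OF \<tau> G(2)] S]) (simp add: that shrink_length_def)
    show "metric_point (contract_edges G S) (\<lambda>e. shrink_length \<tau> (l e))
      = metric_point G (\<lambda>e. shrink_length \<tau> (l e))" if "\<And>e. e \<in> S \<Longrightarrow> l e = 0"
      by (rule metric_point_contract[OF G(1) unit_lengths_shrink[OF \<tau> G(2)] S]) (simp add: that shrink_length_def)
  qed blast
  then have "\<exists>h. \<forall>G :: (nat, nat) multigraph. \<forall>l. finite_multigraph G \<longrightarrow> unit_lengths G l \<longrightarrow>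
     h (metric_point G l) = metric_point G (\<lambda>e. shrink_length \<tau> (l e))" by blast
  from someI_ex[OF this, folded shrink_def] show ?thesis
    using G by blast
qed

abbreviation length_homotopy_space :: "(real \<times> (nat \<Rightarrow> real)) topology" where
  "length_homotopy_space \<equiv> prod_topology (top_of_set {0..1}) (powertop_real UNIV)"

lemma continuous_map_length_homotopy_space:
  "continuous_map (subtopology length_homotopy_space A) euclideanreal fst"
  "continuous_map (subtopology length_homotopy_space A) euclideanreal (\<lambda>x. snd x e)"
proof -
  show "continuous_map (subtopology length_homotopy_space A) euclideanreal fst"
    by (intro continuous_map_from_subtopology continuous_map_into_fulltopology[OF continuous_map_fst])
  have "continuous_map length_homotopy_space euclideanreal ((\<lambda>l. l e) \<circ> snd)"
    by (rule continuous_map_compose[OF continuous_map_snd continuous_map_product_projection]) simp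
  then show "continuous_map (subtopology length_homotopy_space A) euclideanreal (\<lambda>x. snd x e)"
    by (simp add: continuous_map_from_subtopology o_def)
qed

lemma continuous_map_shrink:
  "continuous_map (prod_topology (top_of_set {0..1}) M_Gr) M_Gr (\<lambda>(\<tau>, z). shrink \<tau> z)"
proof -
  let ?T = "topspace M_Gr"
  have "continuous_map (prod_topology (top_of_set {0..1}) (subtopology M_Gr (?T \<inter> ?T))) M_Gr (\<lambda>(\<tau>, z). shrink \<tau> z)"
  proof (rule continuous_map_homotopy_M_Gr[OF openin_topspace closedin_topspace])
    fix G :: "(nat, nat) multigraph" assume G: "finite_multigraph G"
    let ?X = "subtopology length_homotopy_space {(s, l). unit_lengths G l \<and> metric_point G l \<in> ?T \<inter> ?T}"
    have X: "0 \<le> fst x \<and> fst x \<le> 1 \<and> unit_lengths G (snd x)"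
      if "x \<in> topspace ?X" for x
      using that by (cases x) auto
    have "continuous_map ?X M_Gr (\<lambda>x. metric_point G (\<lambda>e. shrink_length (fst x) (snd x e)))"
    proof (rule continuous_map_metric_point[OF G])
      show "continuous_map ?X euclideanreal (\<lambda>x. shrink_length (fst x) (snd x e))" for e
        unfolding shrink_length_def
        by (intro continuous_intros continuous_map_length_homotopy_space)
      show "unit_lengths G (\<lambda>e. shrink_length (fst x) (snd x e))" if "x \<in> topspace ?X"
        for x
        using X[OF that] unit_lengths_shrink by blast
    qed
    then show "continuous_map ?X M_Gr (\<lambda>(s, l). case (s, metric_point G l) of (\<tau>, z) \<Rightarrow> shrink \<tau> z)"
    proof (rule continuous_map_eq)
      fix x assume "x \<in> topspace ?X"
      from X[OF this] show "metric_point G (\<lambda>e. shrink_length (fst x) (snd x e))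
         = (case x of (s, l) \<Rightarrow> case (s, metric_point G l) of (\<tau>, z) \<Rightarrow> shrink \<tau> z)"
        by (simp add: case_prod_unfold shrink_metric_point[OF _ _ G])
    qed
  qed
  then show ?thesis by simp
qed

text \<open>Lengths never grow, so short edges stay short, and at time 1 every edge shorter than 1/2
  has length 0. Thus each \<open>clusters_le n\<close> is preserved during the homotopy and ends up
  in \<open>vertices_le n\<close>.\<close>

lemma shrink_comps:
  assumes \<tau>: "0 \<le> \<tau>" "\<tau> \<le> 1" and z: "z \<in> topspace M_Gr"
  shows "shrink \<tau> z \<in> topspace M_Gr" "short_comps (shrink \<tau> z) \<le> short_comps z"
    "short_comps (shrink \<tau> z) = 0 \<longleftrightarrow> short_comps z = 0"
    "zero_comps (shrink 1 z) \<le> short_comps z" "shrink 0 z = z"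
proof -
  obtain G :: "(nat, nat) multigraph" and l where G: "finite_multigraph G" "unit_lengths G l"
    and z: "z = metric_point G l"
    by (rule topspace_M_Gr_cases[OF z])
  note u = unit_lengths_shrink[OF \<tau> G(2)] and u1 = unit_lengths_shrink[OF zero_le_one order_refl G(2)]
  have s: "shrink \<tau> z = metric_point G (\<lambda>e. shrink_length \<tau> (l e))"
    unfolding z by (rule shrink_metric_point[OF \<tau> G])
  have s1: "shrink 1 z = metric_point G (\<lambda>e. shrink_length 1 (l e))"
    unfolding z by (rule shrink_metric_point[OF zero_le_one order_refl G])
  show "shrink \<tau> z \<in> topspace M_Gr"
    unfolding s by (rule metric_point_in_topspace[OF G(1) u])
  show "short_comps (shrink \<tau> z) \<le> short_comps z"
    unfolding s short_comps_metric_point[OF G(1) u] unfolding z short_comps_metric_point[OF G]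
  proof (intro num_comps_mono[OF G(1)] subsetI)
    fix e assume "e \<in> {e \<in> edges G. l e < 1 / 2}"
    then show "e \<in> {e \<in> edges G. shrink_length \<tau> (l e) < 1 / 2}"
      using shrink_length_bounds(2)[OF \<tau>, of "l e"] G(2) by fastforce
  qed
  show "short_comps (shrink \<tau> z) = 0 \<longleftrightarrow> short_comps z = 0"
    unfolding s short_comps_metric_point[OF G(1) u]
      unfolding z short_comps_metric_point[OF G] num_comps_eq_0[OF G(1)] ..
  show "zero_comps (shrink 1 z) \<le> short_comps z"
    unfolding s1 zero_comps_metric_point[OF G(1) u1] unfolding z short_comps_metric_point[OF G]
    by (intro num_comps_mono[OF G(1)]) (auto simp: shrink_length_def)
  show "shrink 0 z = z"
    using shrink_metric_point[OF order_refl zero_le_one G] unfolding z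
      by (simp add: shrink_length_def)
qed

section \<open>Adding a complete graph\<close>

text \<open>Labelling a new edge by its pair of ends makes the construction functorial: a bijection
  of vertices acts on the new edges by taking images.\<close>

definition add_complete :: "('v, 'e) multigraph \<Rightarrow> ('v, 'e + 'v set) multigraph" where
  "add_complete G =
     \<lparr>verts = verts G,
      edges = Inl ` edges G \<union> Inr ` {A. A \<subseteq> verts G \<and> card A = 2},
      ends = case_sum (ends G) id\<rparr>"

lemma finite_add_complete:
  assumes "finite_multigraph G"
  shows "finite_multigraph (add_complete G)"
  unfolding finite_multigraph_def
proof (intro conjI ballI)
  show "finite (verts (add_complete G))" "finite (edges (add_complete G))"
    using assms by (simp_all add: finite_multigraph_def add_complete_def)
  fix x assume x: "x \<in> edges (add_complete G)"
  show "ends (add_complete G) x \<subseteq> verts (add_complete G)" "card (ends (add_complete G) x) \<in> {1, 2}"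
  proof (atomize (full), cases x)
    case (Inl e)
    then have "e \<in> edges G" using x by (auto simp: add_complete_def)
    then show "ends (add_complete G) x \<subseteq> verts (add_complete G) \<and> card (ends (add_complete G) x) \<in> {1, 2}"
      using assms Inl unfolding finite_multigraph_def by (simp add: add_complete_def)
  next
    case (Inr A)
    then show "ends (add_complete G) x \<subseteq> verts (add_complete G) \<and> card (ends (add_complete G) x) \<in> {1, 2}"
      using x by (auto simp: add_complete_def)
  qed
qed

lemma card_image_eq_2:
  assumes "inj_on f V" "A \<subseteq> V"
  shows "card (f ` A) = card A"
  using assms card_image inj_on_subset by blast

lemma multigraph_iso_add_complete:
  assumes iso: "multigraph_iso f g G H"
  shows "multigraph_iso f (map_sum g ((`) f)) (add_complete G) (add_complete H)"
proof -
  have f: "inj_on f (verts G)" "verts H = f ` verts G" and g: "inj_on g (edges G)" "edges H = g ` edges G"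
    and ends: "\<And>e. e \<in> edges G \<Longrightarrow> ends H (g e) = f ` ends G e"
    using iso by (auto simp: multigraph_iso_def bij_betw_def)
  let ?K = "\<lambda>V. {A. A \<subseteq> V \<and> card A = 2}"
  have K: "(`) f ` ?K (verts G) = ?K (verts H)"
  proof (intro equalityI subsetI)
    fix B assume "B \<in> (`) f ` ?K (verts G)"
    then show "B \<in> ?K (verts H)" using card_image_eq_2[OF f(1)] f(2) by auto
  next
    fix B assume B: "B \<in> ?K (verts H)"
    then obtain A where A: "A \<subseteq> verts G" "B = f ` A"
      using f(2) subset_imageE[of B f "verts G"] by auto
    then have "A \<in> ?K (verts G)" using card_image_eq_2[OF f(1) A(1)] B by simp
    then show "B \<in> (`) f ` ?K (verts G)" using A(2) by blast
  qed
  have img: "map_sum g ((`) f) ` edges (add_complete G) = edges (add_complete H)"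
    unfolding add_complete_def by (simp add: image_Un image_image K[symmetric] g(2))
  have "inj_on (map_sum g ((`) f)) (edges (add_complete G))"
  proof (rule inj_onI)
    fix x y assume x: "x \<in> edges (add_complete G)" and y: "y \<in> edges (add_complete G)"
      and eq: "map_sum g ((`) f) x = map_sum g ((`) f) y"
    show "x = y"
    proof (cases x)
      case (Inl a)
      then obtain b where "y = Inl b" using eq by (cases y) auto
      then show ?thesis using Inl x y eq g(1) by (auto simp: add_complete_def inj_on_def)
    next
      case (Inr A)
      then obtain B where B: "y = Inr B" using eq by (cases y) auto
      have "A \<subseteq> verts G" "B \<subseteq> verts G" "f ` A = f ` B"
        using Inr B x y eq by (auto simp: add_complete_def)
      then show ?thesis using Inr B inj_on_image_eq_iff[OF f(1)] by blast
    qed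
  qed
  moreover have "ends (add_complete H) (map_sum g ((`) f) e) = f ` ends (add_complete G) e"
    if "e \<in> edges (add_complete G)" for e
    using that ends by (cases e) (auto simp: add_complete_def)
  ultimately show ?thesis
    using img f unfolding multigraph_iso_def by (simp add: bij_betw_def add_complete_def)
qed

lemma add_complete_restrict_edges:
  assumes "S \<subseteq> edges G"
  shows "add_complete (restrict_edges G (edges G - S)) =
     restrict_edges (add_complete G) (edges (add_complete G) - Inl ` S)"
  using assms by (auto simp: add_complete_def restrict_edges_def)

section \<open>Loops of length 0, and collapsing in stages\<close>

lemma connected_via_loops:
  assumes G: "finite_multigraph G" and S: "S \<subseteq> edges G" and loops: "\<And>e. e \<in> S \<Longrightarrow> card (ends G e) = 1"
    and v: "v \<in> verts G"
  shows "connected_via G S `` {v} = {v}"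
proof -
  have "w = v" if "(v, w) \<in> connected_via G S" for w
    using that G S
  proof (rule connected_via_induct)
    fix x y e assume "x = v" "e \<in> S" "ends G e = {x, y}"
    then have "card {x, y} = 1" using loops[of e] by simp
    then show "y = v" using \<open>x = v\<close> by (cases "x = y") simp_all
  qed simp
  then show ?thesis using connected_via_refl[OF v, of S] by auto
qed

lemma num_comps_loops:
  assumes "finite_multigraph G" "S \<subseteq> edges G" "\<And>e. e \<in> S \<Longrightarrow> card (ends G e) = 1"
  shows "num_comps G S = card (verts G)"
proof -
  have "verts G // connected_via G S = (\<lambda>v. {v}) ` verts G"
    unfolding quotient_as_image using connected_via_loops[OF assms] by (intro image_cong refl)
  then show ?thesis unfolding num_comps_def by (simp add: card_image)
qed

text \<open>Contracting loops merges no vertices, so up to renaming \<open>v\<close> to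
  \<open>{v}\<close> it is the same as deleting them.\<close>

lemma metric_point_delete_loops:
  assumes G: "finite_multigraph G" and l: "unit_lengths G l" and S: "S \<subseteq> edges G"
    and loops: "\<And>e. e \<in> S \<Longrightarrow> card (ends G e) = 1" and 0: "\<And>e. e \<in> S \<Longrightarrow> l e = 0"
  shows "metric_point (restrict_edges G (edges G - S)) l = metric_point G l"
proof -
  let ?R = "restrict_edges G (edges G - S)"
  have cl: "connected_via G S `` {v} = {v}" if "v \<in> verts G" for v
    by (rule connected_via_loops[OF G S loops that])
  have "ends (contract_edges G S) e = (\<lambda>v. {v}) ` ends ?R e" if "e \<in> edges ?R" for e
  proof -
    have "ends G e \<subseteq> verts G" using that G
      by (simp add: restrict_edges_def finite_multigraph_def)
    then show ?thesis
      unfolding contract_edges_def restrict_edges_def using cl by (auto intro!: image_cong)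
  qed
  moreover have "verts (contract_edges G S) = (\<lambda>v. {v}) ` verts ?R"
    unfolding contract_edges_def restrict_edges_def quotient_as_image using cl
      by (auto intro!: image_cong)
  ultimately have iso: "multigraph_iso (\<lambda>v. {v}) id ?R (contract_edges G S)"
    unfolding multigraph_iso_def by (simp add: bij_betw_def contract_edges_def restrict_edges_def)
  have "metric_point ?R l = metric_point (contract_edges G S) l"
  proof (rule metric_point_iso[OF iso])
    show "finite_multigraph ?R" by (rule finite_restrict_edges[OF G]) blast
    show "unit_lengths ?R l" using l by (simp add: restrict_edges_def)
  qed simp
  then show ?thesis using metric_point_contract[OF G l S 0] by simp
qed

lemma card_ends_collapse:
  assumes G: "finite_multigraph G" and S: "S \<subseteq> edges G" and e: "e \<in> S"
  shows "card (ends (collapse G S) e) = 1"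
proof -
  have eG: "e \<in> edges G" using S e by blast
  obtain a b where ab: "ends G e = {a, b}" "a \<in> verts G" "b \<in> verts G"
    by (rule ends_doubleton[OF G eG])
  have "(a, b) \<in> connected_via G S"
    using ab by (intro connected_via_edge[OF e]) simp_all
  then have "connected_via G S `` {a} = connected_via G S `` {b}"
    by (rule equiv_class_eq[OF equiv_connected_via])
  then show ?thesis by (simp add: collapse_def ab(1))
qed

text \<open>The edges of \<open>S\<close> are loops of length 0 in the collapsed graph, and removing
  them leaves the contraction of \<open>S\<close>.\<close>

lemma metric_point_collapse:
  assumes G: "finite_multigraph G" and l: "unit_lengths G l" and S: "S \<subseteq> edges G"
    and 0: "\<And>e. e \<in> S \<Longrightarrow> l e = 0"
  shows "metric_point (collapse G S) l = metric_point G l"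
proof -
  have "edges (collapse G S) = edges G" by (simp add: collapse_def)
  then have "metric_point (restrict_edges (collapse G S) (edges G - S)) l = metric_point (collapse G S) l"
    using metric_point_delete_loops[OF finite_collapse[OF G], of S l S] l S 0 card_ends_collapse[OF G S] by simp
  then show ?thesis
    using metric_point_contract[OF G l S 0] by (simp add: contract_edges_eq)
qed

lemma collapse_restrict_edges:
  "collapse (restrict_edges G A) S = restrict_edges (collapse G S) A"
  by (simp add: collapse_def) (simp add: restrict_edges_def)

text \<open>A vertex of the graph collapsed in two stages is a set of sets: the
  \<open>S\<close>-components that make up one \<open>T\<close>-component. Taking the union recovers
  that component, whence the map on vertices is injective.\<close>

lemma multigraph_iso_collapse_contract:
  assumes G: "finite_multigraph G" and ST: "S \<subseteq> T" "T \<subseteq> edges G"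
  shows "multigraph_iso ((`) (\<lambda>v. connected_via G S `` {v})) id
     (restrict_edges (collapse G T) (edges G - S)) (collapse (contract_edges G S) (T - S))"
proof -
  let ?c = "\<lambda>v. connected_via G S `` {v}" and ?d = "\<lambda>v. connected_via G T `` {v}"
  let ?H = "contract_edges G S"
  have vH: "verts ?H = ?c ` verts G" by (simp add: contract_edges_def quotient_as_image)
  have T: "S \<union> (T - S) = T" using ST(1) by blast
  have S: "S \<subseteq> edges G" using ST by (rule order_trans)
  have TS: "T - S \<subseteq> edges G - S" using ST(2) by (rule Diff_mono) (rule order_refl)
  have cls: "connected_via ?H (T - S) `` {?c v} = ?c ` ?d v" if v: "v \<in> verts G" for v
  proof -
    have iff: "(?c v, ?c w) \<in> connected_via ?H (T - S) \<longleftrightarrow> (v, w) \<in> connected_via G T" if "w \<in> verts G" for w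
      by (rule connected_via_contract[OF G S TS v that, unfolded T])
    show ?thesis
    proof (intro equalityI subsetI)
      fix Y assume "Y \<in> connected_via ?H (T - S) `` {?c v}"
      then have Y: "(?c v, Y) \<in> connected_via ?H (T - S)" by simp
      then have "Y \<in> ?c ` verts G" unfolding vH[symmetric] by (simp only: connected_via_iff)
      then obtain w where "w \<in> verts G" "Y = ?c w" by blast
      then show "Y \<in> ?c ` ?d v" using iff[of w] Y by blast
    next
      fix Y assume "Y \<in> ?c ` ?d v"
      then obtain w where w: "(v, w) \<in> connected_via G T" "Y = ?c w" by blast
      then have "w \<in> verts G" by (simp add: connected_via_iff)
      then show "Y \<in> connected_via ?H (T - S) `` {?c v}" using iff[of w] w by blast
    qed
  qed
  have Un: "\<Union> (?c ` ?d v) = ?d v" if "v \<in> verts G" for v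
  proof -
    have "\<Union> (?c ` ?d v) \<subseteq> ?d v"
    proof
      fix x assume "x \<in> \<Union> (?c ` ?d v)"
      then obtain w where "(v, w) \<in> connected_via G T" "(w, x) \<in> connected_via G S" by blast
      then show "x \<in> ?d v"
        using connected_via_mono[OF ST(1), of G] connected_via_trans[of v w G T x] by blast
    qed
    moreover have "x \<in> ?c x" if "(v, x) \<in> connected_via G T" for x
    proof -
      have "x \<in> verts G" using that by (simp add: connected_via_iff)
      then show ?thesis using connected_via_refl[of x G S] by blast
    qed
    ultimately show ?thesis by blast
  qed
  have "inj_on ((`) ?c) (verts G // connected_via G T)"
  proof (rule inj_onI)
    fix X Y assume XY: "X \<in> verts G // connected_via G T" "Y \<in> verts G // connected_via G T"
      and eq: "?c ` X = ?c ` Y"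
    obtain u where u: "u \<in> verts G" "X = ?d u" using XY(1) unfolding quotient_as_image by blast
    obtain v where v: "v \<in> verts G" "Y = ?d v" using XY(2) unfolding quotient_as_image by blast
    have "X = \<Union> (?c ` X)" unfolding u(2) Un[OF u(1)] ..
    also have "\<dots> = \<Union> (?c ` Y)" by (simp only: eq)
    also have "\<dots> = Y" unfolding v(2) Un[OF v(1)] ..
    finally show "X = Y" .
  qed
  moreover have "(`) ?c ` (verts G // connected_via G T) = verts ?H // connected_via ?H (T - S)"
    unfolding quotient_as_image vH image_image by (intro image_cong refl) (rule cls[symmetric])
  moreover have "(\<lambda>Y. connected_via ?H (T - S) `` {Y}) ` ends ?H e = (`) ?c ` ?d ` ends G e"
    if "e \<in> edges G" for e
  proof -
    have "ends G e \<subseteq> verts G" using G that by (simp add: finite_multigraph_def)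
    then have "(\<lambda>v. connected_via ?H (T - S) `` {?c v}) ` ends G e = (\<lambda>v. ?c ` ?d v) ` ends G e"
      using cls by (intro image_cong refl) blast
    then show ?thesis by (simp add: contract_edges_def image_image)
  qed
  ultimately show ?thesis
    unfolding multigraph_iso_def
    by (simp add: bij_betw_def collapse_def restrict_edges_def) (simp add: contract_edges_def)
qed

section \<open>The metric graph obtained by adding a complete graph\<close>

abbreviation zero_edges :: "('v, 'e) multigraph \<Rightarrow> ('e \<Rightarrow> real) \<Rightarrow> 'e set" where
  "zero_edges G l \<equiv> {e \<in> edges G. l e = 0}"

text \<open>The zero edges are collapsed before the complete graph is added. Otherwise the new edges
  would depend on the chosen graph and not only on the point that it represents.\<close>

definition complete_point ::
  "real \<Rightarrow> ('v, 'e) multigraph \<Rightarrow> ('e \<Rightarrow> real) \<Rightarrow> ((nat \<times> flag_class) \<times> (nat \<Rightarrow> real)) set" where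
  "complete_point s G l =
     metric_point (add_complete (collapse G (zero_edges G l))) (case_sum l (\<lambda>_. s))"

lemma unit_lengths_add_complete:
  "0 \<le> s \<Longrightarrow> s \<le> 1 \<Longrightarrow> unit_lengths G l \<Longrightarrow> unit_lengths (add_complete (collapse G A)) (case_sum l (\<lambda>_. s))"
  by (auto simp: add_complete_def collapse_def)

lemma complete_point_iso:
  assumes s: "0 \<le> s" "s \<le> 1" and G: "finite_multigraph G" "unit_lengths G l" and iso: "multigraph_iso f g G H"
    and m: "\<And>e. e \<in> edges G \<Longrightarrow> m (g e) = l e"
  shows "complete_point s G l = complete_point s H m"
proof -
  have Z: "zero_edges H m = g ` zero_edges G l"
    by (rule image_length_set[OF iso]) (rule m)
  have "multigraph_iso ((`) f) g (collapse G (zero_edges G l)) (collapse H (zero_edges H m))"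
    unfolding Z by (rule multigraph_iso_collapse[OF iso G(1)]) blast
  note iso' = multigraph_iso_add_complete[OF this]
  show ?thesis
    unfolding complete_point_def
  proof (rule metric_point_iso[OF iso' finite_add_complete[OF finite_collapse[OF G(1)]]
        unit_lengths_add_complete[OF s G(2)]])
    fix e assume "e \<in> edges (add_complete (collapse G (zero_edges G l)))"
    then show "case_sum m (\<lambda>_. s) (map_sum g ((`) ((`) f)) e) = case_sum l (\<lambda>_. s) e"
      using m by (cases e) (auto simp: add_complete_def collapse_def)
  qed
qed

lemma complete_point_delete:
  assumes s: "0 \<le> s" "s \<le> 1" and G: "finite_multigraph G" "unit_lengths G l" and S: "S \<subseteq> edges G"
    and 1: "\<And>e. e \<in> S \<Longrightarrow> l e = 1"
  shows "complete_point s (restrict_edges G (edges G - S)) l = complete_point s G l"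
proof -
  let ?C = "collapse G (zero_edges G l)"
  have Z: "zero_edges (restrict_edges G (edges G - S)) l = zero_edges G l"
    using 1 by (auto simp: restrict_edges_def)
  have eC: "edges ?C = edges G" by (simp add: collapse_def)
  have "add_complete (collapse (restrict_edges G (edges G - S)) (zero_edges G l))
    = restrict_edges (add_complete ?C) (edges (add_complete ?C) - Inl ` S)"
    using add_complete_restrict_edges[of S ?C] S unfolding eC collapse_restrict_edges by blast
  moreover have "metric_point (restrict_edges (add_complete ?C) (edges (add_complete ?C) - Inl ` S)) (case_sum l (\<lambda>_. s))
    = metric_point (add_complete ?C) (case_sum l (\<lambda>_. s))"
  proof (rule metric_point_delete[OF finite_add_complete[OF finite_collapse[OF G(1)]]
        unit_lengths_add_complete[OF s G(2)]])
    show "Inl ` S \<subseteq> edges (add_complete ?C)" using S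
      by (auto simp: add_complete_def collapse_def)
  qed (use 1 in auto)
  ultimately show ?thesis
    unfolding complete_point_def Z by simp
qed

text \<open>Contracting \<open>S\<close> and then collapsing the other zero edges gives, up to
  renaming vertices, the collapse of all zero edges with the edges of \<open>S\<close> left out.
  There these are loops of length 0, so they may equally be dropped after the complete graph has
  been added.\<close>

lemma complete_point_contract:
  assumes s: "0 \<le> s" "s \<le> 1" and G: "finite_multigraph G" "unit_lengths G l" and S: "S \<subseteq> edges G"
    and 0: "\<And>e. e \<in> S \<Longrightarrow> l e = 0"
  shows "complete_point s (contract_edges G S) l = complete_point s G l"
proof -
  let ?Z = "zero_edges G l" and ?H = "contract_edges G S"
  let ?C = "collapse G ?Z"
  have Z: "zero_edges ?H l = ?Z - S" by (auto simp: contract_edges_def)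
  have SZ: "S \<subseteq> ?Z" using S 0 by blast
  have eC: "edges ?C = edges G" by (simp add: collapse_def)
  have C: "finite_multigraph ?C" by (rule finite_collapse[OF G(1)])
  let ?R = "restrict_edges ?C (edges G - S)"
  have R: "finite_multigraph ?R" by (rule finite_restrict_edges[OF C]) (simp add: eC)
  have iso: "multigraph_iso ((`) (\<lambda>v. connected_via G S `` {v})) id ?R (collapse ?H (?Z - S))"
    by (rule multigraph_iso_collapse_contract[OF G(1) SZ]) blast
  have addR: "add_complete ?R = restrict_edges (add_complete ?C) (edges (add_complete ?C) - Inl ` S)"
    using add_complete_restrict_edges[of S ?C] S unfolding eC by blast
  have "metric_point (add_complete ?R) (case_sum l (\<lambda>_. s)) = metric_point (add_complete (collapse ?H (?Z - S))) (case_sum l (\<lambda>_. s))"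
  proof (rule metric_point_iso[OF multigraph_iso_add_complete[OF iso] finite_add_complete[OF R]])
    show "unit_lengths (add_complete ?R) (case_sum l (\<lambda>_. s))"
      using s G(2) by (auto simp: add_complete_def restrict_edges_def)
  qed (auto split: sum.split simp: map_sum_def)
  moreover have "metric_point (add_complete ?R) (case_sum l (\<lambda>_. s)) = metric_point (add_complete ?C) (case_sum l (\<lambda>_. s))"
    unfolding addR
  proof (rule metric_point_delete_loops[OF finite_add_complete[OF C] unit_lengths_add_complete[OF s G(2)]])
    show "Inl ` S \<subseteq> edges (add_complete ?C)" using S
      by (auto simp: add_complete_def collapse_def)
    fix e :: "'b + 'a set set" assume "e \<in> Inl ` S"
    then obtain d where d: "d \<in> S" "e = Inl d" by blast
    then show "case_sum l (\<lambda>_. s) e = 0" using 0 by simp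
    have "d \<in> ?Z" using SZ d(1) by blast
    then show "card (ends (add_complete ?C) e) = 1"
      using card_ends_collapse[OF G(1), of ?Z d] d(2) by (simp add: add_complete_def)
  qed
  ultimately show ?thesis
    unfolding complete_point_def Z by simp
qed

text \<open>New edges of length 1 are deleted, and what remains is the collapsed graph, which
  represents the same point as \<open>G\<close>.\<close>

lemma complete_point_1:
  assumes G: "finite_multigraph G" "unit_lengths G l"
  shows "complete_point 1 G l = metric_point G l"
proof -
  let ?C = "collapse G (zero_edges G l)"
  let ?K = "Inr ` {A. A \<subseteq> verts ?C \<and> card A = 2} :: ('b + 'a set set) set"
  note C = finite_collapse[OF G(1), of "zero_edges G l"]
  have eq: "edges (add_complete ?C) - ?K = Inl ` edges ?C" by (auto simp: add_complete_def)
  have K: "?K \<subseteq> edges (add_complete ?C)" by (auto simp: add_complete_def)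
  have "metric_point (restrict_edges (add_complete ?C) (edges (add_complete ?C) - ?K)) (case_sum l (\<lambda>_. 1))
    = metric_point (add_complete ?C) (case_sum l (\<lambda>_. 1))"
    by (rule metric_point_delete[OF finite_add_complete[OF C]
        unit_lengths_add_complete[OF zero_le_one order_refl G(2)] K]) auto
  note this[unfolded eq]
  moreover have "multigraph_iso id Inl ?C (restrict_edges (add_complete ?C) (Inl ` edges ?C))"
    by (simp add: multigraph_iso_def restrict_edges_def add_complete_def bij_betw_def)
  then have "metric_point ?C l = metric_point (restrict_edges (add_complete ?C) (Inl ` edges ?C)) (case_sum l (\<lambda>_. 1))"
    by (rule metric_point_iso[OF _ C]) (use G(2) in \<open>auto simp: collapse_def\<close>)
  moreover have "metric_point ?C l = metric_point G l"
    by (rule metric_point_collapse[OF G]) auto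
  ultimately show ?thesis unfolding complete_point_def by simp
qed

definition connect ::
  "real \<Rightarrow> ((nat \<times> flag_class) \<times> (nat \<Rightarrow> real)) set \<Rightarrow> ((nat \<times> flag_class) \<times> (nat \<Rightarrow> real)) set" where
  "connect s = (SOME h. \<forall>G :: (nat, nat) multigraph. \<forall>l. finite_multigraph G \<longrightarrow> unit_lengths G l \<longrightarrow>
     h (metric_point G l) = complete_point s G l)"

lemma connect_metric_point:
  fixes G :: "(nat, nat) multigraph"
  assumes s: "0 \<le> s" "s \<le> 1" and G: "finite_multigraph G" "unit_lengths G l"
  shows "connect s (metric_point G l) = complete_point s G l"
proof -
  obtain h where h: "\<And>G :: (nat, nat) multigraph. \<And>l. finite_multigraph G \<Longrightarrow> unit_lengths G l \<Longrightarrow>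
     h (metric_point G l) = complete_point s G l"
  proof (rule metric_point_descent[where F = "complete_point s" and F' = "complete_point s"])
    show "complete_point s G l = complete_point s H m"
      if "finite_multigraph G" "unit_lengths G l" "multigraph_iso f g G H" "\<And>e. e \<in> edges G \<Longrightarrow> m (g e) = l e"
      for G H :: "(nat, nat) multigraph" and f g l m
      by (rule complete_point_iso[OF s that(1-3)]) (rule that(4))
    show "complete_point s G l = complete_point s H m"
      if "finite_multigraph G" "unit_lengths G l" "multigraph_iso f g G H" "\<And>e. e \<in> edges G \<Longrightarrow> m (g e) = l e"
      for G :: "(nat set, nat) multigraph" and H :: "(nat, nat) multigraph" and f g l m
      by (rule complete_point_iso[OF s that(1-3)]) (rule that(4))
    fix G :: "(nat, nat) multigraph" and l and S :: "nat set"
    assume G: "finite_multigraph G" "unit_lengths G l" and S: "S \<subseteq> edges G"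
    show "complete_point s (restrict_edges G (edges G - S)) l = complete_point s G l"
      if "\<And>e. e \<in> S \<Longrightarrow> l e = 1"
      by (rule complete_point_delete[OF s G S that])
    show "complete_point s (contract_edges G S) l = complete_point s G l"
      if "\<And>e. e \<in> S \<Longrightarrow> l e = 0"
      by (rule complete_point_contract[OF s G S that])
  qed blast
  then have "\<exists>h. \<forall>G :: (nat, nat) multigraph. \<forall>l. finite_multigraph G \<longrightarrow> unit_lengths G l \<longrightarrow>
     h (metric_point G l) = complete_point s G l" by blast
  from someI_ex[OF this, folded connect_def] show ?thesis
    using G by blast
qed

text \<open>New edges of positive length merge no vertices, and the old zero edges are loops after
  the collapse; so the number of vertices is kept. New edges shorter than 1/2 join all vertices into
  one cluster.\<close>

lemma connect_comps:
  assumes s: "0 < s" "s \<le> 1" and z: "z \<in> topspace M_Gr"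
  shows "connect s z \<in> topspace M_Gr" "zero_comps (connect s z) = zero_comps z"
    "short_comps (connect s z) \<le> short_comps z" "s < 1 / 2 \<Longrightarrow> short_comps (connect s z) \<le> 1"
    "connect 1 z = z"
proof -
  obtain G :: "(nat, nat) multigraph" and l where G: "finite_multigraph G" "unit_lengths G l"
    and z: "z = metric_point G l"
    by (rule topspace_M_Gr_cases[OF z])
  let ?Z = "zero_edges G l"
  let ?N = "add_complete (collapse G ?Z)"
  have s0: "0 \<le> s" using s by simp
  have Z: "?Z \<subseteq> edges G" by blast
  have N: "finite_multigraph ?N" by (rule finite_add_complete[OF finite_collapse[OF G(1)]])
  have u: "unit_lengths ?N (case_sum l (\<lambda>_. r))" if "0 \<le> r" "r \<le> 1" for r
    by (rule unit_lengths_add_complete[OF that G(2)])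
  have c: "connect r z = metric_point ?N (case_sum l (\<lambda>_. r))" if "0 \<le> r" "r \<le> 1"
    for r
    unfolding z connect_metric_point[OF that G] complete_point_def ..
  note us = u[OF s0 s(2)] and cs = c[OF s0 s(2)] and u1 = u[OF zero_le_one order_refl]
    and c1 = c[OF zero_le_one order_refl]
  show "connect s z \<in> topspace M_Gr"
    unfolding cs by (rule metric_point_in_topspace[OF N us])
  show one: "connect 1 z = z"
    unfolding z connect_metric_point[OF zero_le_one order_refl G] by (rule complete_point_1[OF G])
  have "{e \<in> edges ?N. case_sum l (\<lambda>_. s) e = 0} = Inl ` ?Z"
    using s(1) by (auto simp: add_complete_def collapse_def)
  then have "zero_comps (connect s z) = num_comps ?N (Inl ` ?Z)"
    unfolding cs zero_comps_metric_point[OF N us] by simp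
  also have "\<dots> = card (verts ?N)"
  proof (rule num_comps_loops[OF N])
    show "Inl ` ?Z \<subseteq> edges ?N" by (auto simp: add_complete_def collapse_def)
    fix e assume "e \<in> (Inl ` ?Z :: (nat + nat set set) set)"
    then obtain d where d: "d \<in> ?Z" "e = Inl d" by blast
    then show "card (ends ?N e) = 1"
      using card_ends_collapse[OF G(1) Z d(1)] by (simp add: add_complete_def)
  qed
  also have "\<dots> = zero_comps z"
    unfolding z zero_comps_metric_point[OF G] num_comps_def
      by (simp add: add_complete_def collapse_def)
  finally show "zero_comps (connect s z) = zero_comps z" .
  \<comment> \<open>Both points live on the same graph \<open>?N\<close>, where lowering the new
    lengths from 1 to \<open>s\<close> can only create short edges; and \<open>connect 1 z\<close>
    is \<open>z\<close>.\<close>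
  have "short_comps (connect s z) \<le> short_comps (connect 1 z)"
    unfolding cs c1 short_comps_metric_point[OF N us] short_comps_metric_point[OF N u1]
  proof (intro num_comps_mono[OF N] subsetI)
    fix e assume "e \<in> {e \<in> edges ?N. case_sum l (\<lambda>_. 1) e < 1 / 2}"
    then show "e \<in> {e \<in> edges ?N. case_sum l (\<lambda>_. s) e < 1 / 2}" by (cases e) auto
  qed
  then show "short_comps (connect s z) \<le> short_comps z" unfolding one .
  assume s2: "s < 1 / 2"
  let ?S = "{e \<in> edges ?N. case_sum l (\<lambda>_. s) e < 1 / 2}"
  have conn: "(u, v) \<in> connected_via ?N ?S" if "u \<in> verts ?N" "v \<in> verts ?N" for u v
  proof (cases "u = v")
    case True
    then show ?thesis using connected_via_refl[OF that(1)] by simp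
  next
    case False
    have "Inr {u, v} \<in> ?S" using False that s2 by (simp add: add_complete_def)
    then show ?thesis
      by (rule connected_via_edge) (use that in \<open>simp_all add: add_complete_def\<close>)
  qed
  have "verts ?N // connected_via ?N ?S \<subseteq> {verts ?N}"
  proof
    fix X assume "X \<in> verts ?N // connected_via ?N ?S"
    then obtain u where u: "u \<in> verts ?N" "X = connected_via ?N ?S `` {u}"
      unfolding quotient_as_image by blast
    have "X \<subseteq> verts ?N" unfolding u(2) by (auto simp: connected_via_iff)
    moreover have "verts ?N \<subseteq> X" unfolding u(2) using conn[OF u(1)] by blast
    ultimately show "X \<in> {verts ?N}" by blast
  qed
  then have "num_comps ?N ?S \<le> 1"
    unfolding num_comps_def using card_mono[of "{verts ?N}"] by fastforce
  then show "short_comps (connect s z) \<le> 1"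
    unfolding cs short_comps_metric_point[OF N us] .
qed

text \<open>Where exactly \<open>n\<close> vertices remain, a set \<open>E\<close> of zero edges
  with \<open>n\<close> components already gives the collapse by all zero edges. The conditions that
  \<open>E\<close> consists of zero edges form a finite closed cover, and on each piece the enlarged
  graph is constant while only its lengths move. The new length runs from 1 to 1/4.\<close>

lemma continuous_map_connect:
  assumes n: "1 \<le> n"
  defines "A \<equiv> topspace M_Gr - vertices_le (n - 1)" and "B \<equiv> vertices_le n"
  shows "continuous_map (prod_topology (top_of_set {0..1}) (subtopology M_Gr (A \<inter> B))) M_Gr
     (\<lambda>(\<tau>, z). connect (1 - 3 / 4 * \<tau>) z)"
proof (rule continuous_map_homotopy_M_Gr)
  show "openin M_Gr A" unfolding A_def by (intro openin_diff openin_topspace closedin_vertices_le)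
  show "closedin M_Gr B" unfolding B_def by (rule closedin_vertices_le)
  fix G :: "(nat, nat) multigraph" assume G: "finite_multigraph G"
  let ?X = "subtopology length_homotopy_space {(s, l). unit_lengths G l \<and> metric_point G l \<in> A \<inter> B}"
  let ?J = "{E. E \<subseteq> edges G \<and> num_comps G E = n}"
  let ?T = "\<lambda>E. {x \<in> topspace ?X. \<forall>e\<in>E. 0 \<le> - snd x e}"
  let ?s = "\<lambda>x :: real \<times> (nat \<Rightarrow> real). 1 - 3 / 4 * fst x"
  let ?f = "\<lambda>E x. metric_point (add_complete (collapse G E)) (case_sum (snd x) (\<lambda>_. ?s x))"
  have X: "0 \<le> ?s x \<and> ?s x \<le> 1 \<and> unit_lengths G (snd x) \<and> num_comps G (zero_edges G (snd x)) = n"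
    if "x \<in> topspace ?X" for x
  proof -
    have x: "0 \<le> fst x" "fst x \<le> 1" "unit_lengths G (snd x)" "metric_point G (snd x) \<in> A \<inter> B"
      using that by (cases x; auto)+
    have "zero_comps (metric_point G (snd x)) = n"
      using x(4) unfolding A_def B_def vertices_le_def by auto
    then show ?thesis
      using x(1-3) zero_comps_metric_point[OF G x(3)] by simp
  qed
  have h: "(case x of (s, l) \<Rightarrow> (case (s, metric_point G l) of (\<tau>, z) \<Rightarrow> connect (1 - 3 / 4 * \<tau>) z)) = ?f E x"
    if E: "E \<in> ?J" and x: "x \<in> ?T E" for E x
  proof -
    have xX: "x \<in> topspace ?X" using x by blast
    note X = X[OF xX]
    have "E \<subseteq> zero_edges G (snd x)"
    proof
      fix e assume e: "e \<in> E"
      then have "e \<in> edges G" using E by blast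
      moreover have "0 \<le> - snd x e" using x e by blast
      ultimately show "e \<in> zero_edges G (snd x)" using X by force
    qed
    then have "connected_via G E = connected_via G (zero_edges G (snd x))"
      using connected_via_eq[OF G, of E "zero_edges G (snd x)"] E X by simp
    then have "collapse G (zero_edges G (snd x)) = collapse G E"
      unfolding collapse_def by simp
    then show ?thesis
      using connect_metric_point[OF _ _ G, of "?s x" "snd x"] X
      by (simp add: case_prod_unfold complete_point_def)
  qed
  show "continuous_map ?X M_Gr (\<lambda>(s, l). (case (s, metric_point G l) of (\<tau>, z) \<Rightarrow> connect (1 - 3 / 4 * \<tau>) z))"
  proof (rule pasting_lemma_closed[where I = ?J and T = ?T and f = ?f])
    show "finite ?J" using G unfolding finite_multigraph_def by simp
    show "closedin ?X (?T E)" if "E \<in> ?J" for E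
      by (intro closedin_all_nonneg continuous_map_minus continuous_map_length_homotopy_space)
    fix E assume E: "E \<in> ?J"
    show "continuous_map (subtopology ?X (?T E)) M_Gr (?f E)"
    proof (rule continuous_map_metric_point[OF finite_add_complete[OF finite_collapse[OF G]]])
      fix e :: "nat + nat set set"
      have fst: "continuous_map (subtopology ?X (?T E)) euclideanreal fst"
        by (intro continuous_map_from_subtopology[of ?X] continuous_map_length_homotopy_space)
      have snd: "continuous_map (subtopology ?X (?T E)) euclideanreal (\<lambda>x. snd x d)" for d
        by (intro continuous_map_from_subtopology[of ?X] continuous_map_length_homotopy_space)
      show "continuous_map (subtopology ?X (?T E)) euclideanreal (\<lambda>x. case_sum (snd x) (\<lambda>_. ?s x) e)"
      proof (cases e)
        case (Inl d)
        then show ?thesis using snd[of d] by (simp only: sum.case)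
      next
        case (Inr d)
        have "continuous_map (subtopology ?X (?T E)) euclideanreal ?s"
          by (intro continuous_map_diff continuous_map_real_mult_left fst) simp
        then show ?thesis unfolding Inr sum.case .
      qed
    next
      fix x assume "x \<in> topspace (subtopology ?X (?T E))"
      then have "x \<in> topspace ?X" by simp
      then show "unit_lengths (add_complete (collapse G E)) (case_sum (snd x) (\<lambda>_. ?s x))"
        using X by (intro unit_lengths_add_complete) blast+
    qed
  next
    fix i j x assume ij: "i \<in> ?J" "j \<in> ?J" "x \<in> topspace ?X \<inter> ?T i \<inter> ?T j"
    show "?f i x = ?f j x"
      using h[OF ij(1), of x] h[OF ij(2), of x] ij(3) by auto
  next
    fix x assume x: "x \<in> topspace ?X"
    have J: "zero_edges G (snd x) \<in> ?J" using X[OF x] by blast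
    have T: "x \<in> ?T (zero_edges G (snd x))" using x by simp
    show "\<exists>j. j \<in> ?J \<and> x \<in> ?T j \<and>
       (case x of (s, l) \<Rightarrow> (case (s, metric_point G l) of (\<tau>, z) \<Rightarrow> connect (1 - 3 / 4 * \<tau>) z)) = ?f j x"
      using J T h[OF J T] by blast
  qed
qed

section \<open>Graphs with one vertex\<close>

definition rose :: "'e set \<Rightarrow> (unit, 'e) multigraph" where
  "rose E = \<lparr>verts = {()}, edges = E, ends = (\<lambda>_. {()})\<rparr>"

lemma finite_rose: "finite E \<Longrightarrow> finite_multigraph (rose E)"
  by (simp add: rose_def finite_multigraph_def)

lemma edges_rose [simp]: "edges (rose E) = E"
  by (simp add: rose_def)

lemma restrict_rose: "restrict_edges (rose E) F = rose F"
  by (simp add: rose_def restrict_edges_def)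

lemma rose_point_bij:
  assumes "bij_betw g E F" "finite E" "\<And>e. e \<in> E \<Longrightarrow> 0 \<le> l e \<and> l e \<le> 1" "\<And>e. e \<in> E \<Longrightarrow> m (g e) = l e"
  shows "metric_point (rose E) l = metric_point (rose F) m"
proof (rule metric_point_iso)
  show "multigraph_iso id g (rose E) (rose F)"
    using assms(1) by (simp add: multigraph_iso_def rose_def)
qed (use assms finite_rose in auto)

lemma rose_point_delete:
  assumes E: "finite E" "\<And>e. e \<in> E \<Longrightarrow> 0 \<le> l e \<and> l e \<le> 1"
    and S: "S \<subseteq> E" "\<And>e. e \<in> S \<Longrightarrow> l e = 1"
  shows "metric_point (rose (E - S)) l = metric_point (rose E) l"
  using metric_point_delete[OF finite_rose[OF E(1)], of l S] E(2) S by (simp add: restrict_rose)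

lemma rose_point_contract:
  assumes E: "finite E" "\<And>e. e \<in> E \<Longrightarrow> 0 \<le> l e \<and> l e \<le> 1"
    and S: "S \<subseteq> E" "\<And>e. e \<in> S \<Longrightarrow> l e = 0"
  shows "metric_point (rose (E - S)) l = metric_point (rose E) l"
  using metric_point_delete_loops[OF finite_rose[OF E(1)], of l S] E(2) S
  by (simp add: restrict_rose) (simp add: rose_def)

section \<open>Sorted lengths of a rose and their deformation to a single loop\<close>

definition sorted_lengths :: "'e set \<Rightarrow> ('e \<Rightarrow> real) \<Rightarrow> real list" where
  "sorted_lengths E l = sorted_list_of_multiset (image_mset l (mset_set E))"

lemma sorted_list_of_multiset_eq:
  assumes "sorted xs" "mset xs = M"
  shows "sorted_list_of_multiset M = xs"
  using assms by (metis sorted_list_of_multiset_mset sorted_sort_id)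

lemma sorted_lengths_eq:
  assumes "distinct es" "set es = E" "sorted (map l es)"
  shows "sorted_lengths E l = map l es"
  unfolding sorted_lengths_def
  by (rule sorted_list_of_multiset_eq) (use assms in \<open>auto simp: mset_set_set[symmetric]\<close>)

lemma ex_sorted_lengths:
  assumes "finite E"
  obtains es where "distinct es" "set es = E" "sorted (map l es)" "sorted_lengths E l = map l es"
proof -
  obtain xs where xs: "set xs = E" "distinct xs"
    using finite_distinct_list[OF assms] by metis
  have "distinct (sort_key l xs)" "set (sort_key l xs) = E" "sorted (map l (sort_key l xs))"
    using xs by simp_all
  then show ?thesis using that sorted_lengths_eq by blast
qed

lemma sorted_lengths_facts:
  assumes "finite E"
  shows "length (sorted_lengths E l) = card E" "sum_list (sorted_lengths E l) = sum l E"
    "set (sorted_lengths E l) = l ` E" "sorted (sorted_lengths E l)"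
proof -
  obtain es where es: "distinct es" "set es = E" "sorted (map l es)" "sorted_lengths E l = map l es"
    by (rule ex_sorted_lengths[OF assms])
  show "length (sorted_lengths E l) = card E" "sum_list (sorted_lengths E l) = sum l E"
    "set (sorted_lengths E l) = l ` E" "sorted (sorted_lengths E l)"
    using es distinct_card[OF es(1)] sum_list_distinct_conv_sum_set[OF es(1)] by auto
qed

lemma sorted_lengths_iso:
  assumes "inj_on g E" "\<And>e. e \<in> E \<Longrightarrow> m (g e) = l e" "finite E"
  shows "sorted_lengths (g ` E) m = sorted_lengths E l"
proof -
  have "image_mset m (mset_set (g ` E)) = image_mset l (mset_set E)"
    unfolding image_mset_mset_set[OF assms(1), symmetric] multiset.map_comp
    using assms(2,3) by (intro image_mset_cong) simp
  then show ?thesis by (simp add: sorted_lengths_def)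
qed

lemma image_mset_mset_set_Diff:
  assumes "finite E" "S \<subseteq> E" "\<And>e. e \<in> S \<Longrightarrow> l e = c"
  shows "image_mset l (mset_set E) = image_mset l (mset_set (E - S)) + replicate_mset (card S) c"
proof -
  have S: "finite S" using assms finite_subset by blast
  have "mset_set E = mset_set (E - S) + mset_set S"
  proof -
    have "(E - S) \<union> S = E" using assms(2) by blast
    then show ?thesis using mset_set_Union[of "E - S" S] assms(1) S by (simp add: Int_commute)
  qed
  moreover have "image_mset l (mset_set S) = image_mset (\<lambda>_. c) (mset_set S)"
    using assms(3) S by (intro image_mset_cong) simp
  ultimately show ?thesis using S by (simp add: image_mset_const_eq)
qed

lemma sorted_lengths_delete:
  assumes E: "finite E" "\<And>e. e \<in> E \<Longrightarrow> l e \<le> 1" and S: "S \<subseteq> E" "\<And>e. e \<in> S \<Longrightarrow> l e = 1"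
  shows "sorted_lengths E l = sorted_lengths (E - S) l @ replicate (card S) 1"
  unfolding sorted_lengths_def[of E]
proof (rule sorted_list_of_multiset_eq)
  have "finite (E - S)" using E(1) by simp
  note f = sorted_lengths_facts[OF this, of l]
  show "sorted (sorted_lengths (E - S) l @ replicate (card S) 1)"
    unfolding sorted_append f(3) using f(4) E(2) by auto
  show "mset (sorted_lengths (E - S) l @ replicate (card S) 1) = image_mset l (mset_set E)"
    using image_mset_mset_set_Diff[of E S l 1] E(1) S by (simp add: sorted_lengths_def)
qed

lemma sorted_lengths_contract:
  assumes E: "finite E" "\<And>e. e \<in> E \<Longrightarrow> 0 \<le> l e" and S: "S \<subseteq> E" "\<And>e. e \<in> S \<Longrightarrow> l e = 0"
  shows "sorted_lengths E l = replicate (card S) 0 @ sorted_lengths (E - S) l"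
  unfolding sorted_lengths_def[of E]
proof (rule sorted_list_of_multiset_eq)
  have "finite (E - S)" using E(1) by simp
  note f = sorted_lengths_facts[OF this, of l]
  show "sorted (replicate (card S) 0 @ sorted_lengths (E - S) l)"
    unfolding sorted_append f(3) using f(4) E(2) by auto
  show "mset (replicate (card S) 0 @ sorted_lengths (E - S) l) = image_mset l (mset_set E)"
    using image_mset_mset_set_Diff[of E S l 0] E(1) S by (simp add: sorted_lengths_def)
qed

text \<open>A sorted list of \<open>N\<close> lengths is the probability measure on \<open>{0, \<dots>, N}\<close> whose weights are the
  gaps between consecutive lengths, and adding lengths 0 or 1 translates or enlarges the ambient
  interval.  \<open>settle\<close> moves this measure along a straight line to the one with the same mean
  that is supported on two neighbouring integers, that is, with at most one length in \<open>(0, 1)\<close>.\<close>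

definition settle :: "real \<Rightarrow> real list \<Rightarrow> nat \<Rightarrow> real" where
  "settle \<tau> xs j = (1 - \<tau>) * xs ! j +
     \<tau> * max 0 (min 1 (real j + 1 - real (length xs) + sum_list xs))"

lemma settle_bounds:
  assumes "0 \<le> \<tau>" "\<tau> \<le> 1" "0 \<le> xs ! j" "xs ! j \<le> 1"
  shows "0 \<le> settle \<tau> xs j \<and> settle \<tau> xs j \<le> 1"
proof -
  let ?y = "max 0 (min 1 (real j + 1 - real (length xs) + sum_list xs))"
  have y: "0 \<le> ?y" "?y \<le> 1" by auto
  have "0 \<le> settle \<tau> xs j"
    unfolding settle_def using assms y by (intro add_nonneg_nonneg mult_nonneg_nonneg) simp_all
  moreover have "settle \<tau> xs j \<le> (1 - \<tau>) * 1 + \<tau> * 1"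
    unfolding settle_def using assms y by (intro add_mono mult_left_mono) simp_all
  ultimately show ?thesis by simp
qed

definition rose_flow :: "real \<Rightarrow> real list \<Rightarrow> ((nat \<times> flag_class) \<times> (nat \<Rightarrow> real)) set" where
  "rose_flow \<tau> xs = metric_point (rose {..<length xs}) (settle \<tau> xs)"

lemma sum_list_unit_bounds:
  assumes "set xs \<subseteq> {0..1 :: real}"
  shows "0 \<le> sum_list xs" "sum_list xs \<le> real (length xs)"
  using assms by (induction xs) auto

text \<open>Length and sum of the list both grow by \<open>k\<close>, so the expression inside the
  clamp is unchanged at the old positions. At the new positions it is at least 1, because the sum is
  nonnegative; these edges keep length 1 and are deleted.\<close>

lemma rose_flow_ones:
  assumes \<tau>: "0 \<le> \<tau>" "\<tau> \<le> 1" and xs: "set xs \<subseteq> {0..1}"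
  shows "rose_flow \<tau> (xs @ replicate k 1) = rose_flow \<tau> xs"
proof -
  let ?N = "length xs" and ?ys = "xs @ replicate k 1"
  let ?S = "{?N..<?N + k}"
  have ys: "set ?ys \<subseteq> {0..1}" using xs by auto
  have sum: "sum_list ?ys = sum_list xs + real k" by (simp add: sum_list_replicate)
  have arg: "real j + 1 - real (length ?ys) + sum_list ?ys = real j + 1 - real ?N + sum_list xs"
    for j
    unfolding sum by simp
  have low: "settle \<tau> ?ys j = settle \<tau> xs j" if "j < ?N" for j
    unfolding settle_def arg using that by (simp add: nth_append)
  have high: "settle \<tau> ?ys j = 1" if "j \<in> ?S" for j
  proof -
    have "1 \<le> real j + 1 - real (length ?ys) + sum_list ?ys"
      using that sum sum_list_unit_bounds(1)[OF xs] by simp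
    moreover have "?ys ! j = 1" using that by (auto simp: nth_append)
    ultimately show ?thesis unfolding settle_def by simp
  qed
  have unit: "0 \<le> settle \<tau> ?ys j \<and> settle \<tau> ?ys j \<le> 1" if "j < length ?ys"
    for j
    using ys nth_mem[OF that] by (intro settle_bounds[OF \<tau>]) (meson atLeastAtMost_iff subsetD)+
  have "rose_flow \<tau> ?ys = metric_point (rose ({..<length ?ys} - ?S)) (settle \<tau> ?ys)"
    unfolding rose_flow_def
    by (rule rose_point_delete[symmetric]) (use unit high in \<open>simp_all\<close>, auto)
  also have "{..<length ?ys} - ?S = {..<?N}" by auto
  also have "metric_point (rose {..<?N}) (settle \<tau> ?ys) = rose_flow \<tau> xs"
    unfolding rose_flow_def
  proof (rule metric_point_cong[OF finite_rose])
    show "unit_lengths (rose {..<?N}) (settle \<tau> ?ys)" using unit by simp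
    show "settle \<tau> xs j = settle \<tau> ?ys j" if "j \<in> edges (rose {..<?N})" for j
      using low that by simp
  qed simp
  finally show ?thesis .
qed

text \<open>The sum is unchanged and the list grows by \<open>k\<close>, which the shift of
  positions by \<open>k\<close> cancels. At the first \<open>k\<close> positions the expression
  inside the clamp is at most 0, because the sum of \<open>xs\<close> is at most its length.\<close>

lemma rose_flow_zeros:
  assumes \<tau>: "0 \<le> \<tau>" "\<tau> \<le> 1" and xs: "set xs \<subseteq> {0..1}"
  shows "rose_flow \<tau> (replicate k 0 @ xs) = rose_flow \<tau> xs"
proof -
  let ?N = "length xs" and ?ys = "replicate k 0 @ xs"
  have ys: "set ?ys \<subseteq> {0..1}" using xs by auto
  have sum: "sum_list ?ys = sum_list xs" by (simp add: sum_list_replicate)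
  have low: "settle \<tau> ?ys j = 0" if "j \<in> {..<k}" for j
  proof -
    have "real j + 1 - real (length ?ys) + sum_list ?ys \<le> 0"
      using that sum sum_list_unit_bounds(2)[OF xs] by simp
    then show ?thesis using that by (simp add: settle_def nth_append)
  qed
  have arg: "real (j + k) + 1 - real (length ?ys) + sum_list ?ys = real j + 1 - real ?N + sum_list xs" for j
    unfolding sum by simp
  have high: "settle \<tau> ?ys (j + k) = settle \<tau> xs j" for j
    unfolding settle_def arg by (simp add: nth_append)
  have unit: "0 \<le> settle \<tau> ?ys j \<and> settle \<tau> ?ys j \<le> 1" if "j < length ?ys"
    for j
    using ys nth_mem[OF that] by (intro settle_bounds[OF \<tau>]) (meson atLeastAtMost_iff subsetD)+
  have unit': "0 \<le> settle \<tau> xs j \<and> settle \<tau> xs j \<le> 1" if "j < ?N" for j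
    using xs nth_mem[OF that] by (intro settle_bounds[OF \<tau>]) (meson atLeastAtMost_iff subsetD)+
  have "rose_flow \<tau> ?ys = metric_point (rose ({..<length ?ys} - {..<k})) (settle \<tau> ?ys)"
    unfolding rose_flow_def
    by (rule rose_point_contract[symmetric]) (use unit low in \<open>simp_all\<close>)
  also have "\<dots> = rose_flow \<tau> xs"
    unfolding rose_flow_def
  proof (rule rose_point_bij[symmetric])
    have "(\<lambda>j. j + k) ` {..<?N} = {..<length ?ys} - {..<k}"
    proof (intro equalityI subsetI)
      fix j assume "j \<in> {..<length ?ys} - {..<k}"
      then show "j \<in> (\<lambda>j. j + k) ` {..<?N}" by (intro image_eqI[of _ _ "j - k"]) auto
    qed auto
    then show "bij_betw (\<lambda>j. j + k) {..<?N} ({..<length ?ys} - {..<k})"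
      by (simp add: bij_betw_def)
  qed (use unit' high in simp_all)
  finally show ?thesis .
qed

lemma rose_flow_0:
  assumes E: "finite E" "\<And>e. e \<in> E \<Longrightarrow> 0 \<le> l e \<and> l e \<le> 1"
  shows "rose_flow 0 (sorted_lengths E l) = metric_point (rose E) l"
proof -
  obtain es where es: "distinct es" "set es = E" "sorted_lengths E l = map l es"
    by (rule ex_sorted_lengths[OF E(1)])
  show ?thesis
    unfolding rose_flow_def es(3)
  proof (rule rose_point_bij)
    show "bij_betw ((!) es) {..<length (map l es)} E"
      using bij_betw_nth[OF es(1), of "{..<length es}" E] es(2) by simp
    show "l (es ! j) = settle 0 (map l es) j" if "j \<in> {..<length (map l es)}" for j
      using that by (simp add: settle_def)
    then show "0 \<le> settle 0 (map l es) j \<and> settle 0 (map l es) j \<le> 1"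
      if "j \<in> {..<length (map l es)}" for j
      using that E(2)[of "es ! j"] es(2) nth_mem[of j es] by auto
  qed simp
qed

definition loop :: "real \<Rightarrow> ((nat \<times> flag_class) \<times> (nat \<Rightarrow> real)) set" where
  "loop x = metric_point (rose {()}) (\<lambda>_. x)"

lemma loop_0: "loop 0 = metric_point (rose ({} :: unit set)) (\<lambda>_. 0)"
  unfolding loop_def using rose_point_contract[of "{()}" "\<lambda>_. 0" "{()}"] by simp

lemma loop_1: "loop 1 = loop 0"
proof -
  have "loop 1 = metric_point (rose ({} :: unit set)) (\<lambda>_. 1)"
    unfolding loop_def using rose_point_delete[of "{()}" "\<lambda>_. 1" "{()}"] by simp
  also have "\<dots> = loop 0"
    unfolding loop_0 by (rule metric_point_cong[OF finite_rose]) simp_all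
  finally show ?thesis .
qed

text \<open>The settled list consists of zeros, then at most one fractional length, then ones.
  Contracting the zeros and deleting the ones leaves one loop whose length is the fractional part of
  the sum.\<close>

lemma rose_flow_1:
  assumes xs: "set xs \<subseteq> {0..1}"
  shows "rose_flow 1 xs = loop (frac (sum_list xs))"
proof -
  let ?N = "length xs" and ?\<sigma> = "sum_list xs"
  have s: "settle 1 xs j = max 0 (min 1 (real j + 1 - real ?N + ?\<sigma>))" for j
    by (simp add: settle_def)
  note \<sigma> = sum_list_unit_bounds[OF xs]
  have unit: "0 \<le> settle 1 xs j \<and> settle 1 xs j \<le> 1" for j unfolding s by auto
  define m where "m = nat \<lfloor>?\<sigma>\<rfloor>"
  have m: "real m \<le> ?\<sigma>" "?\<sigma> < real m + 1" "?\<sigma> = real m + frac ?\<sigma>"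
    using \<sigma>(1) unfolding m_def frac_def by linarith+
  show ?thesis
  proof (cases "m < ?N")
    case True
    \<comment> \<open>The position of the fractional length: exactly \<open>m\<close> positions come
      after it, and these carry the ones.\<close>
    define k where "k = ?N - 1 - m"
    have k: "real k = real ?N - 1 - real m" "k < ?N" using True by (auto simp: k_def)
    have low: "settle 1 xs j = 0" if "j < k" for j
    proof -
      have "real j + 1 \<le> real k" using that by linarith
      then show ?thesis unfolding s using k m by simp
    qed
    have high: "settle 1 xs j = 1" if "k < j" for j
    proof -
      have "real k + 1 \<le> real j" using that by linarith
      then show ?thesis unfolding s using k m by simp
    qed
    have mid: "settle 1 xs k = frac ?\<sigma>"
    proof -
      have "real k + 1 - real ?N + ?\<sigma> = frac ?\<sigma>" using k(1) m(3) by linarith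
      then show ?thesis unfolding s using frac_ge_0[of ?\<sigma>] frac_lt_1[of ?\<sigma>] by simp
    qed
    have "rose_flow 1 xs = metric_point (rose ({..<?N} - {k<..<?N})) (settle 1 xs)"
      unfolding rose_flow_def by (rule rose_point_delete[symmetric]) (use unit high in auto)
    also have "\<dots> = metric_point (rose ({..<?N} - {k<..<?N} - {..<k})) (settle 1 xs)"
      by (rule rose_point_contract[symmetric]) (use unit low k in auto)
    also have "{..<?N} - {k<..<?N} - {..<k} = {k}" using k by auto
    also have "metric_point (rose {k}) (settle 1 xs) = loop (frac ?\<sigma>)"
      unfolding loop_def by (rule rose_point_bij[of "\<lambda>_. ()"]) (use mid frac_lt_1[of ?\<sigma>] in \<open>simp_all add: less_imp_le\<close>)
    finally show ?thesis .
  next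
    case False
    \<comment> \<open>The sum is at most the number of lengths, so now it attains it: all settled
      lengths are 1 and every loop is deleted.\<close>
    then have N: "?\<sigma> = real ?N" "m = ?N" using \<sigma>(2) m by linarith+
    then have 0: "frac ?\<sigma> = 0" by simp
    have high: "settle 1 xs j = 1" for j unfolding s N by simp
    have "rose_flow 1 xs = metric_point (rose ({..<?N} - {..<?N})) (settle 1 xs)"
      unfolding rose_flow_def by (rule rose_point_delete[symmetric]) (use unit high in auto)
    also have "\<dots> = loop 0"
      unfolding loop_0 Diff_cancel
      by (rule rose_point_bij[of "\<lambda>_. ()"]) (auto simp: bij_betw_def)
    finally show ?thesis unfolding 0 .
  qed
qed

section \<open>The circle of roses\<close>

text \<open>The vertices of \<open>G\<close> are forgotten, which makes this a map on the whole
  space with values in the roses. Only on \<open>vertices_le 1\<close> does it start at the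
  identity.\<close>

definition flow ::
  "real \<Rightarrow> ((nat \<times> flag_class) \<times> (nat \<Rightarrow> real)) set \<Rightarrow> ((nat \<times> flag_class) \<times> (nat \<Rightarrow> real)) set" where
  "flow \<tau> = (SOME h. \<forall>G :: (nat, nat) multigraph. \<forall>l. finite_multigraph G \<longrightarrow> unit_lengths G l \<longrightarrow>
     h (metric_point G l) = rose_flow \<tau> (sorted_lengths (edges G) l))"

lemma sorted_lengths_multigraph_iso:
  assumes "finite_multigraph G" "multigraph_iso f g G H" "\<And>e. e \<in> edges G \<Longrightarrow> m (g e) = l e"
  shows "sorted_lengths (edges G) l = sorted_lengths (edges H) m"
proof -
  have g: "inj_on g (edges G)" "edges H = g ` edges G"
    using assms(2) by (auto simp: multigraph_iso_def bij_betw_def)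
  have "finite (edges G)" using assms(1) by (simp add: finite_multigraph_def)
  then show ?thesis
    unfolding g(2) using sorted_lengths_iso[of g "edges G" m l] g(1) assms(3) by simp
qed

lemma unit_sorted_lengths:
  assumes "finite_multigraph G" "unit_lengths G l"
  shows "set (sorted_lengths (edges G) l) \<subseteq> {0..1}"
proof -
  have "finite (edges G)" using assms(1) by (simp add: finite_multigraph_def)
  from sorted_lengths_facts(3)[OF this] show ?thesis using assms(2) by auto
qed

lemma flow_metric_point:
  fixes G :: "(nat, nat) multigraph"
  assumes \<tau>: "0 \<le> \<tau>" "\<tau> \<le> 1" and G: "finite_multigraph G" "unit_lengths G l"
  shows "flow \<tau> (metric_point G l) = rose_flow \<tau> (sorted_lengths (edges G) l)"
proof -
  obtain h where h: "\<And>G :: (nat, nat) multigraph. \<And>l. finite_multigraph G \<Longrightarrow> unit_lengths G l \<Longrightarrow>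
     h (metric_point G l) = rose_flow \<tau> (sorted_lengths (edges G) l)"
  proof (rule metric_point_descent[where F = "\<lambda>G l. rose_flow \<tau> (sorted_lengths (edges G) l)"
      and F' = "\<lambda>G l. rose_flow \<tau> (sorted_lengths (edges G) l)"])
    show "rose_flow \<tau> (sorted_lengths (edges G) l) = rose_flow \<tau> (sorted_lengths (edges H) m)"
      if "finite_multigraph G" "multigraph_iso f g G H" "\<And>e. e \<in> edges G \<Longrightarrow> m (g e) = l e"
      for G H :: "(nat, nat) multigraph" and f g l m
      using sorted_lengths_multigraph_iso[where m = m and l = l, OF that] by simp
    show "rose_flow \<tau> (sorted_lengths (edges G) l) = rose_flow \<tau> (sorted_lengths (edges H) m)"
      if "finite_multigraph G" "multigraph_iso f g G H" "\<And>e. e \<in> edges G \<Longrightarrow> m (g e) = l e"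
      for G :: "(nat set, nat) multigraph" and H :: "(nat, nat) multigraph" and f g l m
      using sorted_lengths_multigraph_iso[where m = m and l = l, OF that] by simp
    fix G :: "(nat, nat) multigraph" and l and S :: "nat set"
    assume G: "finite_multigraph G" "unit_lengths G l" and S: "S \<subseteq> edges G"
    have E: "finite (edges G)" using G(1) by (simp add: finite_multigraph_def)
    have xs: "set (sorted_lengths (edges G - S) l) \<subseteq> {0..1}"
      using sorted_lengths_facts(3)[of "edges G - S" l] E G(2) by auto
    show "rose_flow \<tau> (sorted_lengths (edges (restrict_edges G (edges G - S))) l)
      = rose_flow \<tau> (sorted_lengths (edges G) l)" if "\<And>e. e \<in> S \<Longrightarrow> l e = 1"
    proof -
      have "sorted_lengths (edges G) l = sorted_lengths (edges G - S) l @ replicate (card S) 1"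
        by (rule sorted_lengths_delete[OF E _ S that]) (use G(2) in blast)
      then show ?thesis
        using rose_flow_ones[OF \<tau> xs, of "card S"] by (simp add: restrict_edges_def)
    qed
    show "rose_flow \<tau> (sorted_lengths (edges (contract_edges G S)) l)
      = rose_flow \<tau> (sorted_lengths (edges G) l)" if "\<And>e. e \<in> S \<Longrightarrow> l e = 0"
    proof -
      have "sorted_lengths (edges G) l = replicate (card S) 0 @ sorted_lengths (edges G - S) l"
        by (rule sorted_lengths_contract[OF E _ S that]) (use G(2) in blast)
      then show ?thesis
        using rose_flow_zeros[OF \<tau> xs, of "card S"] by (simp add: contract_edges_def)
    qed
  qed blast
  then have "\<exists>h. \<forall>G :: (nat, nat) multigraph. \<forall>l. finite_multigraph G \<longrightarrow> unit_lengths G l \<longrightarrow>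
     h (metric_point G l) = rose_flow \<tau> (sorted_lengths (edges G) l)" by blast
  from someI_ex[OF this, folded flow_def] show ?thesis
    using G by blast
qed

text \<open>The order statistics are coordinate functions on each region of fixed order.\<close>

lemma continuous_map_sorted_lengths:
  assumes E: "finite E" and l: "\<And>e. e \<in> E \<Longrightarrow> continuous_map X euclideanreal (\<lambda>x. l x e)" and j: "j < card E"
  shows "continuous_map X euclideanreal (\<lambda>x. sorted_lengths E (l x) ! j)"
proof (rule continuous_map_by_orders[where E = E and l = l and f = "\<lambda>es x. l x (es ! j)"])
  fix es assume es: "distinct es" "set es = E"
  have j': "j < length es" using j distinct_card[OF es(1)] es(2) by simp
  then have "es ! j \<in> E" using es(2) nth_mem by blast
  then show "continuous_map (subtopology X {x \<in> topspace X. sorted (map (l x) es)}) euclideanreal (\<lambda>x. l x (es ! j))"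
    by (intro continuous_map_from_subtopology l)
  show "sorted_lengths E (l x) ! j = l x (es ! j)" if "sorted (map (l x) es)" for x
    using sorted_lengths_eq[OF es that] j' by simp
qed (use E l in auto)

lemma continuous_map_flow:
  "continuous_map (prod_topology (top_of_set {0..1}) M_Gr) M_Gr (\<lambda>(\<tau>, z). flow \<tau> z)"
proof -
  let ?T = "topspace M_Gr"
  have "continuous_map (prod_topology (top_of_set {0..1}) (subtopology M_Gr (?T \<inter> ?T))) M_Gr (\<lambda>(\<tau>, z). flow \<tau> z)"
  proof (rule continuous_map_homotopy_M_Gr[OF openin_topspace closedin_topspace])
    fix G :: "(nat, nat) multigraph" assume G: "finite_multigraph G"
    let ?X = "subtopology length_homotopy_space {(s, l). unit_lengths G l \<and> metric_point G l \<in> ?T \<inter> ?T}"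
    let ?xs = "\<lambda>x :: real \<times> (nat \<Rightarrow> real). sorted_lengths (edges G) (snd x)"
    have E: "finite (edges G)" using G by (simp add: finite_multigraph_def)
    have X: "0 \<le> fst x \<and> fst x \<le> 1 \<and> unit_lengths G (snd x)"
      if "x \<in> topspace ?X" for x
      using that by (cases x) auto
    have len: "length (?xs x) = card (edges G)" for x by (rule sorted_lengths_facts(1)[OF E])
    have "continuous_map ?X M_Gr (\<lambda>x. metric_point (rose {..<card (edges G)}) (settle (fst x) (?xs x)))"
    proof (rule continuous_map_metric_point[OF finite_rose])
      fix j assume "j \<in> edges (rose {..<card (edges G)})"
      then have j: "j < card (edges G)" by simp
      have a: "continuous_map ?X euclideanreal (\<lambda>x. ?xs x ! j)"
        by (rule continuous_map_sorted_lengths[OF E continuous_map_length_homotopy_space(2) j])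
      have b: "continuous_map ?X euclideanreal (\<lambda>x. sum (snd x) (edges G))"
        by (intro continuous_map_sum E continuous_map_length_homotopy_space(2))
      show "continuous_map ?X euclideanreal (\<lambda>x. settle (fst x) (?xs x) j)"
        unfolding settle_def len sorted_lengths_facts(2)[OF E]
        by (intro continuous_map_add continuous_map_real_mult continuous_map_diff continuous_map_real_max
            continuous_map_real_min continuous_map_canonical_const continuous_map_length_homotopy_space a b)
    next
      fix x assume x: "x \<in> topspace ?X"
      have "settle (fst x) (?xs x) j \<in> {0..1}" if "j < card (edges G)" for j
      proof -
        have "?xs x ! j \<in> {0..1}"
          using unit_sorted_lengths[OF G, of "snd x"] X[OF x] nth_mem[of j "?xs x"] that
            unfolding len by blast
        then show ?thesis using settle_bounds[of "fst x" "?xs x" j] X[OF x] by simp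
      qed
      then show "unit_lengths (rose {..<card (edges G)}) (settle (fst x) (?xs x))" by simp
    qed simp
    then show "continuous_map ?X M_Gr (\<lambda>(s, l). case (s, metric_point G l) of (\<tau>, z) \<Rightarrow> flow \<tau> z)"
    proof (rule continuous_map_eq)
      fix x assume "x \<in> topspace ?X"
      note X = X[OF this]
      have "flow (fst x) (metric_point G (snd x)) = rose_flow (fst x) (?xs x)"
        by (rule flow_metric_point[OF _ _ G]) (use X in blast)+
      then show "metric_point (rose {..<card (edges G)}) (settle (fst x) (?xs x))
         = (case x of (s, l) \<Rightarrow> case (s, metric_point G l) of (\<tau>, z) \<Rightarrow> flow \<tau> z)"
        by (simp add: case_prod_unfold rose_flow_def len)
    qed
  qed
  then show ?thesis by simp
qed

lemma metric_point_one_vertex: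
  assumes G: "finite_multigraph G" "unit_lengths G l" and "card (verts G) = 1"
  shows "metric_point G l = metric_point (rose (edges G)) l"
proof (rule metric_point_iso[OF _ G])
  obtain v where v: "verts G = {v}" using assms(3) by (rule card_1_singletonE)
  have ne: "ends G e \<noteq> {}" if "e \<in> edges G" for e
  proof -
    have "card (ends G e) \<noteq> 0" using that G(1) by (auto simp: finite_multigraph_def)
    then show ?thesis by auto
  qed
  show "multigraph_iso (\<lambda>_. ()) id G (rose (edges G))"
    unfolding multigraph_iso_def
  proof (intro conjI ballI)
    show "bij_betw (\<lambda>_. ()) (verts G) (verts (rose (edges G)))"
      unfolding v by (auto simp: rose_def bij_betw_def)
    fix e assume "e \<in> edges G"
    then show "ends (rose (edges G)) (id e) = (\<lambda>_. ()) ` ends G e"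
      using ne by (auto simp: rose_def)
  qed simp
qed simp

lemma flow_0:
  assumes z: "z \<in> vertices_le 1"
  shows "flow 0 z = z"
proof -
  obtain G :: "(nat, nat) multigraph" and l where G: "finite_multigraph G" "unit_lengths G l"
    and z': "z = metric_point G l"
    using z unfolding vertices_le_def by (auto elim: topspace_M_Gr_cases)
  have E: "finite (edges G)" using G(1) by (simp add: finite_multigraph_def)
  let ?C = "collapse G (zero_edges G l)"
  have "zero_comps z = 1" using z by (simp add: vertices_le_def)
  then have vC: "card (verts ?C) = 1"
    unfolding z' zero_comps_metric_point[OF G] num_comps_def by (simp add: collapse_def)
  have eC: "edges ?C = edges G" by (simp add: collapse_def)
  have "metric_point ?C l = metric_point (rose (edges G)) l"
    using metric_point_one_vertex[OF finite_collapse[OF G(1)] _ vC, of l] G(2) unfolding eC by blast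
  moreover have "metric_point ?C l = z"
    unfolding z' by (rule metric_point_collapse[OF G]) auto
  moreover have "flow 0 z = metric_point (rose (edges G)) l"
    unfolding z' flow_metric_point[OF order_refl zero_le_one G]
    by (rule rose_flow_0[OF E]) (use G(2) in blast)
  ultimately show ?thesis by simp
qed

lemma flow_in_nonempty_graphs:
  assumes \<tau>: "0 \<le> \<tau>" "\<tau> \<le> 1" and z: "z \<in> topspace M_Gr"
  shows "flow \<tau> z \<in> nonempty_graphs"
proof -
  obtain G :: "(nat, nat) multigraph" and l where G: "finite_multigraph G" "unit_lengths G l"
    and z: "z = metric_point G l"
    by (rule topspace_M_Gr_cases[OF z])
  let ?xs = "sorted_lengths (edges G) l"
  have "settle \<tau> ?xs j \<in> {0..1}" if "j < length ?xs" for j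
    using settle_bounds[OF \<tau>, of ?xs j] unit_sorted_lengths[OF G] nth_mem[OF that] by fastforce
  then have u: "unit_lengths (rose {..<length ?xs}) (settle \<tau> ?xs)" by simp
  have R: "finite_multigraph (rose {..<length ?xs})" by (rule finite_rose) simp
  have "verts (rose {..<length ?xs}) \<noteq> {}" by (simp add: rose_def)
  then show ?thesis
    unfolding z flow_metric_point[OF \<tau> G] rose_flow_def nonempty_graphs_def
    using metric_point_in_topspace[OF R u] zero_comps_metric_point[OF R u] num_comps_eq_0[OF R, of "{e \<in> edges (rose {..<length ?xs}). settle \<tau> ?xs e = 0}"]
    by simp
qed

section \<open>Maps between the circle and the space of graphs\<close>

definition circle_point :: "real \<Rightarrow> nat \<Rightarrow> real" where
  "circle_point x = (\<lambda>i. if i = 0 then cos (2 * pi * x) else if i = 1 then sin (2 * pi * x) else 0)"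

lemma circle_point_add_nat: "circle_point (x + real k) = circle_point x"
proof (induction k)
  case (Suc k)
  have "circle_point (x + real (Suc k)) = circle_point (x + real k)"
  proof -
    have "2 * pi * (x + real (Suc k)) = 2 * pi * (x + real k) + 2 * pi" by (simp add: algebra_simps)
    then show ?thesis unfolding circle_point_def by (simp only: cos_periodic sin_periodic)
  qed
  then show ?case using Suc by simp
qed simp

lemma circle_point_frac:
  assumes "0 \<le> x"
  shows "circle_point (frac x) = circle_point x"
proof -
  have "x = frac x + real (nat \<lfloor>x\<rfloor>)" using assms by (simp add: frac_def)
  then show ?thesis using circle_point_add_nat[of "frac x" "nat \<lfloor>x\<rfloor>"] by simp
qed

lemma topspace_circle: "topspace (nsphere 1) = {w. (\<Sum>i\<le>1. w i ^ 2) = 1 \<and> (\<forall>i>1. w i = 0)}"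
  unfolding nsphere by simp

lemma continuous_map_circle_point:
  assumes "continuous_map X euclideanreal f"
  shows "continuous_map X (nsphere 1) (\<lambda>x. circle_point (f x))"
  unfolding nsphere
proof (rule continuous_map_into_subtopology)
  have "continuous_map euclideanreal euclideanreal (\<lambda>x. cos (2 * pi * x))"
    "continuous_map euclideanreal euclideanreal (\<lambda>x. sin (2 * pi * x))"
    unfolding continuous_map_iff_continuous2 by (intro continuous_intros)+
  note cs = this[THEN continuous_map_compose[OF assms], unfolded o_def]
  show "continuous_map X (powertop_real UNIV) (\<lambda>x. circle_point (f x))"
    unfolding continuous_map_componentwise_UNIV circle_point_def
    using cs by (auto split: if_split)
  show "(\<lambda>x. circle_point (f x)) \<in> topspace X \<rightarrow> {x. (\<Sum>i\<le>1. (x i)\<^sup>2) = 1 \<and> (\<forall>i>1. x i = 0)}"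
    by (auto simp: circle_point_def)
qed

lemma circle_point_surj:
  assumes "w \<in> topspace (nsphere 1)"
  obtains x where "0 \<le> x" "x \<le> 1" "w = circle_point x"
proof -
  have w: "(w 0)\<^sup>2 + (w 1)\<^sup>2 = 1" "\<And>i. i > 1 \<Longrightarrow> w i = 0"
    using assms unfolding topspace_circle by auto
  obtain t where t: "0 \<le> t" "t < 2 * pi" "w 0 = cos t" "w 1 = sin t"
    by (rule sincos_total_2pi[OF w(1)])
  have "w = circle_point (t / (2 * pi))"
    using w(2) t(3,4) by (auto simp: circle_point_def fun_eq_iff)
  then show ?thesis using that[of "t / (2 * pi)"] t(1,2) by simp
qed

text \<open>The chosen parameter is ambiguous only at the base point, where it may be 0 or 1;
  \<open>loop\<close> agrees there, since a loop of length 0 or 1 disappears.\<close>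

definition circle_loop :: "(nat \<Rightarrow> real) \<Rightarrow> ((nat \<times> flag_class) \<times> (nat \<Rightarrow> real)) set" where
  "circle_loop w = loop (SOME x. 0 \<le> x \<and> x \<le> 1 \<and> circle_point x = w)"

lemma circle_loop_circle_point:
  assumes x: "0 \<le> x" "x \<le> 1"
  shows "circle_loop (circle_point x) = loop x"
proof -
  let ?P = "\<lambda>y. 0 \<le> y \<and> y \<le> 1 \<and> circle_point y = circle_point x"
  define y where "y = (SOME y. ?P y)"
  have "?P y" unfolding y_def by (rule someI[of ?P x]) (use x in simp)
  then have y: "0 \<le> y" "y \<le> 1" and eq: "circle_point y = circle_point x" by simp_all
  have "sin (2 * pi * y) = sin (2 * pi * x) \<and> cos (2 * pi * y) = cos (2 * pi * x)"
    using fun_cong[OF eq, of 0] fun_cong[OF eq, of 1] by (simp add: circle_point_def)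
  then obtain n :: int where "2 * pi * y = 2 * pi * x + 2 * pi * n"
    unfolding sin_cos_eq_iff by blast
  then have "2 * pi * y = 2 * pi * (x + n)" by (simp add: algebra_simps)
  then have n: "y = x + of_int n" by simp
  \<comment> \<open>Both parameters lie in [0, 1], so a nonzero integer difference forces them to be
    the two end points.\<close>
  then have "-1 \<le> n" "n \<le> 1" using x y by linarith+
  then consider "n = -1" | "n = 0" | "n = 1" by linarith
  then have "loop y = loop x"
  proof cases
    case 1
    then have "y = 0" "x = 1" using n x y by simp_all
    then show ?thesis by (simp add: loop_1)
  next
    case 3
    then have "y = 1" "x = 0" using n x y by simp_all
    then show ?thesis by (simp add: loop_1)
  qed (use n in simp)
  then show ?thesis unfolding circle_loop_def y_def .
qed

text \<open>A continuous surjection from a compact space onto a Hausdorff one is closed, hence a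
  quotient map. So the circle is a quotient of the interval, and it is enough that
  \<open>loop\<close> is continuous there.\<close>

lemma continuous_map_circle_loop: "continuous_map (nsphere 1) M_Gr circle_loop"
proof -
  let ?I = "top_of_set {0..1 :: real}"
  have id: "continuous_map ?I euclideanreal (\<lambda>x. x)"
    by (rule continuous_map_from_subtopology[OF continuous_map_id[unfolded id_def]])
  have cp: "continuous_map ?I (nsphere 1) circle_point"
    using continuous_map_circle_point[OF id] by simp
  have "compact_space ?I" by (simp add: compact_space_subtopology)
  moreover have "kc_space (nsphere 1)"
    unfolding nsphere_def
    by (intro kc_space_subtopology Hausdorff_imp_kc_space Hausdorff_Euclidean_space)
  ultimately have "closed_map ?I (nsphere 1) circle_point"
    using cp by (rule continuous_imp_closed_map_gen)
  moreover have "circle_point ` topspace ?I = topspace (nsphere 1)"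
  proof (intro equalityI subsetI)
    show "w \<in> topspace (nsphere 1)" if "w \<in> circle_point ` topspace ?I" for w
      using that continuous_map_image_subset_topspace[OF cp] by blast
    show "w \<in> circle_point ` topspace ?I" if "w \<in> topspace (nsphere 1)" for w
      by (rule circle_point_surj[OF that]) auto
  qed
  ultimately have Q: "quotient_map ?I (nsphere 1) circle_point"
    by (rule continuous_closed_imp_quotient_map[OF cp])
  have "continuous_map ?I M_Gr loop"
    unfolding loop_def
    by (rule continuous_map_metric_point[OF finite_rose]) (use id in auto)
  then have "continuous_map ?I M_Gr (circle_loop \<circ> circle_point)"
    by (rule continuous_map_eq) (simp add: circle_loop_circle_point)
  then show ?thesis
    by (simp only: continuous_compose_quotient_map_eq[OF Q])
qed

text \<open>The total length modulo 1. Contracted edges contribute 0 and deleted ones an integer, so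
  this descends to points. Up to sign it is the mean of the gap measure modulo integers.\<close>

definition total_angle :: "((nat \<times> flag_class) \<times> (nat \<Rightarrow> real)) set \<Rightarrow> nat \<Rightarrow> real" where
  "total_angle = (SOME h. \<forall>G :: (nat, nat) multigraph. \<forall>l. finite_multigraph G \<longrightarrow> unit_lengths G l \<longrightarrow>
     h (metric_point G l) = circle_point (sum l (edges G)))"

lemma sum_multigraph_iso:
  assumes "multigraph_iso f g G H" "\<And>e. e \<in> edges G \<Longrightarrow> m (g e) = l e"
  shows "sum l (edges G) = sum m (edges H)"
proof -
  have "bij_betw g (edges G) (edges H)" using assms(1) by (simp add: multigraph_iso_def)
  from sum.reindex_bij_betw[OF this, of m] show ?thesis using assms(2) by (simp cong: sum.cong)
qed

lemma total_angle_nat_metric_point: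
  fixes G :: "(nat, nat) multigraph"
  assumes G: "finite_multigraph G" "unit_lengths G l"
  shows "total_angle (metric_point G l) = circle_point (sum l (edges G))"
proof -
  obtain h where h: "\<And>G :: (nat, nat) multigraph. \<And>l. finite_multigraph G \<Longrightarrow> unit_lengths G l \<Longrightarrow>
     h (metric_point G l) = circle_point (sum l (edges G))"
  proof (rule metric_point_descent[where F = "\<lambda>G l. circle_point (sum l (edges G))"
      and F' = "\<lambda>G l. circle_point (sum l (edges G))"])
    show "circle_point (sum l (edges G)) = circle_point (sum m (edges H))"
      if "multigraph_iso f g G H" "\<And>e. e \<in> edges G \<Longrightarrow> m (g e) = l e"
      for G H :: "(nat, nat) multigraph" and f g l m
      using sum_multigraph_iso[where m = m and l = l, OF that] by simp
    show "circle_point (sum l (edges G)) = circle_point (sum m (edges H))"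
      if "multigraph_iso f g G H" "\<And>e. e \<in> edges G \<Longrightarrow> m (g e) = l e"
      for G :: "(nat set, nat) multigraph" and H :: "(nat, nat) multigraph" and f g l m
      using sum_multigraph_iso[where m = m and l = l, OF that] by simp
    fix G :: "(nat, nat) multigraph" and l :: "nat \<Rightarrow> real" and S :: "nat set"
    assume G: "finite_multigraph G" and S: "S \<subseteq> edges G"
    have E: "finite (edges G)" using G by (simp add: finite_multigraph_def)
    have split: "sum l (edges G) = sum l (edges G - S) + sum l S"
      by (rule sum.subset_diff[OF S E])
    show "circle_point (sum l (edges (restrict_edges G (edges G - S)))) = circle_point (sum l (edges G))"
      if "\<And>e. e \<in> S \<Longrightarrow> l e = 1"
      using circle_point_add_nat[of "sum l (edges G - S)" "card S"] that split
      by (simp add: restrict_edges_def)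
    show "circle_point (sum l (edges (contract_edges G S))) = circle_point (sum l (edges G))"
      if "\<And>e. e \<in> S \<Longrightarrow> l e = 0"
      using that split by (simp add: contract_edges_def)
  qed blast
  then have "\<exists>h. \<forall>G :: (nat, nat) multigraph. \<forall>l. finite_multigraph G \<longrightarrow> unit_lengths G l \<longrightarrow>
     h (metric_point G l) = circle_point (sum l (edges G))" by blast
  from someI_ex[OF this, folded total_angle_def] show ?thesis
    using G by blast
qed

lemma total_angle_metric_point:
  assumes G: "finite_multigraph G" "unit_lengths G l"
  shows "total_angle (metric_point G l) = circle_point (sum l (edges G))"
proof -
  obtain H :: "(nat, nat) multigraph" and f g m where H: "multigraph_iso f g G H" "finite_multigraph H"
    "unit_lengths H m" "\<And>e. e \<in> edges G \<Longrightarrow> m (g e) = l e" "metric_point G l = metric_point H m"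
    by (rule metric_point_nat_copy[OF G]) (rule that; assumption)
  show ?thesis
    unfolding H(5) total_angle_nat_metric_point[OF H(2,3)]
    using sum_multigraph_iso[where m = m and l = l, OF H(1,4)] by simp
qed

lemma continuous_map_total_angle: "continuous_map M_Gr (nsphere 1) total_angle"
proof -
  let ?T = "topspace M_Gr"
  \<comment> \<open>The criterion for continuity on the realization is stated for homotopies; it is
    applied to a constant one, which is restricted to time 0 at the end.\<close>
  have "continuous_map (prod_topology (top_of_set {0..1}) (subtopology M_Gr (?T \<inter> ?T))) (nsphere 1)
     (\<lambda>w :: real \<times> _. total_angle (snd w))"
  proof (rule continuous_map_homotopy_M_Gr[OF openin_topspace closedin_topspace])
    fix G :: "(nat, nat) multigraph" assume G: "finite_multigraph G"
    let ?X = "subtopology length_homotopy_space {(s, l). unit_lengths G l \<and> metric_point G l \<in> ?T \<inter> ?T}"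
    have E: "finite (edges G)" using G by (simp add: finite_multigraph_def)
    have "continuous_map ?X (nsphere 1) (\<lambda>x. circle_point (sum (snd x) (edges G)))"
      by (intro continuous_map_circle_point continuous_map_sum E continuous_map_length_homotopy_space(2))
    then show "continuous_map ?X (nsphere 1) (\<lambda>(s, l). total_angle (snd (s, metric_point G l)))"
      by (rule continuous_map_eq) (auto simp: total_angle_metric_point[OF G])
  qed
  then have 1: "continuous_map (prod_topology (top_of_set {0..1}) M_Gr) (nsphere 1) (\<lambda>w :: real \<times> _. total_angle (snd w))"
    by simp
  have 2: "continuous_map M_Gr (prod_topology (top_of_set {0..1 :: real}) M_Gr) (\<lambda>z. (0, z))"
    by (simp add: continuous_map_pairwise o_def)
  show ?thesis
    using continuous_map_compose[OF 2 1] by (simp add: o_def)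
qed

lemma flow_1:
  assumes "z \<in> topspace M_Gr"
  shows "flow 1 z = circle_loop (total_angle z)"
proof -
  obtain G :: "(nat, nat) multigraph" and l where G: "finite_multigraph G" "unit_lengths G l"
    and z: "z = metric_point G l"
    by (rule topspace_M_Gr_cases[OF assms])
  have E: "finite (edges G)" using G(1) by (simp add: finite_multigraph_def)
  let ?s = "sum l (edges G)"
  have "0 \<le> ?s" using G(2) by (intro sum_nonneg) blast
  then have "circle_loop (total_angle z) = loop (frac ?s)"
    using circle_loop_circle_point[of "frac ?s"] circle_point_frac[of ?s] frac_lt_1[of ?s]
    unfolding z total_angle_metric_point[OF G] by simp
  moreover have "flow 1 z = loop (frac ?s)"
    unfolding z flow_metric_point[OF zero_le_one order_refl G] rose_flow_1[OF unit_sorted_lengths[OF G]]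
      sorted_lengths_facts(2)[OF E] ..
  ultimately show ?thesis by simp
qed

lemma total_angle_circle_loop:
  assumes "w \<in> topspace (nsphere 1)"
  shows "total_angle (circle_loop w) = w"
proof -
  obtain x where x: "0 \<le> x" "x \<le> 1" "w = circle_point x"
    by (rule circle_point_surj[OF assms])
  have "finite_multigraph (rose {()})" by (rule finite_rose) simp
  from total_angle_metric_point[OF this, of "\<lambda>_. x"] show ?thesis
    unfolding x(3) circle_loop_circle_point[OF x(1,2)] loop_def using x(1,2) by simp
qed

lemma circle_loop_in_nonempty_graphs:
  assumes "w \<in> topspace (nsphere 1)"
  shows "circle_loop w \<in> nonempty_graphs"
proof -
  have z: "circle_loop w \<in> topspace M_Gr"
    using continuous_map_image_subset_topspace[OF continuous_map_circle_loop] assms by blast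
  \<comment> \<open>A fixed point of \<open>flow 1\<close>, all of whose values are nonempty
    graphs.\<close>
  have "flow 1 (circle_loop w) = circle_loop w"
    unfolding flow_1[OF z] total_angle_circle_loop[OF assms] ..
  then show ?thesis
    using flow_in_nonempty_graphs[OF zero_le_one order_refl z] by simp
qed

section \<open>Rational homology from integral homology\<close>

text \<open>The free abelian group of rank \<open>k\<close>, with tuples encoded as in
  \<open>rat_power\<close>, so that integer tuples become rational ones by coercing the
  entries.\<close>

definition int_power :: "nat \<Rightarrow> (nat \<Rightarrow> int) monoid" where
  "int_power k = \<lparr>carrier = {v. \<forall>i\<ge>k. v i = 0}, monoid.mult = (\<lambda>v w i. v i + w i), one = (\<lambda>_. 0)\<rparr>"

definition rat_of_chain :: "('i \<Rightarrow>\<^sub>0 int) \<Rightarrow> ('i \<Rightarrow>\<^sub>0 rat)" where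
  "rat_of_chain = Poly_Mapping.map rat_of_int"

lemma lookup_rat_of_chain [simp]:
  "Poly_Mapping.lookup (rat_of_chain c) f = rat_of_int (Poly_Mapping.lookup c f)"
  by (simp add: rat_of_chain_def Poly_Mapping.map.rep_eq when_def)

definition rat_scale :: "rat \<Rightarrow> ('i \<Rightarrow>\<^sub>0 rat) \<Rightarrow> ('i \<Rightarrow>\<^sub>0 rat)" where
  "rat_scale a = Poly_Mapping.map ((*) a)"

lemma lookup_rat_scale [simp]: "Poly_Mapping.lookup (rat_scale a c) f = a * Poly_Mapping.lookup c f"
  by (simp add: rat_scale_def Poly_Mapping.map.rep_eq when_def)

lemma rat_chain_eqI: "(\<And>f. Poly_Mapping.lookup c f = Poly_Mapping.lookup d f) \<Longrightarrow> c = d"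
  by (rule poly_mapping_eqI)

lemma keys_rat_of_chain [simp]: "Poly_Mapping.keys (rat_of_chain c) = Poly_Mapping.keys c"
  by (auto simp: in_keys_iff)

lemma keys_rat_scale [simp]: "a \<noteq> 0 \<Longrightarrow> Poly_Mapping.keys (rat_scale a c) = Poly_Mapping.keys c"
  by (auto simp: in_keys_iff)

lemma rat_of_chain_inject: "rat_of_chain c = rat_of_chain d \<longleftrightarrow> c = d"
proof
  assume "rat_of_chain c = rat_of_chain d"
  then have "Poly_Mapping.lookup (rat_of_chain c) f = Poly_Mapping.lookup (rat_of_chain d) f" for f
    by simp
  then show "c = d" by (intro poly_mapping_eqI) simp
qed simp

lemma rat_of_chain_add: "rat_of_chain (c + d) = rat_of_chain c + rat_of_chain d"
  by (rule rat_chain_eqI) (simp add: lookup_add)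

lemma rat_of_chain_cmul: "rat_of_chain (frag_cmul k c) = rat_scale (rat_of_int k) (rat_of_chain c)"
  by (rule rat_chain_eqI) simp

lemma rat_scale_add: "rat_scale a (c + d) = rat_scale a c + rat_scale a d"
  by (rule rat_chain_eqI) (simp add: lookup_add algebra_simps)

lemma rat_scale_scale: "rat_scale a (rat_scale b c) = rat_scale (a * b) c"
  by (rule rat_chain_eqI) (simp add: mult.assoc)

lemma rat_scale_1 [simp]: "rat_scale 1 c = c"
  by (rule rat_chain_eqI) simp

text \<open>The sum runs over any finite set containing the support, so that boundaries of chains
  with different supports can be compared term by term.\<close>

lemma lookup_rat_chain_boundary:
  assumes "finite A" "Poly_Mapping.keys c \<subseteq> A"
  shows "Poly_Mapping.lookup (rat_chain_boundary n c) h =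
     (if n = 0 then 0 else \<Sum>f\<in>A. \<Sum>k\<le>n. if singular_face n k f = h then (-1) ^ k * Poly_Mapping.lookup c f else 0)"
proof (cases "n = 0")
  case False
  have "Poly_Mapping.lookup (rat_chain_boundary n c) h =
    (\<Sum>f\<in>Poly_Mapping.keys c. \<Sum>k\<le>n. if singular_face n k f = h then (-1) ^ k * Poly_Mapping.lookup c f else 0)"
    using False by (simp add: rat_chain_boundary_def lookup_sum lookup_single when_def)
  also have "\<dots> = (\<Sum>f\<in>A. \<Sum>k\<le>n. if singular_face n k f = h then (-1) ^ k * Poly_Mapping.lookup c f else 0)"
  proof (rule sum.mono_neutral_left[OF assms], rule ballI)
    fix f assume "f \<in> A - Poly_Mapping.keys c"
    then have "Poly_Mapping.lookup c f = 0" by (simp add: in_keys_iff)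
    then show "(\<Sum>k\<le>n. if singular_face n k f = h then (-1) ^ k * Poly_Mapping.lookup c f else 0) = 0"
      by (simp cong: if_cong)
  qed
  finally show ?thesis using False by simp
qed (simp add: rat_chain_boundary_def)

lemma rat_chain_boundary_add:
  "rat_chain_boundary n (c + d) = rat_chain_boundary n c + rat_chain_boundary n d"
proof (rule rat_chain_eqI)
  fix h
  let ?A = "Poly_Mapping.keys c \<union> Poly_Mapping.keys d"
  have "Poly_Mapping.keys (c + d) \<subseteq> ?A" by (rule keys_add)
  then show "Poly_Mapping.lookup (rat_chain_boundary n (c + d)) h
    = Poly_Mapping.lookup (rat_chain_boundary n c + rat_chain_boundary n d) h"
    unfolding lookup_add
    by (subst (1 2 3) lookup_rat_chain_boundary[of ?A])
      (auto simp: lookup_add sum.distrib[symmetric] algebra_simps intro!: sum.cong)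
qed

lemma rat_chain_boundary_scale:
  "rat_chain_boundary n (rat_scale a c) = rat_scale a (rat_chain_boundary n c)"
proof (rule rat_chain_eqI)
  fix h
  have "Poly_Mapping.keys (rat_scale a c) \<subseteq> Poly_Mapping.keys c"
    by (auto simp: in_keys_iff)
  then show "Poly_Mapping.lookup (rat_chain_boundary n (rat_scale a c)) h
    = Poly_Mapping.lookup (rat_scale a (rat_chain_boundary n c)) h"
    unfolding lookup_rat_scale
    by (subst (1 2) lookup_rat_chain_boundary[of "Poly_Mapping.keys c"])
      (auto simp: sum_distrib_left intro!: sum.cong)
qed

lemma rat_chain_boundary_of_chain:
  "rat_chain_boundary n (rat_of_chain c) = rat_of_chain (chain_boundary n c)"
proof (rule rat_chain_eqI)
  fix h
  show "Poly_Mapping.lookup (rat_chain_boundary n (rat_of_chain c)) h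
    = Poly_Mapping.lookup (rat_of_chain (chain_boundary n c)) h"
  proof (cases "n = 0")
    case False
    have "Poly_Mapping.lookup (chain_boundary n c) h =
      (\<Sum>f\<in>Poly_Mapping.keys c. \<Sum>k\<le>n. if singular_face n k f = h then (-1) ^ k * Poly_Mapping.lookup c f else 0)"
      using False
      by (simp add: chain_boundary_def frag_extend_def lookup_sum sum_distrib_left when_def lookup_single)
        (auto intro!: sum.cong)
    then have "Poly_Mapping.lookup (rat_of_chain (chain_boundary n c)) h =
      (\<Sum>f\<in>Poly_Mapping.keys c. \<Sum>k\<le>n. if singular_face n k f = h then (-1) ^ k * rat_of_int (Poly_Mapping.lookup c f) else 0)"
      by (simp add: of_int_sum if_distrib[of rat_of_int] cong: if_cong)
    then show ?thesis
      using False lookup_rat_chain_boundary[of "Poly_Mapping.keys c" "rat_of_chain c" n h]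
      by (simp cong: if_cong)
  qed (simp add: rat_chain_boundary_def chain_boundary_def)
qed

text \<open>\<open>N\<close> is the product of the denominators of the finitely many nonzero
  coefficients.\<close>

lemma ex_int_multiple:
  fixes c :: "'i \<Rightarrow>\<^sub>0 rat"
  obtains N :: int and d :: "'i \<Rightarrow>\<^sub>0 int" where "N > 0" "rat_of_chain d = rat_scale (rat_of_int N) c"
proof -
  let ?den = "\<lambda>f. snd (quotient_of (Poly_Mapping.lookup c f))"
  define N where "N = (\<Prod>f\<in>Poly_Mapping.keys c. ?den f)"
  have N: "N > 0" unfolding N_def by (intro prod_pos) (simp add: quotient_of_denom_pos')
  have "\<exists>m. rat_of_int m = rat_of_int N * Poly_Mapping.lookup c f" for f
  proof (cases "f \<in> Poly_Mapping.keys c")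
    case True
    then have "?den f dvd N" unfolding N_def by (intro dvd_prodI) simp_all
    then obtain q where q: "N = ?den f * q" by (elim dvdE)
    have "Poly_Mapping.lookup c f = rat_of_int (fst (quotient_of (Poly_Mapping.lookup c f))) / rat_of_int (?den f)"
      by (simp add: quotient_of_div prod.collapse)
    moreover have "?den f \<noteq> 0" using quotient_of_denom_pos'[of "Poly_Mapping.lookup c f"]
      by simp
    ultimately have "rat_of_int N * Poly_Mapping.lookup c f = rat_of_int (q * fst (quotient_of (Poly_Mapping.lookup c f)))"
      using q by (simp add: field_simps)
    then show ?thesis by metis
  qed (auto simp: in_keys_iff intro: exI[of _ 0])
  then obtain m where m: "\<And>f. rat_of_int (m f) = rat_of_int N * Poly_Mapping.lookup c f"
    by metis
  have "{f. m f \<noteq> 0} \<subseteq> Poly_Mapping.keys c"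
  proof
    fix f assume "f \<in> {f. m f \<noteq> 0}"
    then have "rat_of_int (m f) \<noteq> 0" by simp
    then have "Poly_Mapping.lookup c f \<noteq> 0" unfolding m[of f] by (rule contrapos_nn) simp
    then show "f \<in> Poly_Mapping.keys c" by (simp add: in_keys_iff)
  qed
  then have "finite {f. m f \<noteq> 0}" by (rule finite_subset) simp
  then have "Poly_Mapping.lookup (Abs_poly_mapping m) = m" by simp
  then have "rat_of_chain (Abs_poly_mapping m) = rat_scale (rat_of_int N) c"
    by (intro rat_chain_eqI) (simp add: m)
  then show ?thesis using that N by blast
qed

lemma chain_boundary_cmul: "chain_boundary n (frag_cmul k c) = frag_cmul k (chain_boundary n c)"
  by (simp add: chain_boundary_def frag_extend_cmul)

lemma rat_power_group: "group (add_monoid (rat_power k))"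
proof (rule groupI)
  let ?V = "add_monoid (rat_power k)"
  fix v assume "v \<in> carrier ?V"
  then show "\<exists>w\<in>carrier ?V. w \<otimes>\<^bsub>?V\<^esub> v = \<one>\<^bsub>?V\<^esub>"
    by (intro bexI[of _ "\<lambda>i. - v i"]) (simp_all add: rat_power_def)
qed (simp_all add: rat_power_def fun_eq_iff add.assoc)

lemma rat_of_chain_0 [simp]: "rat_of_chain 0 = 0"
  by (rule rat_chain_eqI) simp

lemma rat_scale_0_right [simp]: "rat_scale a 0 = 0"
  by (rule rat_chain_eqI) simp

lemma rat_scale_eq_0: "a \<noteq> 0 \<Longrightarrow> rat_scale a c = 0 \<longleftrightarrow> c = 0"
  using rat_scale_scale[of "1 / a" a c] by auto

lemma rat_cycle_iff:
  assumes N: "N > 0" and d: "rat_of_chain d = rat_scale (rat_of_int N) c"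
  shows "c \<in> carrier (rat_cycle_module n X) \<longleftrightarrow> singular_relcycle n X {} d"
proof -
  have "Poly_Mapping.keys c = Poly_Mapping.keys d"
    using keys_rat_of_chain[of d] N unfolding d by simp
  moreover have "rat_chain_boundary n c = 0 \<longleftrightarrow> chain_boundary n d = 0"
  proof -
    have "rat_of_chain (chain_boundary n d) = rat_scale (rat_of_int N) (rat_chain_boundary n c)"
      using rat_chain_boundary_of_chain[of n d] unfolding d rat_chain_boundary_scale by simp
    then show ?thesis
      using N rat_scale_eq_0[of "rat_of_int N" "rat_chain_boundary n c"] rat_of_chain_inject[of "chain_boundary n d" 0]
      by simp
  qed
  ultimately show ?thesis
    by (simp add: rat_cycle_module_def rat_chain_set_def singular_cycle singular_chain_def)
qed

lemma rat_cycle_add_group: "group (add_monoid (rat_cycle_module n X))"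
proof (rule groupI)
  let ?Z = "add_monoid (rat_cycle_module n X)"
  have keys: "Poly_Mapping.keys (c + d) \<subseteq> singular_simplex_set n X"
    if "Poly_Mapping.keys c \<subseteq> singular_simplex_set n X" "Poly_Mapping.keys d \<subseteq> singular_simplex_set n X"
    for c d :: "'a rat_chain"
    using keys_add[of c d] that by blast
  fix x assume x: "x \<in> carrier ?Z"
  show "x \<otimes>\<^bsub>?Z\<^esub> y \<in> carrier ?Z" if "y \<in> carrier ?Z" for y
    using x that keys[of x y] by (simp add: rat_cycle_module_def rat_chain_set_def rat_chain_boundary_add)
  have "rat_scale (-1) x \<in> carrier ?Z"
    using x by (simp add: rat_cycle_module_def rat_chain_set_def rat_chain_boundary_scale)
  moreover have "rat_scale (-1) x + x = 0"
    by (rule rat_chain_eqI) (simp add: lookup_add)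
  ultimately show "\<exists>y\<in>carrier ?Z. y \<otimes>\<^bsub>?Z\<^esub> x = \<one>\<^bsub>?Z\<^esub>"
    by (intro bexI[of _ "rat_scale (-1) x"]) (simp_all add: rat_cycle_module_def)
qed (auto simp: rat_cycle_module_def rat_chain_set_def rat_chain_boundary_def add.assoc)

text \<open>If \<open>N c\<close> is an integral chain for a rational cycle \<open>c\<close>, the
  class of \<open>N c\<close> is sent by \<open>h\<close> to an integer tuple, which is divided by
  \<open>N\<close> again. Cross multiplication shows that the result does not depend on
  \<open>N\<close>. Its kernel is the set of rational boundaries: by injectivity of \<open>h\<close>
  an integral cycle with zero tuple bounds integrally, and that bounding chain can be divided by
  \<open>N\<close>. The first isomorphism theorem gives the bijection.\<close>

theorem module_isomorphic_rat_homology: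
  assumes h: "h \<in> iso (homology_group (int n) X) (int_power k)"
  shows "module_isomorphic rat_ring (rat_homology n X) (rat_power k)"
proof -
  let ?C = "relcycle_group n X {}" and ?B = "singular_relboundary_set n X {}"
  let ?Z = "add_monoid (rat_cycle_module n X)" and ?V = "add_monoid (rat_power k)"
  define \<psi> where "\<psi> d = h (homologous_rel_set n X {} d)" for d
  have cls: "homologous_rel_set n X {} d \<in> carrier (homology_group (int n) X)"
    if "singular_relcycle n X {} d" for d
    using that by (auto simp: carrier_relative_homology_group)
  have "(\<lambda>a. ?B #>\<^bsub>?C\<^esub> a) \<in> hom ?C (homology_group (int n) X)"
    unfolding nontrivial_relative_homology_group
    by (rule normal.r_coset_hom_Mod[OF normal_subgroup_singular_relboundary_relcycle])
  then have clsm: "homologous_rel_set n X {} (a + b)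
      = homologous_rel_set n X {} a \<otimes>\<^bsub>homology_group (int n) X\<^esub> homologous_rel_set n X {} b"
    if "singular_relcycle n X {} a" "singular_relcycle n X {} b" for a b
    using that unfolding right_coset_singular_relboundary hom_def by simp
  have hh: "h \<in> hom (homology_group (int n) X) (int_power k)"
    and bij: "bij_betw h (carrier (homology_group (int n) X)) (carrier (int_power k))"
    using h by (auto simp: iso_def)
  have add: "\<psi> (a + b) = (\<lambda>i. \<psi> a i + \<psi> b i)"
    if "singular_relcycle n X {} a" "singular_relcycle n X {} b" for a b
    using hh clsm[OF that] cls[OF that(1)] cls[OF that(2)]
      by (simp add: \<psi>_def hom_def int_power_def)
  have range: "\<psi> d i = 0" if "singular_relcycle n X {} d" "k \<le> i" for d i
    using bij_betw_apply[OF bij cls[OF that(1)]] that(2) by (simp add: \<psi>_def int_power_def)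
  have surj: "\<exists>d. singular_relcycle n X {} d \<and> \<psi> d = v"
    if "\<And>i. k \<le> i \<Longrightarrow> v i = 0" for v
  proof -
    have "v \<in> h ` carrier (homology_group (int n) X)"
      unfolding bij_betw_imp_surj_on[OF bij] using that by (simp add: int_power_def)
    then obtain d where "singular_relcycle n X {} d" "v = h (homologous_rel_set n X {} d)"
      unfolding carrier_relative_homology_group by blast
    then show ?thesis unfolding \<psi>_def by (intro exI[of _ d]) simp
  qed
  have zero: "\<psi> 0 = (\<lambda>_. 0)"
    using add[of 0 0] by (simp add: fun_eq_iff)
  have ker: "\<psi> d = (\<lambda>_. 0) \<longleftrightarrow> singular_relboundary n X {} d"
    if d: "singular_relcycle n X {} d" for d
  proof -
    have "\<psi> d = \<psi> 0 \<longleftrightarrow> homologous_rel_set n X {} d = homologous_rel_set n X {} 0"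
      unfolding \<psi>_def
      by (rule inj_on_eq_iff[OF bij_betw_imp_inj_on[OF bij] cls[OF d] cls]) simp
    also have "homologous_rel_set n X {} 0 = singular_relboundary_set n X {}"
      using homologous_rel_set_eq_relboundary[of n X "{}" 0] by simp
    finally show ?thesis unfolding zero homologous_rel_set_eq_relboundary .
  qed
  have cyc: "singular_relcycle n X {} (frag_cmul m d)" if "singular_relcycle n X {} d" for m d
    using that by (simp add: singular_cycle singular_chain_cmul chain_boundary_cmul)
  have mult_nat: "\<psi> (frag_cmul (int m) d) = (\<lambda>i. int m * \<psi> d i)"
    if d: "singular_relcycle n X {} d" for m d
  proof (induction m)
    case (Suc m)
    have "frag_cmul (int (Suc m)) d = d + frag_cmul (int m) d"
      by (simp add: frag_cmul_distrib)
    then show ?case using add[OF d cyc[OF d, of "int m"]] Suc by (simp add: algebra_simps)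
  qed (simp add: zero)
  have mult: "\<psi> (frag_cmul m d) = (\<lambda>i. m * \<psi> d i)"
    if d: "singular_relcycle n X {} d" for m d
  proof (cases "0 \<le> m")
    case True
    then show ?thesis using mult_nat[OF d, of "nat m"] by simp
  next
    case False
    have "frag_cmul m d + frag_cmul (- m) d = 0"
      by (simp add: frag_cmul_distrib[symmetric])
    then have "(\<lambda>i. \<psi> (frag_cmul m d) i + \<psi> (frag_cmul (- m) d) i) = (\<lambda>_. 0)"
      using add[OF cyc[OF d] cyc[OF d], of m "- m"] zero by simp
    then show ?thesis
      using mult_nat[OF d, of "nat (- m)"] False by (simp add: fun_eq_iff)
  qed
  define Q where "Q c P \<longleftrightarrow> fst P > 0 \<and> rat_of_chain (snd P) = rat_scale (rat_of_int (fst P)) c"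
    for c :: "'a rat_chain" and P
  define \<Phi> where "\<Phi> c = (\<lambda>i. rat_of_int (\<psi> (snd (SOME P. Q c P)) i) / rat_of_int (fst (SOME P. Q c P)))" for c
  have Phi: "\<Phi> c = (\<lambda>i. rat_of_int (\<psi> d i) / rat_of_int N)"
    if c: "c \<in> carrier (rat_cycle_module n X)" and N: "N > 0" and d: "rat_of_chain d = rat_scale (rat_of_int N) c"
    for c N d
  proof -
    have "Q c (N, d)" using N d by (simp add: Q_def)
    then have Q: "Q c (SOME P. Q c P)" by (rule someI)
    obtain N' d' where P: "(SOME P. Q c P) = (N', d')" by (cases "SOME P. Q c P")
    have N': "N' > 0" and d': "rat_of_chain d' = rat_scale (rat_of_int N') c"
      using Q unfolding P by (simp_all add: Q_def)
    \<comment> \<open>Both sides are \<open>N * N'\<close> times \<open>c\<close>; injectivity of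
      the embedding of integral chains turns this into an identity of integral cycles, to which
      \<open>\<psi>\<close> applies.\<close>
    have "rat_of_chain (frag_cmul N' d) = rat_of_chain (frag_cmul N d')"
      unfolding rat_of_chain_cmul d d' rat_scale_scale by (simp add: mult.commute)
    then have eq: "frag_cmul N' d = frag_cmul N d'" by (simp only: rat_of_chain_inject)
    have "singular_relcycle n X {} d" "singular_relcycle n X {} d'"
      using rat_cycle_iff[OF N d] rat_cycle_iff[OF N' d'] c by blast+
    then have "N' * \<psi> d i = N * \<psi> d' i" for i
      using mult[of d N'] mult[of d' N] eq by (metis (no_types))
    then have "rat_of_int N' * rat_of_int (\<psi> d i) = rat_of_int N * rat_of_int (\<psi> d' i)"
      for i
      by (metis of_int_mult)
    then show ?thesis
      unfolding \<Phi>_def P using N N' by (simp add: fun_eq_iff frac_eq_eq mult.commute)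
  qed
  have Phi_add: "\<Phi> (a + b) = (\<lambda>i. \<Phi> a i + \<Phi> b i)"
    if a: "a \<in> carrier (rat_cycle_module n X)" and b: "b \<in> carrier (rat_cycle_module n X)"
      and ab: "a + b \<in> carrier (rat_cycle_module n X)" for a b
  proof -
    obtain N d where N: "N > 0" and d: "rat_of_chain d = rat_scale (rat_of_int N) a"
      by (rule ex_int_multiple)
    obtain M e where M: "M > 0" and e: "rat_of_chain e = rat_scale (rat_of_int M) b"
      by (rule ex_int_multiple)
    have dc: "singular_relcycle n X {} d" and ec: "singular_relcycle n X {} e"
      using rat_cycle_iff[OF N d] rat_cycle_iff[OF M e] a b by blast+
    have "rat_of_chain (frag_cmul M d + frag_cmul N e) = rat_scale (rat_of_int (M * N)) (a + b)"
      unfolding rat_of_chain_add rat_of_chain_cmul d e rat_scale_scale rat_scale_add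
        by (simp add: mult.commute)
    from Phi[OF ab _ this] have "\<Phi> (a + b) = (\<lambda>i. rat_of_int (M * \<psi> d i + N * \<psi> e i) / rat_of_int (M * N))"
      using N M add[OF cyc[OF dc] cyc[OF ec]] mult[OF dc] mult[OF ec] by simp
    then show ?thesis
      unfolding Phi[OF a N d] Phi[OF b M e] using N M by (simp add: fun_eq_iff field_simps)
  qed
  have Phi_scale: "\<Phi> (rat_scale a c) = (\<lambda>i. a * \<Phi> c i)"
    if c: "c \<in> carrier (rat_cycle_module n X)" and ac: "rat_scale a c \<in> carrier (rat_cycle_module n X)" for a c
  proof -
    obtain N d where N: "N > 0" and d: "rat_of_chain d = rat_scale (rat_of_int N) c"
      by (rule ex_int_multiple)
    have dc: "singular_relcycle n X {} d" using rat_cycle_iff[OF N d] c by blast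
    obtain r s where rs: "quotient_of a = (r, s)" by (cases "quotient_of a")
    have s: "s > 0" and a: "a = rat_of_int r / rat_of_int s"
      using quotient_of_denom_pos[OF rs] quotient_of_div[OF rs] by simp_all
    have "rat_of_chain (frag_cmul r d) = rat_scale (rat_of_int (s * N)) (rat_scale a c)"
      unfolding rat_of_chain_cmul d rat_scale_scale using s a by (simp add: mult.commute)
    from Phi[OF ac _ this] have eq: "\<Phi> (rat_scale a c) = (\<lambda>i. rat_of_int (r * \<psi> d i) / rat_of_int (s * N))"
      using N s mult[OF dc] by simp
    show ?thesis
      unfolding eq Phi[OF c N d] unfolding a using N s by (simp add: fun_eq_iff field_simps)
  qed
  have Phi_ker: "c \<in> carrier (rat_cycle_module n X) \<and> \<Phi> c = (\<lambda>_. 0) \<longleftrightarrow> c \<in> rat_boundary_set n X" for c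
  proof
    assume "c \<in> carrier (rat_cycle_module n X) \<and> \<Phi> c = (\<lambda>_. 0)"
    then have c: "c \<in> carrier (rat_cycle_module n X)" and 0: "\<Phi> c = (\<lambda>_. 0)"
      by simp_all
    obtain N d where N: "N > 0" and d: "rat_of_chain d = rat_scale (rat_of_int N) c"
      by (rule ex_int_multiple)
    have dc: "singular_relcycle n X {} d" using rat_cycle_iff[OF N d] c by blast
    have "\<psi> d = (\<lambda>_. 0)" using 0 N unfolding Phi[OF c N d] by (simp add: fun_eq_iff)
    then obtain e where e: "singular_chain (Suc n) X e" "chain_boundary (Suc n) e = d"
      using ker[OF dc] singular_boundary by metis
    let ?b = "rat_scale (1 / rat_of_int N) (rat_of_chain e)"
    have "?b \<in> rat_chain_set (Suc n) X"
      using e(1) N by (simp add: rat_chain_set_def singular_chain_def)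
    moreover have "rat_chain_boundary (Suc n) ?b = c"
      unfolding rat_chain_boundary_scale rat_chain_boundary_of_chain e(2) d rat_scale_scale using N
        by simp
    ultimately show "c \<in> rat_boundary_set n X" unfolding rat_boundary_set_def by blast
  next
    assume "c \<in> rat_boundary_set n X"
    then obtain b where b: "b \<in> rat_chain_set (Suc n) X" "c = rat_chain_boundary (Suc n) b"
      unfolding rat_boundary_set_def by blast
    obtain N e where N: "N > 0" and e: "rat_of_chain e = rat_scale (rat_of_int N) b"
      by (rule ex_int_multiple)
    have d: "rat_of_chain (chain_boundary (Suc n) e) = rat_scale (rat_of_int N) c"
      unfolding rat_chain_boundary_of_chain[symmetric] e rat_chain_boundary_scale b(2) ..
    have "Poly_Mapping.keys e = Poly_Mapping.keys b"
      using keys_rat_of_chain[of e] N unfolding e by simp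
    then have "singular_chain (Suc n) X e"
      using b(1) by (simp add: rat_chain_set_def singular_chain_def)
    then have bd: "singular_relboundary n X {} (chain_boundary (Suc n) e)"
      unfolding singular_boundary by blast
    note dc = singular_relboundary_imp_relcycle[OF bd]
    have c: "c \<in> carrier (rat_cycle_module n X)" using rat_cycle_iff[OF N d] dc by blast
    then show "c \<in> carrier (rat_cycle_module n X) \<and> \<Phi> c = (\<lambda>_. 0)"
      using Phi[OF c N d] ker[OF dc] bd by simp
  qed
  have Phi_range: "\<Phi> c \<in> carrier ?V" if c: "c \<in> carrier (rat_cycle_module n X)" for c
  proof -
    obtain N d where N: "N > 0" and d: "rat_of_chain d = rat_scale (rat_of_int N) c"
      by (rule ex_int_multiple)
    have "singular_relcycle n X {} d" using rat_cycle_iff[OF N d] c by blast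
    then show ?thesis using range by (simp add: Phi[OF c N d] rat_power_def)
  qed
  interpret Z: group ?Z by (rule rat_cycle_add_group)
  interpret V: group ?V by (rule rat_power_group)
  have closed: "a + b \<in> carrier (rat_cycle_module n X)"
    if "a \<in> carrier (rat_cycle_module n X)" "b \<in> carrier (rat_cycle_module n X)" for a b
    using Z.m_closed[of a b] that by (simp add: rat_cycle_module_def)
  interpret group_hom ?Z ?V \<Phi>
  proof unfold_locales
    show "\<Phi> \<in> hom ?Z ?V"
      unfolding hom_def using Phi_range Phi_add closed
        by (simp add: rat_cycle_module_def rat_power_def)
  qed
  have kernel: "kernel ?Z ?V \<Phi> = rat_boundary_set n X"
    using Phi_ker by (auto simp: kernel_def rat_power_def)
  have "\<Phi> ` carrier ?Z = carrier ?V"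
  proof (intro equalityI subsetI)
    fix v assume "v \<in> carrier ?V"
    then have v: "v i = 0" if "k \<le> i" for i using that by (simp add: rat_power_def)
    have "{i. v i \<noteq> 0} \<subseteq> {..<k}" using v by (auto simp: not_le[symmetric])
    then have "finite {i. v i \<noteq> 0}" by (rule finite_subset) simp
    then have lv: "Poly_Mapping.lookup (Abs_poly_mapping v) = v" by simp
    \<comment> \<open>The tuple is read as a finitely supported function, so the lemma on chains
      clears its denominators as well. The resulting integer tuple is lifted through
      \<open>h\<close> and the lift is divided by \<open>N\<close>.\<close>
    obtain N w where N: "N > 0" and w: "rat_of_chain w = rat_scale (rat_of_int N) (Abs_poly_mapping v)"
      by (rule ex_int_multiple)
    have wi: "rat_of_int (Poly_Mapping.lookup w i) = rat_of_int N * v i" for i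
      using arg_cong[OF w, of "\<lambda>c. Poly_Mapping.lookup c i"] lv by simp
    have "Poly_Mapping.lookup w i = 0" if "k \<le> i" for i
      using wi[of i] v[OF that] by simp
    then obtain d where d: "singular_relcycle n X {} d" "\<psi> d = Poly_Mapping.lookup w"
      using surj by blast
    let ?c = "rat_scale (1 / rat_of_int N) (rat_of_chain d)"
    have dc: "rat_of_chain d = rat_scale (rat_of_int N) ?c"
      unfolding rat_scale_scale using N by simp
    have c: "?c \<in> carrier (rat_cycle_module n X)" using rat_cycle_iff[OF N dc] d(1) by blast
    have "\<Phi> ?c = v"
      unfolding Phi[OF c N dc] d(2) wi using N by (simp add: fun_eq_iff)
    then show "v \<in> \<Phi> ` carrier ?Z" using c by force
  qed (use Phi_range in auto)
  from FactGroup_iso_set[OF this]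
  have iso: "(\<lambda>A. the_elem (\<Phi> ` A)) \<in> iso (?Z Mod rat_boundary_set n X) ?V"
    unfolding kernel .
  \<comment> \<open>The quotient module and the factor group have the same cosets and the same
    addition, so the isomorphism carries over unchanged.\<close>
  have iso': "(\<lambda>A. the_elem (\<Phi> ` A)) \<in> iso (add_monoid (rat_homology n X)) ?V"
    using iso by (simp add: iso_def hom_def rat_homology_def quotient_module_def FactGroup_def A_RCOSETS_def set_add_def)
  have "the_elem (\<Phi> ` (a \<odot>\<^bsub>rat_homology n X\<^esub> A)) = a \<odot>\<^bsub>rat_power k\<^esub> the_elem (\<Phi> ` A)"
    if A: "A \<in> carrier (rat_homology n X)" for a A
  proof -
    have "A \<in> rcosets\<^bsub>?Z\<^esub> rat_boundary_set n X"
      using A by (simp add: rat_homology_def quotient_module_def A_RCOSETS_def)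
    then obtain c where c: "c \<in> carrier (rat_cycle_module n X)" and "A = rat_boundary_set n X #>\<^bsub>?Z\<^esub> c"
      unfolding RCOSETS_def by auto
    then have A: "A = {b + c | b. b \<in> rat_boundary_set n X}"
      by (auto simp: r_coset_def rat_cycle_module_def)
    have B: "b \<in> carrier (rat_cycle_module n X)" "\<Phi> b = (\<lambda>_. 0)"
      if "b \<in> rat_boundary_set n X" for b
      using Phi_ker[of b] that by blast+
    have 0: "0 \<in> rat_boundary_set n X"
      using Z.one_closed hom_one Phi_ker[of 0] by (simp add: rat_cycle_module_def rat_power_def)
    have PhiA: "\<Phi> x = \<Phi> c \<and> x \<in> carrier (rat_cycle_module n X)" if "x \<in> A"
      for x
      using that Phi_add[OF B(1) c closed[OF B(1) c]] B closed[OF B(1) c] unfolding A by auto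
    have cA: "c \<in> A" unfolding A using 0 by force
    have imgA: "\<Phi> ` A = {\<Phi> c}" using PhiA cA by blast
    let ?aA = "a \<odot>\<^bsub>rat_homology n X\<^esub> A"
    have aA: "?aA = {b + rat_scale a x | b x. b \<in> rat_boundary_set n X \<and> x \<in> A}"
      by (auto simp: rat_homology_def quotient_module_def set_add_def set_mult_def rat_cycle_module_def rat_scale_def)
    have sc: "rat_scale a x \<in> carrier (rat_cycle_module n X)"
      if "x \<in> carrier (rat_cycle_module n X)" for x
    proof -
      have "Poly_Mapping.keys (rat_scale a x) \<subseteq> Poly_Mapping.keys x"
        by (auto simp: in_keys_iff)
      then show ?thesis
        using that by (auto simp: rat_cycle_module_def rat_chain_set_def rat_chain_boundary_scale)
    qed
    \<comment> \<open>\<open>\<Phi>\<close> vanishes on boundaries, so it takes on the scaled coset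
      only the value of \<open>\<Phi> c\<close> scaled by \<open>a\<close>. For \<open>a = 0\<close>
      the added boundaries make the coset full, and the argument is the same.\<close>
    have H: "\<Phi> y = (\<lambda>i. a * \<Phi> c i)" if yA: "y \<in> ?aA" for y
    proof -
      obtain b x where y: "y = b + rat_scale a x" "b \<in> rat_boundary_set n X" "x \<in> A"
        using yA unfolding aA by blast
      note x = PhiA[OF y(3)] and b = B[OF y(2)]
      have xs: "rat_scale a x \<in> carrier (rat_cycle_module n X)" using sc x by blast
      show ?thesis
        unfolding y(1) Phi_add[OF b(1) xs closed[OF b(1) xs]] b(2) using Phi_scale[OF _ xs] x
          by simp
    qed
    have m: "rat_scale a c \<in> ?aA"
      unfolding aA using 0 cA by force
    have "\<Phi> ` ?aA = (\<lambda>_ i. a * \<Phi> c i) ` ?aA" by (rule image_cong[OF refl H])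
    also have "\<dots> = {\<lambda>i. a * \<Phi> c i}" by (rule image_constant[OF m])
    finally have "\<Phi> ` ?aA = {\<lambda>i. a * \<Phi> c i}" .
    then show ?thesis
      unfolding imgA by (simp add: rat_power_def)
  qed
  then show ?thesis
    unfolding module_isomorphic_def
    by (intro bexI[OF _ iso']) blast
qed

section \<open>Integral homology\<close>

lemma singular_relboundary_inclusion:
  assumes "singular_relboundary p (subtopology X A) S c" "A \<subseteq> B" "S \<subseteq> T"
  shows "singular_relboundary p (subtopology X B) T c"
proof -
  obtain d e where d: "singular_chain (Suc p) (subtopology X A) d"
    and e: "singular_chain p (subtopology (subtopology X A) S) e" and eq: "chain_boundary (Suc p) d + e = c"
    using assms(1) unfolding singular_relboundary by blast
  have "singular_chain (Suc p) (subtopology X B) d" by (rule singular_chain_mono[OF d assms(2)])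
  moreover have "singular_chain p (subtopology (subtopology X B) T) e"
    using e unfolding subtopology_subtopology
      by (rule singular_chain_mono) (use assms(2,3) in blast)
  ultimately show ?thesis using eq unfolding singular_relboundary by blast
qed

lemma homologous_rel_inclusion:
  assumes "homologous_rel p (subtopology X A) S a b" "A \<subseteq> B" "S \<subseteq> T"
  shows "homologous_rel p (subtopology X B) T a b"
  using assms singular_relboundary_inclusion unfolding homologous_rel_def by blast

lemma homotopic_with_subtopology:
  fixes h :: "real \<Rightarrow> 'a \<Rightarrow> 'b"
  assumes h: "continuous_map (prod_topology (top_of_set {0..1}) (subtopology X V)) Y (\<lambda>(t, x). h t x)"
    and W: "\<And>t x. 0 \<le> t \<Longrightarrow> t \<le> 1 \<Longrightarrow> x \<in> topspace X \<Longrightarrow> x \<in> V \<Longrightarrow> h t x \<in> W"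
    and ST: "\<And>t x. 0 \<le> t \<Longrightarrow> t \<le> 1 \<Longrightarrow> x \<in> S \<Longrightarrow> h t x \<in> T"
  shows "homotopic_with (\<lambda>f. f \<in> S \<rightarrow> T) (subtopology X V) (subtopology Y W) (h 0) (h 1)"
  unfolding homotopic_with_def
proof (rule exI[where x = "\<lambda>(t, x). h t x"], intro conjI allI ballI)
  show "continuous_map (prod_topology (top_of_set {0..1}) (subtopology X V)) (subtopology Y W) (\<lambda>(t, x). h t x)"
    by (rule continuous_map_into_subtopology[OF h]) (use W in auto)
qed (use ST in auto)

lemma continuous_map_homotopy_restrict:
  assumes "continuous_map (prod_topology Z X) Y f"
  shows "continuous_map (prod_topology Z (subtopology X V)) Y f"
  unfolding prod_topology_subtopology(2) by (rule continuous_map_from_subtopology[OF assms])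

lemma singular_relcycle_empty_imp:
  assumes "singular_relcycle p X {} c"
  shows "singular_relcycle p X S c"
proof -
  have "singular_chain p X c" "chain_boundary p c = 0"
    using assms unfolding singular_cycle by blast+
  then show ?thesis unfolding singular_relcycle by simp
qed

text \<open>To bound relative to \<open>B\<close> means that \<open>c\<close> minus a chain
  \<open>e\<close> of \<open>B\<close> is an absolute boundary. Being homologous to the cycle
  \<open>c\<close>, the chain \<open>e\<close> is a cycle, and it is the required one.\<close>

lemma homologous_relI_relboundary:
  assumes c: "singular_relcycle p (subtopology X A) {} c" and b: "singular_relboundary p (subtopology X A) B c"
    and BA: "B \<subseteq> A"
  obtains c' where "singular_relcycle p (subtopology X B) {} c'" "homologous_rel p (subtopology X A) {} c c'"
proof -
  obtain d e where d: "singular_chain (Suc p) (subtopology X A) d"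
    and e: "singular_chain p (subtopology (subtopology X A) B) e" and eq: "chain_boundary (Suc p) d + e = c"
    using b unfolding singular_relboundary by blast
  have "singular_relboundary p (subtopology X A) {} (c - e)"
    unfolding singular_boundary using d eq by (intro exI[of _ d]) (simp add: eq[symmetric])
  then have hom: "homologous_rel p (subtopology X A) {} c e" unfolding homologous_rel_def .
  then have "singular_relcycle p (subtopology X A) {} e"
    using homologous_rel_singular_relcycle c by blast
  moreover have "A \<inter> B = B" using BA by blast
  then have "singular_chain p (subtopology X B) e"
    using e by (simp add: subtopology_subtopology)
  ultimately have "singular_relcycle p (subtopology X B) {} e"
    unfolding singular_cycle by simp
  then show ?thesis using that hom by blast
qed

text \<open>It is enough that \<open>c\<close> bounds relative to
  \<open>clusters_le (n - 1)\<close>. Up to relative homology, \<open>shrink\<close> moves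
  \<open>c\<close> into the closed set \<open>vertices_le n\<close>, and excision moves it off
  \<open>vertices_le (n - 1)\<close>. There exactly \<open>n\<close> vertices remain, so
  \<open>connect\<close> is continuous and pushes the cycle into
  \<open>clusters_le (n - 1)\<close>.\<close>

lemma clusters_le_step:
  assumes n: "2 \<le> n" and c: "singular_relcycle p (subtopology M_Gr (clusters_le n)) {} c"
  obtains c' where "singular_relcycle p (subtopology M_Gr (clusters_le (n - 1))) {} c'"
    "homologous_rel p (subtopology M_Gr (clusters_le n)) {} c c'"
proof -
  let ?V = "clusters_le n" and ?U = "clusters_le (n - 1)" and ?M = "vertices_le n" and ?L = "vertices_le (n - 1)"
  have UV: "?U \<subseteq> ?V" unfolding clusters_le_def by auto
  have LM: "?L \<subseteq> ?M" unfolding vertices_le_def by auto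
  have MV: "?M \<subseteq> ?V" and LU: "?L \<subseteq> ?U" by (rule vertices_le_subset_clusters_le)+
  have top: "?V \<subseteq> topspace M_Gr" "?M \<subseteq> topspace M_Gr"
    by (auto simp: clusters_le_def vertices_le_def)
  have shrink_U: "shrink t x \<in> clusters_le k" if "0 \<le> t" "t \<le> 1" "x \<in> clusters_le k"
    for t x k
    using that shrink_comps(1-3)[of t x] unfolding clusters_le_def by fastforce
  have shrink_M: "shrink 1 x \<in> ?M" if "x \<in> ?V" for x
  proof -
    have x: "x \<in> topspace M_Gr" "1 \<le> short_comps x" "short_comps x \<le> n" using that
      by (auto simp: clusters_le_def)
    note s = shrink_comps[OF zero_le_one order_refl x(1)]
    show ?thesis
      using s x(2,3) short_comps_le_zero_comps(2)[OF s(1)] unfolding vertices_le_def by fastforce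
  qed
  have cU: "singular_relcycle p (subtopology M_Gr ?V) ?U c"
    by (rule singular_relcycle_empty_imp[OF c])
  have "homotopic_with (\<lambda>f. f \<in> ?U \<rightarrow> ?U) (subtopology M_Gr ?V) (subtopology M_Gr ?V) (shrink 0) (shrink 1)"
    by (rule homotopic_with_subtopology[OF continuous_map_homotopy_restrict[OF continuous_map_shrink]])
      (use shrink_U in blast)+
  from homotopic_imp_homologous_rel_chain_maps[OF this cU]
  have "homologous_rel p (subtopology M_Gr ?V) ?U (chain_map p (shrink 0) c) (chain_map p (shrink 1) c)" .
  moreover have "chain_map p (shrink 0) c = c"
  proof (rule chain_map_id_gen)
    show "singular_chain p (subtopology M_Gr ?V) c" using c unfolding singular_cycle by blast
    show "shrink 0 x = x" if "x \<in> topspace (subtopology M_Gr ?V)" for x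
      using that shrink_comps(5)[of 0 x] by auto
  qed
  ultimately have 1: "homologous_rel p (subtopology M_Gr ?V) ?U c (chain_map p (shrink 1) c)"
    by simp
  have sh1: "continuous_map (subtopology M_Gr ?V) (subtopology M_Gr ?M) (shrink 1)"
  proof (rule continuous_map_into_subtopology)
    have "continuous_map M_Gr (prod_topology (top_of_set {0..1 :: real}) M_Gr) (\<lambda>z. (1, z))"
      by (simp add: continuous_map_pairwise o_def)
    from continuous_map_compose[OF this continuous_map_shrink]
    show "continuous_map (subtopology M_Gr ?V) M_Gr (shrink 1)"
      by (intro continuous_map_from_subtopology) (simp add: o_def)
  qed (use shrink_M in auto)
  let ?X = "subtopology M_Gr ?M" and ?W = "?U \<inter> ?M"
  have XM: "topspace ?X = ?M" using top by auto
  have XX: "subtopology ?X ?M = ?X" by (simp add: subtopology_subtopology)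
  have W: "?W = topspace ?X \<inter> ?U" unfolding XM by blast
  have "singular_relcycle p ?X ?U (chain_map p (shrink 1) c)"
    by (rule singular_relcycle_chain_map[OF cU sh1]) (use shrink_U in auto)
  then have c1: "singular_relcycle p (subtopology ?X ?M) ?W (chain_map p (shrink 1) c)"
    unfolding XX W singular_relcycle_restrict .
  \<comment> \<open>The condition for excision holds without taking proper closures or interiors:
    \<open>?L\<close> is closed, \<open>?W\<close> is open in \<open>?X\<close>, and
    \<open>?L\<close> lies in \<open>?W\<close>.\<close>
  have cl: "?X closure_of ?L \<subseteq> ?X interior_of ?W"
  proof -
    have "closedin ?X (?M \<inter> ?L)" by (rule closedin_subtopology_Int_closed[OF closedin_vertices_le])
    moreover have "?M \<inter> ?L = ?L" using LM by blast
    ultimately have "?X closure_of ?L = ?L" using closure_of_closedin by metis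
    moreover have "openin ?X ?W"
      using openin_clusters_le openin_subtopology by blast
    then have "?X interior_of ?W = ?W" by (rule interior_of_openin)
    ultimately show ?thesis using LM LU by blast
  qed
  obtain c2 where c2: "singular_relcycle p (subtopology ?X (?M - ?L)) (?W - ?L) c2"
    and h2: "homologous_rel p (subtopology ?X ?M) ?W (chain_map p (shrink 1) c) c2"
    by (rule excised_relcycle_exists[OF cl _ c1]) blast
  have "homologous_rel p (subtopology M_Gr ?V) ?U (chain_map p (shrink 1) c) c2"
    by (rule homologous_rel_inclusion[of p M_Gr ?M ?W]) (use h2 MV in \<open>simp_all add: subtopology_subtopology\<close>)
  then have 2: "homologous_rel p (subtopology M_Gr ?V) ?U c c2"
    using 1 homologous_rel_trans by blast
  \<comment> \<open>On \<open>?Y\<close> the number of vertices is exactly \<open>n\<close>. The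
    length of the new edges in \<open>?k t\<close> starts at 1, which gives the identity, and ends
    at 1/4.\<close>
  let ?Y = "?M - ?L" and ?B = "?W - ?L" and ?k = "\<lambda>t. connect (1 - 3 / 4 * t)"
  have Y: "subtopology ?X ?Y = subtopology M_Gr ?Y"
    by (simp add: subtopology_subtopology Int_absorb1)
  have c2': "singular_relcycle p (subtopology M_Gr ?Y) ?B c2" using c2 unfolding Y .
  have Ytop: "(topspace M_Gr - ?L) \<inter> ?M = ?Y" using top by blast
  have kY: "?k t x \<in> ?Y \<and> short_comps (?k t x) \<le> short_comps x"
    if t: "0 \<le> t" "t \<le> 1" and x: "x \<in> ?Y" for t x
  proof -
    have "0 < 1 - 3 / 4 * t" "1 - 3 / 4 * t \<le> 1" using t by simp_all
    from connect_comps(1-3)[OF this] show ?thesis using x unfolding vertices_le_def by auto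
  qed
  \<comment> \<open>The homotopy has to respect the pair. It does so because adding shorter edges
    never increases the number of clusters.\<close>
  have kB: "?k t x \<in> ?B" if t: "0 \<le> t" "t \<le> 1" and x: "x \<in> ?B" for t x
  proof -
    have xY: "x \<in> ?Y" using x by blast
    note k = kY[OF t xY]
    have z: "?k t x \<in> topspace M_Gr" "1 \<le> zero_comps (?k t x)" using k
      by (auto simp: vertices_le_def)
    have "1 \<le> short_comps (?k t x)" using short_comps_le_zero_comps(2)[OF z(1)] z(2) by linarith
    moreover have "short_comps x \<le> n - 1" using x by (auto simp: clusters_le_def)
    ultimately have "?k t x \<in> ?U" using k z(1) by (simp add: clusters_le_def)
    then show ?thesis using k by blast
  qed
  have "continuous_map (prod_topology (top_of_set {0..1}) (subtopology M_Gr ?Y)) M_Gr (\<lambda>(t, x). ?k t x)"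
    using continuous_map_connect[of n] n unfolding Ytop by simp
  then have "homotopic_with (\<lambda>f. f \<in> ?B \<rightarrow> ?B) (subtopology M_Gr ?Y) (subtopology M_Gr ?Y) (?k 0) (?k 1)"
    by (rule homotopic_with_subtopology) (use kY kB in blast)+
  from homotopic_imp_homologous_rel_chain_maps[OF this c2'] homotopic_with_imp_continuous_maps[OF this]
  have 3: "homologous_rel p (subtopology M_Gr ?Y) ?B (chain_map p (?k 0) c2) (chain_map p (?k 1) c2)"
    and k1: "continuous_map (subtopology M_Gr ?Y) (subtopology M_Gr ?Y) (?k 1)" by blast+
  have c2c: "singular_chain p (subtopology M_Gr ?Y) c2" using c2' unfolding singular_relcycle
    by blast
  have "chain_map p (?k 0) c2 = c2"
    by (rule chain_map_id_gen[OF c2c]) (use connect_comps(5)[of 1] in auto)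
  moreover have "singular_chain p (subtopology (subtopology M_Gr ?Y) ?B) (chain_map p (?k 1) c2)"
  proof (rule singular_chain_chain_map[OF c2c continuous_map_into_subtopology[OF k1]])
    show "?k 1 \<in> topspace (subtopology M_Gr ?Y) \<rightarrow> ?B"
    proof
      fix x assume "x \<in> topspace (subtopology M_Gr ?Y)"
      then have x: "x \<in> topspace M_Gr" "x \<in> ?Y" by auto
      note k = kY[OF zero_le_one order_refl x(2)]
      have z: "?k 1 x \<in> topspace M_Gr" "1 \<le> zero_comps (?k 1 x)" using k
        by (auto simp: vertices_le_def)
      have "1 \<le> short_comps (?k 1 x)" using short_comps_le_zero_comps(2)[OF z(1)] z(2)
        by linarith
      \<comment> \<open>At the end the new edges have length 1/4, below 1/2, so there is a single
        cluster; by \<open>n \<ge> 2\<close> this is within the bound \<open>n - 1\<close>.\<close>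
      moreover have "short_comps (?k 1 x) \<le> 1" using connect_comps(4)[of "1 - 3 / 4 * 1" x] x(1)
        by simp
      ultimately have "?k 1 x \<in> ?U" using z(1) n by (simp add: clusters_le_def)
      then show "?k 1 x \<in> ?B" using k by blast
    qed
  qed
  \<comment> \<open>A chain lying in the subspace bounds relative to it, with 0 as the bounding
    chain.\<close>
  then have "singular_relboundary p (subtopology M_Gr ?Y) ?B (chain_map p (?k 1) c2)"
    unfolding singular_relboundary by (intro exI[of _ 0] exI[of _ "chain_map p (?k 1) c2"]) simp
  ultimately have "singular_relboundary p (subtopology M_Gr ?Y) ?B c2"
    using singular_relboundary_add[of p _ ?B "c2 - chain_map p (?k 1) c2" "chain_map p (?k 1) c2"] 3
    unfolding homologous_rel_def by simp
  then have "singular_relboundary p (subtopology M_Gr ?V) ?U c2"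
    by (rule singular_relboundary_inclusion) (use MV in blast)+
  then have "singular_relboundary p (subtopology M_Gr ?V) ?U c"
    using 2 singular_relboundary_add[of p _ ?U "c - c2" c2] unfolding homologous_rel_def by simp
  from homologous_relI_relboundary[OF c this UV] that show ?thesis by blast
qed

lemma clusters_le_1:
  assumes "1 \<le> n" "singular_relcycle p (subtopology M_Gr (clusters_le n)) {} c"
  shows "\<exists>c'. singular_relcycle p (subtopology M_Gr (clusters_le 1)) {} c' \<and>
    homologous_rel p (subtopology M_Gr nonempty_graphs) {} c c'"
  using assms
proof (induction n arbitrary: c rule: nat_induct_at_least)
  case base
  then show ?case using homologous_rel_refl by blast
next
  case (Suc n)
  obtain c' where c': "singular_relcycle p (subtopology M_Gr (clusters_le n)) {} c'"
    "homologous_rel p (subtopology M_Gr (clusters_le (Suc n))) {} c c'"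
    using clusters_le_step[OF _ Suc.prems] Suc.hyps by auto
  have "clusters_le (Suc n) \<subseteq> nonempty_graphs" unfolding nonempty_graphs_eq_Union by blast
  then have "homologous_rel p (subtopology M_Gr nonempty_graphs) {} c c'"
    using homologous_rel_inclusion[OF c'(2)] by blast
  then show ?case using Suc.IH[OF c'(1)] homologous_rel_trans by blast
qed

text \<open>The image of a simplex is compact and the open sets \<open>clusters_le n\<close>
  increase to the space of nonempty graphs, so one of them contains it. A chain involves only
  finitely many simplices.\<close>

lemma singular_chain_in_clusters_le:
  assumes c: "singular_chain p (subtopology M_Gr nonempty_graphs) c"
  obtains n where "1 \<le> n" "singular_chain p (subtopology M_Gr (clusters_le n)) c"
proof -
  have mono: "clusters_le m \<subseteq> clusters_le n" if "m \<le> n" for m n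
    using that by (auto simp: clusters_le_def)
  have "\<exists>n. f ` standard_simplex p \<subseteq> clusters_le n"
    if f: "f \<in> Poly_Mapping.keys c" for f
  proof -
    have "singular_simplex p (subtopology M_Gr nonempty_graphs) f"
      using c f unfolding singular_chain_def by blast
    then have s: "singular_simplex p M_Gr f" and im: "f ` standard_simplex p \<subseteq> (\<Union>n. clusters_le n)"
      unfolding singular_simplex_subtopology nonempty_graphs_eq_Union by blast+
    have f: "continuous_map (subtopology (powertop_real UNIV) (standard_simplex p)) M_Gr f"
      using s unfolding singular_simplex_def by blast
    have "compactin (subtopology (powertop_real UNIV) (standard_simplex p)) (standard_simplex p)"
      by (simp add: compactin_subtopology compactin_standard_simplex)
    then have K: "compactin M_Gr (f ` standard_simplex p)" by (rule image_compactin[OF _ f])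
    have "\<exists>\<F>. finite \<F> \<and> \<F> \<subseteq> range clusters_le \<and> f ` standard_simplex p \<subseteq> \<Union>\<F>"
      by (rule compactinD[OF K _ im]) (auto intro: openin_clusters_le)
    then obtain \<F> where \<F>: "finite \<F>" "\<F> \<subseteq> range clusters_le" "f ` standard_simplex p \<subseteq> \<Union>\<F>"
      by (elim exE conjE)
    obtain N where N: "finite N" "\<F> = clusters_le ` N"
      using finite_subset_image[OF \<F>(1,2)] by (elim exE conjE)
    have "\<Union>\<F> \<subseteq> clusters_le (Max (insert 0 N))"
    proof
      fix z assume "z \<in> \<Union>\<F>"
      then obtain k where k: "k \<in> N" "z \<in> clusters_le k" unfolding N(2)
        by (elim UnionE imageE) simp
      have "k \<le> Max (insert 0 N)" using N(1) k(1) by (intro Max_ge) auto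
      from mono[OF this] show "z \<in> clusters_le (Max (insert 0 N))" using k(2) by (rule subsetD)
    qed
    then show ?thesis using \<F>(3) by (intro exI[of _ "Max (insert 0 N)"]) (rule order_trans)
  qed
  then obtain n where n: "\<And>f. f \<in> Poly_Mapping.keys c \<Longrightarrow> f ` standard_simplex p \<subseteq> clusters_le (n f)" by metis
  let ?n = "Max (insert 1 (n ` Poly_Mapping.keys c))"
  have "f ` standard_simplex p \<subseteq> clusters_le ?n" if "f \<in> Poly_Mapping.keys c" for f
  proof -
    have "n f \<le> ?n" using that by (intro Max_ge) auto
    from order_trans[OF n[OF that] mono[OF this]] show ?thesis .
  qed
  then have "singular_chain p (subtopology M_Gr (clusters_le ?n)) c"
    using c unfolding singular_chain_subtopology by blast
  moreover have "1 \<le> ?n" by (intro Max_ge) auto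
  ultimately show ?thesis by (rule that[rotated])
qed

text \<open>Every cycle is homologous to one in \<open>clusters_le 1\<close>, and
  \<open>shrink\<close> moves that to graphs with one vertex. There \<open>flow\<close> is a
  homotopy from the inclusion to \<open>circle_loop \<circ> total_angle\<close>, a map through the
  circle; so the circle supplies every class.\<close>

lemma cycle_from_circle:
  assumes c: "singular_relcycle p (subtopology M_Gr nonempty_graphs) {} c"
  obtains a where "singular_relcycle p (nsphere 1) {} a"
    "homologous_rel p (subtopology M_Gr nonempty_graphs) {} c (chain_map p circle_loop a)"
proof -
  let ?X = "subtopology M_Gr nonempty_graphs" and ?V = "clusters_le 1" and ?M = "vertices_le 1"
  have "singular_chain p ?X c" using c unfolding singular_cycle by blast
  then obtain n where n: "1 \<le> n" "singular_chain p (subtopology M_Gr (clusters_le n)) c"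
    by (rule singular_chain_in_clusters_le)
  have "singular_relcycle p (subtopology M_Gr (clusters_le n)) {} c"
    using n(2) c unfolding singular_cycle by blast
  then obtain c0 where c0: "singular_relcycle p (subtopology M_Gr ?V) {} c0" "homologous_rel p ?X {} c c0"
    using clusters_le_1[OF n(1)] by blast
  have VX: "?V \<subseteq> nonempty_graphs" unfolding nonempty_graphs_eq_Union by blast
  have c0c: "singular_chain p (subtopology M_Gr ?V) c0" using c0(1) unfolding singular_cycle
    by blast
  have shrink_V: "shrink t x \<in> ?V" if "0 \<le> t" "t \<le> 1" "x \<in> ?V" for t x
    using that shrink_comps(1-3)[of t x] unfolding clusters_le_def by fastforce
  have shrink_M: "shrink 1 x \<in> ?M" if "x \<in> ?V" for x
  proof -
    have x: "x \<in> topspace M_Gr" "1 \<le> short_comps x" "short_comps x \<le> 1" using that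
      by (auto simp: clusters_le_def)
    note s = shrink_comps[OF zero_le_one order_refl x(1)]
    show ?thesis
      using s x(2,3) short_comps_le_zero_comps(2)[OF s(1)] unfolding vertices_le_def by fastforce
  qed
  have "homotopic_with (\<lambda>f. f \<in> {} \<rightarrow> {}) (subtopology M_Gr ?V) ?X (shrink 0) (shrink 1)"
    by (rule homotopic_with_subtopology[OF continuous_map_homotopy_restrict[OF continuous_map_shrink]])
      (use shrink_V VX in blast)+
  from homotopic_imp_homologous_rel_chain_maps[OF this c0(1)]
  have h1: "homologous_rel p ?X {} (chain_map p (shrink 0) c0) (chain_map p (shrink 1) c0)" .
  have e1: "chain_map p (shrink 0) c0 = c0"
    by (rule chain_map_id_gen[OF c0c]) (use shrink_comps(5)[of 0] in auto)
  have 1: "homologous_rel p ?X {} c (chain_map p (shrink 1) c0)"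
    by (rule homologous_rel_trans[OF h1[unfolded e1] c0(2)])
  let ?c = "chain_map p (shrink 1) c0"
  have "continuous_map (subtopology M_Gr ?V) (subtopology M_Gr ?M) (shrink 1)"
  proof (rule continuous_map_into_subtopology)
    have "continuous_map M_Gr (prod_topology (top_of_set {0..1 :: real}) M_Gr) (\<lambda>z. (1, z))"
      by (simp add: continuous_map_pairwise o_def)
    from continuous_map_compose[OF this continuous_map_shrink]
    show "continuous_map (subtopology M_Gr ?V) M_Gr (shrink 1)"
      by (intro continuous_map_from_subtopology) (simp add: o_def)
  qed (use shrink_M in auto)
  then have cM: "singular_relcycle p (subtopology M_Gr ?M) {} ?c"
    by (rule singular_relcycle_chain_map[OF c0(1)]) simp
  then have cMc: "singular_chain p (subtopology M_Gr ?M) ?c" unfolding singular_cycle by blast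
  have "homotopic_with (\<lambda>f. f \<in> {} \<rightarrow> {}) (subtopology M_Gr ?M) ?X (flow 0) (flow 1)"
    by (rule homotopic_with_subtopology[OF continuous_map_homotopy_restrict[OF continuous_map_flow]])
      (use flow_in_nonempty_graphs in blast)+
  from homotopic_imp_homologous_rel_chain_maps[OF this cM]
  have h2: "homologous_rel p ?X {} (chain_map p (flow 0) ?c) (chain_map p (flow 1) ?c)" .
  have e2: "chain_map p (flow 0) ?c = ?c"
    by (rule chain_map_id_gen[OF cMc]) (use flow_0 in auto)
  have "chain_map p (flow 1) ?c = chain_map p (circle_loop \<circ> total_angle) ?c"
    by (rule chain_map_eq[OF cMc]) (use flow_1 in auto)
  then have e3: "chain_map p (flow 1) ?c = chain_map p circle_loop (chain_map p total_angle ?c)"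
    by (simp only: chain_map_compose o_apply)
  have "homologous_rel p ?X {} c (chain_map p circle_loop (chain_map p total_angle ?c))"
    by (rule homologous_rel_trans[OF h2[unfolded e2 e3] 1])
  moreover have "singular_relcycle p (nsphere 1) {} (chain_map p total_angle ?c)"
    by (rule singular_relcycle_chain_map[OF cM continuous_map_from_subtopology[OF continuous_map_total_angle]]) simp
  ultimately show ?thesis using that by blast
qed

text \<open>\<open>total_angle\<close> is a left inverse of \<open>circle_loop\<close>, which makes
  the induced map injective. Surjectivity on classes is \<open>cycle_from_circle\<close>.\<close>

lemma iso_homology_nonempty_graphs:
  "hom_induced (int p) (nsphere 1) {} (subtopology M_Gr nonempty_graphs) {} circle_loop
    \<in> iso (homology_group (int p) (nsphere 1)) (homology_group (int p) (subtopology M_Gr nonempty_graphs))"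
proof -
  let ?X = "subtopology M_Gr nonempty_graphs"
  have cl: "continuous_map (nsphere 1) ?X circle_loop"
    by (rule continuous_map_into_subtopology[OF continuous_map_circle_loop]) (use circle_loop_in_nonempty_graphs in auto)
  let ?h = "hom_induced (int p) (nsphere 1) {} ?X {} circle_loop"
  have "section_map (nsphere 1) ?X circle_loop"
    unfolding section_map_def retraction_maps_def
    using cl continuous_map_from_subtopology[OF continuous_map_total_angle] total_angle_circle_loop
      by blast
  then have "inj_on ?h (carrier (homology_group (int p) (nsphere 1)))"
    by (rule inj_on_hom_induced_section_map)
  moreover have "?h ` carrier (homology_group (int p) (nsphere 1)) = carrier (homology_group (int p) ?X)"
  proof (intro equalityI subsetI)
    fix A assume "A \<in> carrier (homology_group (int p) ?X)"
    then obtain c where c: "singular_relcycle p ?X {} c" "A = homologous_rel_set p ?X {} c"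
      unfolding carrier_relative_homology_group by blast
    obtain a where a: "singular_relcycle p (nsphere 1) {} a" "homologous_rel p ?X {} c (chain_map p circle_loop a)"
      by (rule cycle_from_circle[OF c(1)])
    have "?h (homologous_rel_set p (nsphere 1) {} a) = homologous_rel_set p ?X {} (chain_map p circle_loop a)"
      by (rule hom_induced_chain_map[OF cl _ a(1)]) simp
    also have "\<dots> = A" unfolding c(2) homologous_rel_set_eq
      by (rule homologous_rel_sym[THEN iffD1, OF a(2)])
    finally show "A \<in> ?h ` carrier (homology_group (int p) (nsphere 1))"
      using a(1) unfolding carrier_relative_homology_group by blast
  next
    fix A assume "A \<in> ?h ` carrier (homology_group (int p) (nsphere 1))"
    then show "A \<in> carrier (homology_group (int p) ?X)"
      using hom_induced_empty_hom[of "int p" "nsphere 1" ?X circle_loop] by (auto simp: hom_def)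
  qed
  ultimately show ?thesis
    by (simp add: iso_def bij_betw_def hom_induced_empty_hom)
qed

section \<open>Homology of the circle, of the empty graph, and of the whole space\<close>

lemma int_power_0: "trivial_group G \<Longrightarrow> G \<cong> int_power 0"
  unfolding trivial_group_def
  by (intro is_isoI[of "\<lambda>_ _. 0"] isoI homI)
    (auto simp: int_power_def bij_betw_def fun_eq_iff)

lemma int_power_1: "integer_group \<cong> int_power 1"
proof (intro is_isoI isoI homI)
  let ?f = "\<lambda>n :: int. \<lambda>i :: nat. if i = 0 then n else 0"
  have "v \<in> range ?f" if "v \<in> carrier (int_power 1)" for v
  proof
    show "v = ?f (v 0)" using that by (auto simp: int_power_def fun_eq_iff)
  qed simp
  then show "bij_betw ?f (carrier integer_group) (carrier (int_power 1))"
    by (auto simp: bij_betw_def inj_on_def int_power_def fun_eq_iff)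
qed (auto simp: int_power_def fun_eq_iff)

lemma int_power_2: "integer_group \<times>\<times> integer_group \<cong> int_power 2"
proof (intro is_isoI isoI homI)
  let ?f = "\<lambda>(m :: int, n). \<lambda>i :: nat. if i = 0 then m else if i = 1 then n else 0"
  have "v \<in> range ?f" if "v \<in> carrier (int_power 2)" for v
  proof
    show "v = ?f (v 0, v 1)" using that by (auto simp: int_power_def fun_eq_iff)
  qed simp
  moreover have "inj ?f"
  proof (rule injI)
    fix x y assume eq: "?f x = ?f y"
    show "x = y" using fun_cong[OF eq, of 0] fun_cong[OF eq, of 1] by (cases x; cases y) simp
  qed
  ultimately show "bij_betw ?f (carrier (integer_group \<times>\<times> integer_group)) (carrier (int_power 2))"
    by (auto simp: bij_betw_def DirProd_def int_power_def)
qed (auto simp: int_power_def fun_eq_iff)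

lemma DirProd_trivial_iso:
  assumes "trivial_group G"
  shows "G \<times>\<times> H \<cong> H"
proof (rule is_isoI[of snd], rule isoI)
  have "carrier G = {\<one>\<^bsub>G\<^esub>}" using assms by (simp add: trivial_group_def)
  then show "bij_betw snd (carrier (G \<times>\<times> H)) (carrier H)"
    by (auto simp: bij_betw_def inj_on_def)
qed (auto simp: hom_def)

lemma path_connected_nsphere_1: "path_connected_space (nsphere 1)"
proof -
  have cp: "continuous_map euclideanreal (nsphere 1) circle_point"
    using continuous_map_circle_point[OF continuous_map_id[unfolded id_def]] by simp
  have "circle_point ` {0..1} = topspace (nsphere 1)"
  proof (intro equalityI subsetI)
    show "w \<in> topspace (nsphere 1)" if "w \<in> circle_point ` {0..1}" for w
      using that continuous_map_image_subset_topspace[OF cp] by auto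
    show "w \<in> circle_point ` {0..1}" if "w \<in> topspace (nsphere 1)" for w
      by (rule circle_point_surj[OF that]) auto
  qed
  moreover have "path_connectedin (nsphere 1) (circle_point ` {0..1})"
    by (rule path_connectedin_continuous_map_image[OF cp]) (simp add: convex_imp_path_connected)
  ultimately show ?thesis unfolding path_connectedin_topspace[symmetric] by simp
qed

text \<open>Away from degree 0 the groups agree with the reduced homology of the sphere; in degree 0
  path connectedness decides.\<close>

lemma homology_circle:
  "homology_group 0 (nsphere 1) \<cong> integer_group"
  "homology_group 1 (nsphere 1) \<cong> integer_group"
  "p \<noteq> 0 \<Longrightarrow> p \<noteq> 1 \<Longrightarrow> trivial_group (homology_group p (nsphere 1))"
proof -
  have "circle_point 0 \<in> topspace (nsphere 1)"
    using continuous_map_circle_point[of euclideanreal "\<lambda>t. t"]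
    by (simp add: continuous_map_def Pi_iff)
  then show "homology_group 0 (nsphere 1) \<cong> integer_group"
    by (intro isomorphic_integer_zeroth_homology_group path_connected_nsphere_1) auto
  show "homology_group 1 (nsphere 1) \<cong> integer_group"
    using reduced_homology_group_nsphere(1)[of 1] un_reduced_homology_group[of 1 "nsphere 1"]
      by simp
  show "trivial_group (homology_group p (nsphere 1))" if "p \<noteq> 0" "p \<noteq> 1"
    using reduced_homology_group_nsphere(2)[of p 1] un_reduced_homology_group[of p "nsphere 1"] that
      by simp
qed

definition empty_graphs :: "((nat \<times> flag_class) \<times> (nat \<Rightarrow> real)) set set" where
  "empty_graphs = {z \<in> topspace M_Gr. zero_comps z = 0}"

text \<open>Whether a graph has vertices does not depend on the lengths, so for each graph the
  condition holds for all lengths or for none.\<close>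

lemma openin_empty_graphs: "openin M_Gr empty_graphs"
proof (rule openin_M_Gr)
  fix G :: "(nat, nat) multigraph" assume G: "finite_multigraph G"
  let ?X = "subtopology (powertop_real UNIV) {l :: nat \<Rightarrow> real. unit_lengths G l}"
  have "metric_point G l \<in> empty_graphs \<longleftrightarrow> verts G = {}"
    if "unit_lengths G l" for l
    using metric_point_in_topspace[OF G that] zero_comps_metric_point[OF G that] num_comps_eq_0[OF G]
    by (simp add: empty_graphs_def)
  then have eq: "{l. unit_lengths G l \<and> metric_point G l \<in> empty_graphs} = (if verts G = {} then topspace ?X else {})"
    by auto
  show "openin ?X {l. unit_lengths G l \<and> metric_point G l \<in> empty_graphs}"
    unfolding eq by (cases "verts G = {}") (simp_all only: simp_thms if_True if_False openin_topspace openin_empty)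
qed (simp add: empty_graphs_def)

text \<open>Every edge has an end, so a graph without vertices has no edges either, and all such
  graphs are isomorphic.\<close>

lemma topspace_empty_graphs:
  obtains a where "topspace (subtopology M_Gr empty_graphs) = {a}"
proof -
  let ?G = "\<lparr>verts = {}, edges = {}, ends = (\<lambda>_. {})\<rparr> :: (nat, nat) multigraph"
  have G: "finite_multigraph ?G" by (simp add: finite_multigraph_def)
  have u: "unit_lengths ?G (\<lambda>_. 0)" by simp
  let ?a = "metric_point ?G (\<lambda>_. 0)"
  have "?a \<in> empty_graphs"
    using metric_point_in_topspace[OF G u] zero_comps_metric_point[OF G u] num_comps_eq_0[OF G]
    by (simp add: empty_graphs_def)
  moreover have "z = ?a" if z: "z \<in> empty_graphs" for z
  proof -
    have zt: "z \<in> topspace M_Gr" and z0: "zero_comps z = 0" using z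
      by (simp_all add: empty_graphs_def)
    obtain H :: "(nat, nat) multigraph" and l where H: "finite_multigraph H" "unit_lengths H l"
      and zH: "z = metric_point H l"
      by (rule topspace_M_Gr_cases[OF zt])
    have v: "verts H = {}"
      using z0 zero_comps_metric_point[OF H] num_comps_eq_0[OF H(1)] unfolding zH by simp
    have e: "edges H = {}"
    proof (rule ccontr)
      assume "edges H \<noteq> {}"
      then obtain e where "e \<in> edges H" by blast
      from ends_doubleton[OF H(1) this] show False using v by blast
    qed
    have "multigraph_iso id id H ?G"
      using v e by (simp add: multigraph_iso_def)
    from metric_point_iso[OF this H, of "\<lambda>_. 0"] show ?thesis
      unfolding zH e by simp
  qed
  moreover have "topspace (subtopology M_Gr empty_graphs) = empty_graphs"
    by (auto simp: empty_graphs_def)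
  ultimately show ?thesis using that[of ?a] by blast
qed

text \<open>The empty graph and the nonempty graphs form two disjoint open pieces, so homology is
  the product of that of a point and that of the circle. In degree 0 each piece contributes one copy
  of the integers.\<close>

lemma homology_M_Gr:
  "homology_group (int n) M_Gr \<cong> int_power (if n = 0 then 2 else if n = 1 then 1 else 0)"
proof -
  let ?E = "homology_group (int n) (subtopology M_Gr empty_graphs)"
  let ?N = "homology_group (int n) (subtopology M_Gr nonempty_graphs)"
  let ?S = "homology_group (int n) (nsphere 1)"
  have disj: "disjnt empty_graphs nonempty_graphs"
    unfolding disjnt_iff empty_graphs_def nonempty_graphs_def by auto
  have un: "empty_graphs \<union> nonempty_graphs = topspace M_Gr"
    unfolding empty_graphs_def nonempty_graphs_def by auto
  have sum: "?E \<times>\<times> ?N \<cong> homology_group (int n) M_Gr"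
    by (rule is_isoI, rule homology_additivity_explicit[OF openin_empty_graphs openin_nonempty_graphs disj un])
  have gE: "group ?E" and gN: "group ?N" and gS: "group ?S" by (rule group_relative_homology_group)+
  have M: "homology_group (int n) M_Gr \<cong> ?E \<times>\<times> ?N"
    by (rule group.iso_sym[OF DirProd_group[OF gE gN] sum])
  have NS: "?N \<cong> ?S"
    by (rule group.iso_sym[OF gS is_isoI[OF iso_homology_nonempty_graphs]])
  obtain a where a: "topspace (subtopology M_Gr empty_graphs) = {a}" by (rule topspace_empty_graphs)
  consider "n = 0" | "n = 1" | "n \<noteq> 0" "n \<noteq> 1" by blast
  then show ?thesis
  proof cases
    case 1
    have "?E \<cong> integer_group" using homology_coefficients[OF a] unfolding 1 by simp
    moreover have "?S \<cong> integer_group" using homology_circle(1) unfolding 1 by simp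
    from iso_trans[OF NS this] have "?N \<cong> integer_group" .
    ultimately have "?E \<times>\<times> ?N \<cong> integer_group \<times>\<times> integer_group"
      by (rule group.DirProd_iso_trans[OF gE])
    from iso_trans[OF iso_trans[OF M this] int_power_2] show ?thesis
      unfolding if_P[OF 1] .
  next
    case 2
    have "trivial_group ?E" by (rule homology_dimension_axiom[OF a]) (simp add: 2)
    from DirProd_trivial_iso[OF this] have "?E \<times>\<times> ?N \<cong> ?N" .
    moreover have "?S \<cong> integer_group" using homology_circle(2) unfolding 2 by simp
    ultimately have "?E \<times>\<times> ?N \<cong> integer_group"
      using iso_trans iso_trans[OF NS] by blast
    from iso_trans[OF iso_trans[OF M this] int_power_1] show ?thesis using 2 by auto
  next
    case 3
    have "trivial_group ?E" by (rule homology_dimension_axiom[OF a]) (simp add: 3)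
    from DirProd_trivial_iso[OF this] have EN: "?E \<times>\<times> ?N \<cong> ?N" .
    have "trivial_group ?S" by (rule homology_circle(3)) (use 3 in auto)
    from iso_trans[OF iso_trans[OF iso_trans[OF M EN] NS] int_power_0[OF this]] show ?thesis
      using 3 by auto
  qed
qed

theorem corollary5p29:
  fixes n :: nat
  shows "module_isomorphic rat_ring (rat_homology n M_Gr)
           (rat_power (if n = 0 then 2 else if n = 1 then 1 else 0))"
proof -
  obtain h where "h \<in> iso (homology_group (int n) M_Gr) (int_power (if n = 0 then 2 else if n = 1 then 1 else 0))"
    using homology_M_Gr[of n] unfolding is_iso_def by blast
  then show ?thesis by (rule module_isomorphic_rat_homology)
qed

end
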